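(* Consider $\dot{\vec{x}}=\vec{f}(\vec{x})+\epsilon\,\vec{g}(\vec{x},t)$ on $\Omega\subset\mathbb{R}^3$, with $0<\epsilon\ll 1$, under the standing assumptions listed in the context, where the fixed point $\vec{a}$ of the unperturbed flow has a two-dimensional unstable manifold $\Gamma^u(\vec a)$ parametrized by $\bar{\vec x}^u(p,\alpha)$. Let $P,T\in\mathbb{R}$ be finite. Then for $(p,\alpha,t)\in(-\infty,P]\times\mathrm{S}^1\times(-\infty,T]$ the normal displacement $$d^{u}(p,\alpha,\epsilon,t)=\frac{\vec{f}(\bar{\vec{x}}^{u}(p,\alpha))\wedge\bar{\vec{x}}^{u}_\alpha(p,\alpha)}{\left|\vec{f}(\bar{\vec{x}}^{u}(p,\alpha))\wedge\bar{\vec{x}}^{u}_\alpha(p,\alpha)\right|}\cdot\left[\vec{x}^{u}(p,\alpha,\epsilon,t)-\bar{\vec{x}}^{u}(p,\alpha)\right]$$ of the perturbed unstable manifold can be expanded in $\epsilon$ in the form $$d^{u}(p,\alpha,\epsilon,t)=\epsilon\,\frac{M^u(p,\alpha,t)}{\left|\vec{f}(\bar{\vec{x}}^{u}(p,\alpha))\wedge\bar{\vec{x}}^{u}_\alpha(p,\alpha)\right|}+\mathcal{O}(\epsilon^2),$$ where the unstable Melnikov function $M^u$ is the convergent improper integral $$M^{u}(p,\alpha,t)=\int_{-\infty}^p\exp\left[\int_{\tau}^p(\nabla\cdot\vec{f})(\bar{\vec{x}}^{u}(\xi,\alpha))\,\mathrm{d}\xi\right]\left[\vec{f}(\bar{\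vec{x}}^{u}(\tau,\alpha))\wedge\bar{\vec{x}}^{u}_{\alpha}(\tau,\alpha)\right]\cdot\vec{g}(\bar{\vec{x}}^{u}(\tau,\alpha),\tau+t-p)\,\mathrm{d}\tau.$$
   Context: Here $\wedge$ is the cross product in $\mathbb{R}^3$, a subscript $\alpha$ denotes $\partial/\partial\alpha$, and $\mathrm{S}^1=[0,1)$ extended periodically with period $1$. $\mathcal{O}(\cdot)$ refers to $\epsilon\to0$. Standing assumptions. $\vec f:\Omega\to\mathbb{R}^3$ is $C^2$ with $D\vec f$ bounded on $\Omega$. $\vec g:\Omega\times\mathbb{R}\to\mathbb{R}^3$; for each $t\in\mathbb{R}$, $\vec g(\cdot,t)\in C^2(\Omega)$, and $\vec g$, $D\vec g$ (spatial derivative) are bounded on $\Omega\times\mathbb{R}$. $\vec a$ satisfies $\vec f(\vec a)=\vec 0$, and $D\vec f(\vec a)$ has one negative eigenvalue and two eigenvalues with positive real parts; the eigenvectors associated with the two-dimensional unstable subspace are linearly independent. The two-dimensional unstable manifold $\Gamma^u(\vec a)$ of $\vec a$ for $\dot{\vec x}=\vec f(\vec x)$ is $C^2$-smooth. Parametrization of $\Gamma^u(\vec a)$. The trajectories of $\dot{\vec x}=\vec f(\vec x)$ on $\Gamma^u(\vec a)$ are labelled by $\alpha\in\mathrm{S}^1$ (a small circle around $\vec a$ in the tangent plane to $\Gamma^u(\vec a)$ at $\vec a$ meets exactly one such trajectory at each angle, and $\alpha$ is the angle divided by $2\pi$), and $p$ is time along the trajectory: $\partial_p\bar{\vec x}^u(p,\alpha)=\vec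 f(\bar{\vec x}^u(p,\alpha))$, $\lim_{p\to-\infty}\bar{\vec x}^u(p,\alpha)=\vec a$. The parametrization by $(p,\alpha)\in(-\infty,P]\times\mathrm{S}^1$ is assumed $C^1$-smooth. The tangent vectors $\vec f(\bar{\vec x}^u(p,\alpha))$ and $\bar{\vec x}^u_\alpha(p,\alpha)$ are transverse at every $(p,\alpha)$, since the trajectories labelled by $\alpha$ foliate $\Gamma^u(\vec a)$; so their cross product is nonzero and normal to $\Gamma^u(\vec a)$. Perturbed manifold. For small $\epsilon\neq 0$, the fixed point $\vec a$ (viewed as the hyperbolic trajectory $(\vec a,t)$ in the phase space augmented by $\dot t=1$) persists as a hyperbolic trajectory $(\vec a_\epsilon(t),t)$ with $\vec a_\epsilon(t)$ $\mathcal{O}(\epsilon)$-close to $\vec a$ for $t\in(-\infty,T]$, and it has a perturbed unstable manifold whose time-slice $\Gamma^u_\epsilon(\vec a_\epsilon,t)$ is $\mathcal{O}(\epsilon)$-close to $\Gamma^u(\vec a)$ at finite times $t$. The point $\vec x^u(p,\alpha,\epsilon,t)$ is a point on $\Gamma^u_\epsilon(\vec a_\epsilon,t)$ that is $\mathcal{O}(\epsilon)$-close to $\bar{\vec x}^u(p,\alpha)$. The quantity $d^u(p,\alpha,\epsilon,t)$ is thus the signed displacement from the unperturbed to the perturbed manifold at time $t$, measured along the normal to $\Gamma^u(\vec a)$ at $\bar{\vec x}^u(p,\alpha)$.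
   Formalization: It is additionally assumed that g is measurable in t (otherwise the integral may be undefined) and that x^u lies on a part of the perturbed manifold whose backward trajectories stay uniformly O(ε)-close to the parametrized sheet p≤P (other sheets may accumulate on it). *)

theory Defs
  imports "HOL-Analysis.Analysis"
begin

definition C1_on :: "'a::real_normed_vector set \<Rightarrow> ('a \<Rightarrow> 'b::real_normed_vector) \<Rightarrow> bool" where
  "C1_on S f \<longleftrightarrow> (\<exists>D :: 'a \<Rightarrow> 'a \<Rightarrow>\<^sub>L 'b.
     (\<forall>x\<in>S. (f has_derivative blinfun_apply (D x)) (at x within S)) \<and> continuous_on S D)"

definition C2_on :: "'a::real_normed_vector set \<Rightarrow> ('a \<Rightarrow> 'b::real_normed_vector) \<Rightarrow> bool" where
  "C2_on S f \<longleftrightarrow> (\<exists>D :: 'a \<Rightarrow> 'a \<Rightarrow>\<^sub>L 'b.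
     (\<forall>x\<in>S. (f has_derivative blinfun_apply (D x)) (at x within S)) \<and> C1_on S D)"

definition jac :: "(real^3 \<Rightarrow> real^3) \<Rightarrow> real^3 \<Rightarrow> real^3^3" where
  "jac f x = matrix (frechet_derivative f (at x))"

definition divergence :: "(real^3 \<Rightarrow> real^3) \<Rightarrow> real^3 \<Rightarrow> real" where
  "divergence f x = trace (jac f x)"

definition C2_surface :: "(real^3) set \<Rightarrow> bool" where
  "C2_surface S \<longleftrightarrow> (\<forall>x\<in>S. \<exists>(U :: (real^3) set) (V :: (real^2) set) \<phi> \<psi>.
     open U \<and> x \<in> U \<and> open V \<and> C2_on V \<phi> \<and>
     (\<forall>u\<in>V. inj (frechet_derivative \<phi> (at u))) \<and> homeomorphism V (S \<inter> U) \<phi> \<psi>)"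

definition tangent_space :: "(real^3) set \<Rightarrow> real^3 \<Rightarrow> (real^3) set" where
  "tangent_space S x = {v. \<exists>c :: real \<Rightarrow> real^3.
     c 0 = x \<and> (\<forall>\<^sub>F s in nhds 0. c s \<in> S) \<and> (c has_vector_derivative v) (at 0)}"

definition cvec :: "real^3 \<Rightarrow> complex^3" where
  "cvec v = (\<chi> i. complex_of_real (v $ i))"

definition cmat :: "real^3^3 \<Rightarrow> complex^3^3" where
  "cmat A = (\<chi> i j. complex_of_real (A $ i $ j))"

definition eigenpair :: "real^3^3 \<Rightarrow> complex \<Rightarrow> complex^3 \<Rightarrow> bool" where
  "eigenpair A l v \<longleftrightarrow> v \<noteq> 0 \<and> cmat A *v v = l *s v"

text \<open>The two unstable eigenvalues may coincide, in which case two independent eigenvectors are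
  required.\<close>

definition saddle_with_unstable_plane :: "real^3^3 \<Rightarrow> bool" where
  "saddle_with_unstable_plane A \<longleftrightarrow>
     (\<exists>ls w. ls < 0 \<and> eigenpair A (complex_of_real ls) w) \<and>
     (\<exists>l1 l2 v1 v2. 0 < Re l1 \<and> 0 < Re l2 \<and> eigenpair A l1 v1 \<and> eigenpair A l2 v2 \<and>
        v1 \<noteq> v2 \<and> vec.independent {v1, v2})"

definition unstable_subspace :: "real^3^3 \<Rightarrow> (real^3) set" where
  "unstable_subspace A = {v. cvec v \<in> vec.span {w. \<exists>l. 0 < Re l \<and> eigenpair A l w}}"

text \<open>Solutions are understood in the integrated (Caratheodory) sense, since no continuity
  in time of the vector field is required; for a continuous vector field this is the
  classical notion.\<close>

definition trajectory_on ::
  "(real^3 \<Rightarrow> real \<Rightarrow> real^3) \<Rightarrow> (real^3) set \<Rightarrow> real set \<Rightarrow> (real \<Rightarrow> real^3) \<Rightarrow> bool" where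
  "trajectory_on F \<Omega> I y \<longleftrightarrow> (\<forall>t\<in>I. y t \<in> \<Omega>) \<and>
     (\<forall>s\<in>I. \<forall>t\<in>I. s \<le> t \<longrightarrow> ((\<lambda>\<tau>. F (y \<tau>) \<tau>) has_integral (y t - y s)) {s..t})"

text \<open>Exponential dichotomy of \<open>v' = A t v\<close> on an interval \<open>I\<close>; \<open>X\<close> is a fundamental matrix.\<close>

definition exponential_dichotomy_on :: "real set \<Rightarrow> (real \<Rightarrow> real^3^3) \<Rightarrow> bool" where
  "exponential_dichotomy_on I A \<longleftrightarrow> (\<exists>(X :: real \<Rightarrow> real^3^3) Q K \<mu>.
     0 < \<mu> \<and> Q ** Q = Q \<and> (\<forall>t\<in>I. invertible (X t)) \<and>
     (\<forall>s\<in>I. \<forall>t\<in>I. s \<le> t \<longrightarrow>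
        ((\<lambda>\<tau>. A \<tau> ** X \<tau>) has_integral (X t - X s)) {s..t} \<and>
        onorm ((*v) (X t ** Q ** matrix_inv (X s))) \<le> K * exp (- \<mu> * (t - s)) \<and>
        onorm ((*v) (X s ** (mat 1 - Q) ** matrix_inv (X t))) \<le> K * exp (- \<mu> * (t - s))))"

definition hyperbolic_trajectory_on ::
  "(real^3 \<Rightarrow> real \<Rightarrow> real^3) \<Rightarrow> (real^3) set \<Rightarrow> real set \<Rightarrow> (real \<Rightarrow> real^3) \<Rightarrow> bool" where
  "hyperbolic_trajectory_on F \<Omega> I \<gamma> \<longleftrightarrow> trajectory_on F \<Omega> I \<gamma> \<and>
     exponential_dichotomy_on I (\<lambda>t. jac (\<lambda>x. F x t) (\<gamma> t))"

definition unstable_trajectory ::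
  "(real^3 \<Rightarrow> real \<Rightarrow> real^3) \<Rightarrow> (real^3) set \<Rightarrow> (real \<Rightarrow> real^3) \<Rightarrow> real \<Rightarrow> (real \<Rightarrow> real^3) \<Rightarrow> bool" where
  "unstable_trajectory F \<Omega> \<gamma> t y \<longleftrightarrow>
     trajectory_on F \<Omega> {..t} y \<and> ((\<lambda>s. y s - \<gamma> s) \<longlongrightarrow> 0) at_bot"

definition unstable_manifold ::
  "(real^3 \<Rightarrow> real \<Rightarrow> real^3) \<Rightarrow> (real^3) set \<Rightarrow> (real \<Rightarrow> real^3) \<Rightarrow> real \<Rightarrow> (real^3) set" where
  "unstable_manifold F \<Omega> \<gamma> t = {y t | y. unstable_trajectory F \<Omega> \<gamma> t y}"

text \<open>The global unstable manifold may accumulate on itself, so that closeness to another unstable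
  manifold makes sense only for a part of it.  Such a part has to contain the backward
  trajectories of its points; it is given here by its time-slices \<open>G t\<close>, \<open>t \<le> T\<close>.\<close>

definition unstable_manifold_part ::
  "(real^3 \<Rightarrow> real \<Rightarrow> real^3) \<Rightarrow> (real^3) set \<Rightarrow> (real \<Rightarrow> real^3) \<Rightarrow> real \<Rightarrow>
   (real \<Rightarrow> (real^3) set) \<Rightarrow> bool" where
  "unstable_manifold_part F \<Omega> \<gamma> T G \<longleftrightarrow> (\<forall>t\<le>T. G t \<subseteq> unstable_manifold F \<Omega> \<gamma> t \<and>
     (\<forall>x\<in>G t. \<exists>y. trajectory_on F \<Omega> {..t} y \<and> y t = x \<and> (\<forall>s\<le>t. y s \<in> G s)))"

text \<open>Labels in the circle are real numbers modulo 1: \<open>xb\<close> is 1-periodic in its second argument.\<close>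

definition param_set :: "real^3 \<Rightarrow> (real \<Rightarrow> real \<Rightarrow> real^3) \<Rightarrow> real set \<Rightarrow> (real^3) set" where
  "param_set a xb I = insert a {xb p \<alpha> | p \<alpha>. p \<in> I}"

definition xb_alpha :: "(real \<Rightarrow> real \<Rightarrow> real^3) \<Rightarrow> real \<Rightarrow> real \<Rightarrow> real^3" where
  "xb_alpha xb p \<alpha> = vector_derivative (\<lambda>\<beta>. xb p \<beta>) (at \<alpha>)"

definition normal_vec ::
  "(real^3 \<Rightarrow> real^3) \<Rightarrow> (real \<Rightarrow> real \<Rightarrow> real^3) \<Rightarrow> real \<Rightarrow> real \<Rightarrow> real^3" where
  "normal_vec f xb p \<alpha> = cross3 (f (xb p \<alpha>)) (xb_alpha xb p \<alpha>)"

text \<open>Each nonconstant trajectory that tends to \<open>a\<close> in backward time carries exactly one label.\<close>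

definition labels_trajectories ::
  "(real^3 \<Rightarrow> real^3) \<Rightarrow> (real^3) set \<Rightarrow> real^3 \<Rightarrow> real \<Rightarrow> (real \<Rightarrow> real \<Rightarrow> real^3) \<Rightarrow> bool" where
  "labels_trajectories f \<Omega> a P xb \<longleftrightarrow>
     (\<forall>y. unstable_trajectory (\<lambda>x _. f x) \<Omega> (\<lambda>_. a) 0 y \<and> y 0 \<noteq> a \<longrightarrow>
        (\<exists>!\<alpha>. \<alpha> \<in> {0..<1} \<and> (\<exists>s. \<forall>\<tau>\<le>0. \<tau> + s \<le> P \<longrightarrow> y \<tau> = xb (\<tau> + s) \<alpha>)))"

text \<open>The label is the angle (divided by \<open>2 * pi\<close>) at which the trajectory passes, in orthogonal
  projection to the tangent plane at \<open>a\<close>, a small circle around \<open>a\<close>.  As \<open>P\<close> is arbitrary,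
  the passage may occur only at a time \<open>q\<close> later than \<open>P\<close>.\<close>

definition angular_labels ::
  "(real^3 \<Rightarrow> real^3) \<Rightarrow> (real^3) set \<Rightarrow> real^3 \<Rightarrow> real \<Rightarrow> (real \<Rightarrow> real \<Rightarrow> real^3) \<Rightarrow> bool" where
  "angular_labels f \<Omega> a P xb \<longleftrightarrow>
     (\<exists>\<rho> e1 e2. 0 < \<rho> \<and> norm e1 = 1 \<and> norm e2 = 1 \<and> e1 \<bullet> e2 = 0 \<and>
        span {e1, e2} = tangent_space (param_set a xb {..<P}) a \<and>
        (\<forall>\<alpha>. \<exists>q y. unstable_trajectory (\<lambda>x _. f x) \<Omega> (\<lambda>_. a) q y \<and>
           (\<forall>p. p \<le> P \<and> p \<le> q \<longrightarrow> y p = xb p \<alpha>) \<and>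
           (y q - a) \<bullet> e1 = \<rho> * cos (2 * pi * \<alpha>) \<and> (y q - a) \<bullet> e2 = \<rho> * sin (2 * pi * \<alpha>)))"

text \<open>Only the part of the unstable manifold that is parametrized by \<open>p < P\<close> is required to be an
  embedded surface; the global unstable manifold is in general only immersed.\<close>

definition unstable_parametrization ::
  "(real^3 \<Rightarrow> real^3) \<Rightarrow> (real^3) set \<Rightarrow> real^3 \<Rightarrow> real \<Rightarrow> (real \<Rightarrow> real \<Rightarrow> real^3) \<Rightarrow> bool" where
  "unstable_parametrization f \<Omega> a P xb \<longleftrightarrow>
     (\<forall>p\<le>P. \<forall>\<alpha>. xb p \<alpha> \<in> \<Omega>) \<and>
     (\<forall>p\<le>P. \<forall>\<alpha>. xb p (\<alpha> + 1) = xb p \<alpha>) \<and>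
     C1_on ({..P} \<times> UNIV) (\<lambda>(p, \<alpha>). xb p \<alpha>) \<and>
     (\<forall>p\<le>P. \<forall>\<alpha>. ((\<lambda>q. xb q \<alpha>) has_vector_derivative f (xb p \<alpha>)) (at p within {..P})) \<and>
     (\<forall>\<alpha>. ((\<lambda>p. xb p \<alpha>) \<longlongrightarrow> a) at_bot) \<and>
     (\<forall>p\<le>P. \<forall>\<alpha>. normal_vec f xb p \<alpha> \<noteq> 0) \<and>
     C2_surface (param_set a xb {..<P}) \<and>
     tangent_space (param_set a xb {..<P}) a = unstable_subspace (jac f a) \<and>
     labels_trajectories f \<Omega> a P xb \<and>
     angular_labels f \<Omega> a P xb"

definition normal_displacement ::
  "(real^3 \<Rightarrow> real^3) \<Rightarrow> (real \<Rightarrow> real \<Rightarrow> real^3) \<Rightarrow> (real \<Rightarrow> real \<Rightarrow> real \<Rightarrow> real \<Rightarrow> real^3) \<Rightarrow>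
   real \<Rightarrow> real \<Rightarrow> real \<Rightarrow> real \<Rightarrow> real" where
  "normal_displacement f xb xu p \<alpha> \<epsilon> t =
     (normal_vec f xb p \<alpha> /\<^sub>R norm (normal_vec f xb p \<alpha>)) \<bullet> (xu p \<alpha> \<epsilon> t - xb p \<alpha>)"

definition melnikov_integrand ::
  "(real^3 \<Rightarrow> real^3) \<Rightarrow> (real^3 \<Rightarrow> real \<Rightarrow> real^3) \<Rightarrow> (real \<Rightarrow> real \<Rightarrow> real^3) \<Rightarrow>
   real \<Rightarrow> real \<Rightarrow> real \<Rightarrow> real \<Rightarrow> real" where
  "melnikov_integrand f g xb p \<alpha> t \<tau> =
     exp (integral {\<tau>..p} (\<lambda>\<xi>. divergence f (xb \<xi> \<alpha>))) *
     (normal_vec f xb \<tau> \<alpha> \<bullet> g (xb \<tau> \<alpha>) (\<tau> + t - p))"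

text \<open>The Henstock--Kurzweil integral over a half-line exists if and only if the corresponding
  improper integral converges, and then the two agree.\<close>

definition melnikov ::
  "(real^3 \<Rightarrow> real^3) \<Rightarrow> (real^3 \<Rightarrow> real \<Rightarrow> real^3) \<Rightarrow> (real \<Rightarrow> real \<Rightarrow> real^3) \<Rightarrow>
   real \<Rightarrow> real \<Rightarrow> real \<Rightarrow> real" where
  "melnikov f g xb p \<alpha> t = integral {..p} (melnikov_integrand f g xb p \<alpha> t)"

end

theory Submission
  imports Defs
begin

text \<open>Pair the deviation \<open>\<delta>(\<tau>) = y(\<tau> + t - p) - xb(\<tau>, \<alpha>)\<close> of a perturbed trajectory \<open>y\<close> with the solution
  \<open>w(\<tau>) = exp(\<integral> div f) N(\<tau>)\<close> of the adjoint variational equation, \<open>N\<close> being the normal: the derivative of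
  \<open>w \<bullet> \<delta>\<close> is \<open>\<epsilon>\<close> times the Melnikov integrand up to \<open>O(\<epsilon>\<^sup>2) |w|\<close>.  Two uniform estimates
  make the integration over the half-line work.  First, \<open>|w(\<tau>)| \<le> C exp(-\<kappa>(p - \<tau>)) |N(p)|\<close>: near \<open>a\<close>
  the tangent planes of the manifold lie in a cone around the unstable subspace, so \<open>w\<close> is controlled by
  its component along the stable eigenvector, which decays backward in time.  Second, \<open>\<delta> = O(\<epsilon>)\<close> for all
  \<open>\<tau> \<le> p\<close>: the part of \<open>\<delta>\<close> in the unstable coordinates contracts backward in time, and the stable part is
  dominated by it because \<open>y\<close> stays \<open>O(\<epsilon>)\<close>-close to the unperturbed manifold.\<close>

section \<open>Integral curves\<close>

text \<open>\<open>g\<close> is only measurable in time, so a perturbed trajectory is an integral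
  curve and \<open>w \<bullet> \<delta>\<close> has no classical derivative; identities and
  inequalities involving it are proved in integrated form. All constants must be uniform in
  \<open>p\<close>, \<open>\<alpha>\<close> and \<open>t\<close>, and as \<open>p\<close> tends to
  minus infinity no positive lower bound for the length of the normal is at hand. This is why the
  decay of \<open>w\<close> is stated relative to the length of \<open>N\<close> at
  \<open>p\<close>: the factor cancels in the normalized displacement. One geometric fact carries
  both half-line estimates: near \<open>a\<close>, the difference of any two points of the sheet has
  its stable coordinate bounded by the sum of its unstable ones. In the limit of nearby points it
  makes the stable eigenvector transverse to the tangent planes, whence the decay of
  \<open>w\<close>; applied to a sheet point next to \<open>y\<close> and to
  \<open>xb(\<tau>, \<alpha>)\<close> it bounds the stable part of \<open>\<delta>\<close>.
  Convergence to \<open>a\<close> backward in time is given label by label and is made uniform by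
  compactness of the circle.\<close>

lemma quadratic_increments_imp_eq:
  fixes f :: "real \<Rightarrow> 'a::euclidean_space"
  assumes "a \<le> b"
    and inc: "\<And>s t. a \<le> s \<Longrightarrow> s \<le> t \<Longrightarrow> t \<le> b \<Longrightarrow> norm (f t - f s) \<le> C * (t - s)\<^sup>2"
  shows "f a = f b"
proof -
  have "(f has_derivative (\<lambda>_. 0)) (at x within {a..b})" if x: "x \<in> {a..b}" for x
  proof -
    have bd: "norm (f y - f x) \<le> C * (y - x)\<^sup>2" if "y \<in> {a..b}" for y
      using inc[of x y] inc[of y x] x that
      by (cases "x \<le> y") (auto simp: norm_minus_commute power2_commute)
    have "((\<lambda>y. (f y - f x) /\<^sub>R \<bar>y - x\<bar>) \<longlongrightarrow> 0) (at x within {a..b})"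
    proof (rule Lim_null_comparison[where g="\<lambda>y. \<bar>C\<bar> * \<bar>y - x\<bar>"])
      show "\<forall>\<^sub>F y in at x within {a..b}. norm ((f y - f x) /\<^sub>R \<bar>y - x\<bar>) \<le> \<bar>C\<bar> * \<bar>y - x\<bar>"
        unfolding eventually_at_filter
      proof (rule always_eventually, intro allI impI)
        fix y assume y: "y \<noteq> x" "y \<in> {a..b}"
        have "norm (f y - f x) \<le> C * (y - x)\<^sup>2" using bd y by blast
        also have "\<dots> \<le> \<bar>C\<bar> * \<bar>y - x\<bar> * \<bar>y - x\<bar>"
          using mult_right_mono[OF abs_ge_self[of C], of "(y - x)\<^sup>2"]
          by (simp add: power2_eq_square mult.assoc)
        finally show "norm ((f y - f x) /\<^sub>R \<bar>y - x\<bar>) \<le> \<bar>C\<bar> * \<bar>y - x\<bar>"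
          using y by (simp add: divide_simps)
      qed
      have "((\<lambda>y. \<bar>C\<bar> * \<bar>y - x\<bar>) \<longlongrightarrow> \<bar>C\<bar> * \<bar>x - x\<bar>) (at x within {a..b})"
        by (intro tendsto_intros)
      then show "((\<lambda>y. \<bar>C\<bar> * \<bar>y - x\<bar>) \<longlongrightarrow> 0) (at x within {a..b})" by simp
    qed
    then show ?thesis
      by (simp add: has_derivative_within divide_inverse_commute)
  qed
  then have "\<exists>c. \<forall>x\<in>{a..b}. f x = c"
    by (intro has_derivative_zero_constant) auto
  then show ?thesis using assms(1) by auto
qed

text \<open>\<open>h\<close> need not be continuous, so \<open>\<delta>\<close> is merely Lipschitz
  and the product has no pointwise derivative. On \<open>{s..t}\<close> the increment of the product
  and the integral of the claimed integrand differ only by O((t - s)^2), because \<open>w\<close>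
  and \<open>\<delta>\<close> are both Lipschitz, and a function with quadratic increments is
  constant.\<close>

lemma integral_product_rule:
  fixes w :: "real \<Rightarrow> 'a::euclidean_space" and \<delta> :: "real \<Rightarrow> 'b::euclidean_space"
    and prod :: "'a \<Rightarrow> 'b \<Rightarrow> 'c::euclidean_space"
  assumes bil: "bounded_bilinear prod" and "a \<le> b"
    and w: "\<And>\<tau>. \<tau> \<in> {a..b} \<Longrightarrow> (w has_vector_derivative w' \<tau>) (at \<tau> within {a..b})"
    and w': "continuous_on {a..b} w'"
    and \<delta>: "\<And>s t. a \<le> s \<Longrightarrow> s \<le> t \<Longrightarrow> t \<le> b \<Longrightarrow> (h has_integral \<delta> t - \<delta> s) {s..t}"
    and h: "\<And>\<tau>. \<tau> \<in> {a..b} \<Longrightarrow> norm (h \<tau>) \<le> B"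
  shows "((\<lambda>\<tau>. prod (w' \<tau>) (\<delta> \<tau>) + prod (w \<tau>) (h \<tau>)) has_integral
           prod (w b) (\<delta> b) - prod (w a) (\<delta> a)) {a..b}"
proof -
  interpret bounded_bilinear prod by fact
  obtain K where K: "K > 0" "\<And>x y. norm (prod x y) \<le> norm x * norm y * K"
    using pos_bounded by blast
  have cw: "continuous_on {a..b} w"
    using has_vector_derivative_continuous[OF w] by (simp add: continuous_on_eq_continuous_within)
  have "bounded (w' ` {a..b})"
    using compact_continuous_image[OF w'] compact_imp_bounded by blast
  then obtain C where C: "C > 0" "\<And>\<tau>. \<tau> \<in> {a..b} \<Longrightarrow> norm (w' \<tau>) \<le> C"
    unfolding bounded_pos by auto
  have B0: "B \<ge> 0" using order_trans[OF norm_ge_zero h[of a]] \<open>a \<le> b\<close> by simp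
  have lip_w: "norm (w t - w s) \<le> C * (t - s)" if "a \<le> s" "s \<le> t" "t \<le> b" for s t
  proof -
    have "((w') has_integral w t - w s) {s..t}"
      using that by (intro fundamental_theorem_of_calculus has_vector_derivative_within_subset[OF w]) auto
    then have "norm (w t - w s) \<le> C * measure lborel {s..t}"
      using that C(1) by (intro has_integral_bound_real[OF _ finite.emptyI]) (auto intro!: C(2))
    then show ?thesis using that by simp
  qed
  have lip_d: "norm (\<delta> t - \<delta> s) \<le> B * (t - s)" if "a \<le> s" "s \<le> t" "t \<le> b" for s t
  proof -
    have "norm (\<delta> t - \<delta> s) \<le> B * measure lborel {s..t}"
      using that B0 h by (intro has_integral_bound_real[OF _ finite.emptyI \<delta>[OF that]]) auto
    then show ?thesis using that by simp
  qed
  have cd: "continuous_on {a..b} \<delta>"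
  proof (rule continuous_on_subset[OF lipschitz_on_continuous_on[of B "{a..b}"]])
    show "B-lipschitz_on {a..b} \<delta>"
    proof (rule lipschitz_onI[OF _ B0])
      fix x y assume "x \<in> {a..b}" "y \<in> {a..b}"
      then show "dist (\<delta> x) (\<delta> y) \<le> B * dist x y"
        using lip_d[of x y] lip_d[of y x]
        by (cases "x \<le> y") (auto simp: dist_norm norm_minus_commute)
    qed
  qed auto
  \<comment> \<open>A bounded Henstock-Kurzweil integrable function is absolutely integrable, and
    this property survives multiplication by the bounded continuous \<open>w\<close>.\<close>
  have "h absolutely_integrable_on {a..b}"
  proof (rule absolutely_integrable_integrable_bound)
    show "h integrable_on {a..b}" using \<delta>[of a b] \<open>a \<le> b\<close> by blast
    show "(\<lambda>_. B) integrable_on {a..b}" by (rule integrable_const_ivl)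
  qed (rule h)
  moreover have "w \<in> borel_measurable (lebesgue_on {a..b})"
    by (rule continuous_imp_measurable_on_sets_lebesgue[OF cw]) simp
  ultimately have "(\<lambda>\<tau>. prod (w \<tau>) (h \<tau>)) absolutely_integrable_on {a..b}"
    using absolutely_integrable_bounded_measurable_product[of prod w "{a..b}" h]
      bilinear_conv_bounded_bilinear[of prod] bil
      compact_imp_bounded[OF compact_continuous_image[OF cw compact_Icc]] by simp
  then have int2: "(\<lambda>\<tau>. prod (w \<tau>) (h \<tau>)) integrable_on {a..b}"
    using absolutely_integrable_on_def by blast
  have int1: "(\<lambda>\<tau>. prod (w' \<tau>) (\<delta> \<tau>)) integrable_on {a..b}"
    by (intro integrable_continuous_real continuous_on w' cd)
  define k where "k \<tau> = prod (w' \<tau>) (\<delta> \<tau>) + prod (w \<tau>) (h \<tau>)" for \<tau>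
  have intk: "k integrable_on {s..t}" if "a \<le> s" "t \<le> b" for s t
    unfolding k_def using integrable_on_subinterval[OF integrable_add[OF int1 int2]] that by auto
  define \<Psi> where "\<Psi> t = prod (w t) (\<delta> t) - integral {a..t} k" for t
  have "\<Psi> a = \<Psi> b"
  proof (rule quadratic_increments_imp_eq[OF \<open>a \<le> b\<close>])
    fix s t assume st: "a \<le> s" "s \<le> t" "t \<le> b"
    have "integral {a..t} k = integral {a..s} k + integral {s..t} k"
      using st intk[of a t] by (simp add: Henstock_Kurzweil_Integration.integral_combine)
    then have eq: "\<Psi> t - \<Psi> s = (prod (w t) (\<delta> t) - prod (w s) (\<delta> s)) - integral {s..t} k"
      unfolding \<Psi>_def by simp
    have i1: "((\<lambda>\<tau>. prod (w t) (h \<tau>)) has_integral prod (w t) (\<delta> t - \<delta> s)) {s..t}"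
      using has_integral_linear[OF \<delta>[OF st] bounded_linear_right[of "w t"]] by (simp add: o_def)
    have "(w' has_integral w t - w s) {s..t}"
      using st by (intro fundamental_theorem_of_calculus has_vector_derivative_within_subset[OF w]) auto
    from has_integral_linear[OF this bounded_linear_left[of "\<delta> s"]]
    have i2: "((\<lambda>\<tau>. prod (w' \<tau>) (\<delta> s)) has_integral prod (w t - w s) (\<delta> s)) {s..t}"
      by (simp add: o_def)
    have "((\<lambda>\<tau>. prod (w t) (h \<tau>) + prod (w' \<tau>) (\<delta> s) - k \<tau>) has_integral
        prod (w t) (\<delta> t - \<delta> s) + prod (w t - w s) (\<delta> s) - integral {s..t} k) {s..t}"
      by (intro has_integral_diff has_integral_add i1 i2 integrable_integral intk st)
    moreover have "prod (w t) (\<delta> t - \<delta> s) + prod (w t - w s) (\<delta> s) - integral {s..t} k = \<Psi> t - \<Psi> s"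
      unfolding eq by (simp add: diff_left diff_right)
    ultimately have hi: "((\<lambda>\<tau>. prod (w t) (h \<tau>) + prod (w' \<tau>) (\<delta> s) - k \<tau>) has_integral \<Psi> t - \<Psi> s) {s..t}"
      by simp
    have "norm (\<Psi> t - \<Psi> s) \<le> (2 * (C * B * K) * (t - s)) * measure lborel {s..t}"
    proof (rule has_integral_bound_real[OF _ finite.emptyI hi])
      show "0 \<le> 2 * (C * B * K) * (t - s)" using C K B0 st by simp
      fix \<tau> assume \<tau>: "\<tau> \<in> {s..t} - {}"
      have "prod (w t) (h \<tau>) + prod (w' \<tau>) (\<delta> s) - k \<tau> = prod (w t - w \<tau>) (h \<tau>) - prod (w' \<tau>) (\<delta> \<tau> - \<delta> s)"
        unfolding k_def by (simp add: diff_left diff_right)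
      also have "norm \<dots> \<le> norm (w t - w \<tau>) * norm (h \<tau>) * K + norm (w' \<tau>) * norm (\<delta> \<tau> - \<delta> s) * K"
        by (intro norm_triangle_le_diff add_mono K)
      also have "\<dots> \<le> (C * (t - s)) * B * K + C * (B * (t - s)) * K"
      proof -
        have \<tau>': "\<tau> \<in> {a..b}" "s \<le> \<tau>" "\<tau> \<le> t" using \<tau> st by auto
        have "C * (t - \<tau>) \<le> C * (t - s)" "B * (\<tau> - s) \<le> B * (t - s)"
          using \<tau>' C(1) B0 by (auto intro: mult_left_mono)
        then have "norm (w t - w \<tau>) \<le> C * (t - s)" "norm (\<delta> \<tau> - \<delta> s) \<le> B * (t - s)"
          using lip_w[of \<tau> t] lip_d[of s \<tau>] \<tau>' st by auto
        then show ?thesis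
          using C(1) C(2)[OF \<tau>'(1)] h[OF \<tau>'(1)] K(1) B0 st
          by (intro add_mono mult_right_mono mult_mono) auto
      qed
      finally show "norm (prod (w t) (h \<tau>) + prod (w' \<tau>) (\<delta> s) - k \<tau>) \<le> 2 * (C * B * K) * (t - s)"
        by (simp add: algebra_simps)
    qed
    then show "norm (\<Psi> t - \<Psi> s) \<le> (2 * (C * B * K)) * (t - s)\<^sup>2"
      using st by (simp add: power2_eq_square mult.assoc)
  qed
  then have "integral {a..b} k = prod (w b) (\<delta> b) - prod (w a) (\<delta> a)"
    unfolding \<Psi>_def by (simp add: algebra_simps)
  then show ?thesis
    using integrable_integral[OF intk[of a b]] unfolding k_def by simp
qed

text \<open>Continuity argument run backward from \<open>t\<close>. To violate the a priori bound
  \<open>\<eta>\<close> the norm would have to pass the level \<open>\<eta>\<close>, but at the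
  latest time where it reaches that level the hypothesis of \<open>step\<close> still holds and
  yields the strictly smaller \<open>k\<close>.\<close>

lemma backward_bootstrap:
  fixes \<delta> :: "real \<Rightarrow> 'a::real_normed_vector"
  assumes cont: "continuous_on {..t} \<delta>" and k: "norm (\<delta> t) \<le> k" "k < \<eta>"
    and step: "\<And>s. s \<le> t \<Longrightarrow> (\<And>\<sigma>. s \<le> \<sigma> \<Longrightarrow> \<sigma> \<le> t \<Longrightarrow> norm (\<delta> \<sigma>) \<le> \<eta>) \<Longrightarrow> norm (\<delta> s) \<le> k"
    and "s \<le> t"
  shows "norm (\<delta> s) \<le> k"
proof (rule step[OF \<open>s \<le> t\<close>], rule ccontr)
  fix \<sigma> assume \<sigma>: "s \<le> \<sigma>" "\<sigma> \<le> t" "\<not> norm (\<delta> \<sigma>) \<le> \<eta>"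
  have cn: "continuous_on {..t} (\<lambda>x. norm (\<delta> x))"
    by (intro continuous_intros cont)
  define S where "S = {\<sigma>..t} \<inter> (\<lambda>x. norm (\<delta> x)) -` {\<eta>..}"
  have "closed S" unfolding S_def
    by (intro continuous_closed_preimage continuous_on_subset[OF cn]) auto
  then have "compact S"
    unfolding S_def by (metis Int_lower1 bounded_closed_interval bounded_subset compact_eq_bounded_closed)
  moreover have "\<sigma> \<in> S" using \<sigma> unfolding S_def by auto
  ultimately obtain m where m: "m \<in> S" "\<And>x. x \<in> S \<Longrightarrow> x \<le> m"
    using compact_attains_sup[of S] by blast
  have mt: "m \<le> t" "\<sigma> \<le> m" "norm (\<delta> m) \<ge> \<eta>" using m(1) by (auto simp: S_def)
  have "\<exists>x\<ge>m. x \<le> t \<and> norm (\<delta> x) = \<eta>"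
    using mt k by (intro IVT2' continuous_on_subset[OF cn]) auto
  then obtain x where "m \<le> x" "x \<le> t" "norm (\<delta> x) = \<eta>" by blast
  then have xm: "norm (\<delta> m) = \<eta>" using m(2)[of x] mt by (force simp: S_def)
  have "norm (\<delta> m) \<le> k"
  proof (rule step[OF mt(1)])
    fix y assume y: "m \<le> y" "y \<le> t"
    show "norm (\<delta> y) \<le> \<eta>"
      using m(2)[of y] y xm mt by (force simp: S_def)
  qed
  then show False using xm k by simp
qed

lemma integral_curve_continuous:
  fixes \<delta> :: "real \<Rightarrow> 'a::banach"
  assumes "\<And>s t. a \<le> s \<Longrightarrow> s \<le> t \<Longrightarrow> t \<le> b \<Longrightarrow> (h has_integral \<delta> t - \<delta> s) {s..t}"
  shows "continuous_on {a..b} \<delta>"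
proof (cases "a \<le> b")
  case True
  have "h integrable_on {a..b}" using assms[of a b] True by blast
  then have "continuous_on {a..b} (\<lambda>x. \<delta> a + integral {a..x} h)"
    by (intro continuous_intros indefinite_integral_continuous_1)
  then show ?thesis
  proof (rule continuous_on_eq)
    fix x assume "x \<in> {a..b}"
    then show "\<delta> a + integral {a..x} h = \<delta> x" using integral_unique[OF assms[of a x]] by simp
  qed
qed simp

text \<open>The norm is maximized against the weight \<open>exp (- (2 * B * (b - \<tau>)))\<close>.
  The 2 in the exponent makes the integral of the linear term at most half of the quantity
  estimated, so it can be absorbed; this accounts for the leading factor 2 in the
  conclusion.\<close>

lemma backward_gronwall:
  fixes \<delta> :: "real \<Rightarrow> 'a::euclidean_space"
  assumes "a \<le> b" and L: "b - a \<le> L" and B: "B > 0" and "e \<ge> 0"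
    and \<delta>: "\<And>s t. a \<le> s \<Longrightarrow> s \<le> t \<Longrightarrow> t \<le> b \<Longrightarrow> (h has_integral \<delta> t - \<delta> s) {s..t}"
    and h: "\<And>\<tau>. \<tau> \<in> {a..b} \<Longrightarrow> norm (h \<tau>) \<le> B * norm (\<delta> \<tau>) + e"
  shows "norm (\<delta> a) \<le> 2 * exp (2 * B * L) * (norm (\<delta> b) + e * L)"
proof -
  have cd: "continuous_on {a..b} \<delta>" using \<delta> by (rule integral_curve_continuous)
  define u where "u \<tau> = norm (\<delta> \<tau>) * exp (- (2 * B * (b - \<tau>)))" for \<tau>
  have "continuous_on {a..b} u" unfolding u_def by (intro continuous_intros cd)
  then obtain \<sigma> where \<sigma>: "\<sigma> \<in> {a..b}" "\<And>\<tau>. \<tau> \<in> {a..b} \<Longrightarrow> u \<tau> \<le> u \<sigma>"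
    using continuous_attains_sup[of "{a..b}" u] \<open>a \<le> b\<close> by auto
  define m where "m = u \<sigma>"
  have m0: "m \<ge> 0" unfolding m_def u_def by simp
  have le: "norm (\<delta> \<tau>) \<le> m * exp (2 * B * (b - \<tau>))" if "\<tau> \<in> {a..b}" for \<tau>
  proof -
    have "norm (\<delta> \<tau>) = u \<tau> * exp (2 * B * (b - \<tau>))"
      unfolding u_def by (simp add: exp_minus)
    then show ?thesis using \<sigma>(2)[OF that] m_def by simp
  qed
  have FTC: "((\<lambda>\<tau>. B * m * exp (2 * B * (b - \<tau>)) + e) has_integral
      (- (m / 2) * exp (2 * B * (b - b)) + e * b) - (- (m / 2) * exp (2 * B * (b - \<sigma>)) + e * \<sigma>)) {\<sigma>..b}"
    using \<sigma>(1) B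
    by (intro fundamental_theorem_of_calculus)
       (auto simp: has_real_derivative_iff_has_vector_derivative[symmetric] intro!: derivative_eq_intros)
  have "norm (\<delta> b - \<delta> \<sigma>) \<le> (- (m / 2) * exp (2 * B * (b - b)) + e * b) - (- (m / 2) * exp (2 * B * (b - \<sigma>)) + e * \<sigma>)"
  proof -
    have hi: "(h has_integral \<delta> b - \<delta> \<sigma>) {\<sigma>..b}" using \<delta> \<sigma>(1) by auto
    have "norm (integral {\<sigma>..b} h) \<le> integral {\<sigma>..b} (\<lambda>\<tau>. B * m * exp (2 * B * (b - \<tau>)) + e)"
    proof (rule integral_norm_bound_integral)
      show "h integrable_on {\<sigma>..b}" using hi by blast
      show "(\<lambda>\<tau>. B * m * exp (2 * B * (b - \<tau>)) + e) integrable_on {\<sigma>..b}" using FTC by blast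
      fix \<tau> assume "\<tau> \<in> {\<sigma>..b}"
      then have t: "\<tau> \<in> {a..b}" using \<sigma>(1) by auto
      have "B * norm (\<delta> \<tau>) \<le> B * (m * exp (2 * B * (b - \<tau>)))"
        using le[OF t] B by (intro mult_left_mono) auto
      then show "norm (h \<tau>) \<le> B * m * exp (2 * B * (b - \<tau>)) + e"
        using h[OF t] by (simp add: mult.assoc)
    qed
    then show ?thesis using integral_unique[OF hi] integral_unique[OF FTC] by simp
  qed
  moreover have "m * exp (2 * B * (b - \<sigma>)) = norm (\<delta> \<sigma>)"
    unfolding m_def u_def by (simp add: exp_minus)
  moreover have "norm (\<delta> \<sigma>) \<le> norm (\<delta> b) + norm (\<delta> b - \<delta> \<sigma>)"
    by (metis norm_minus_commute norm_triangle_sub)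
  moreover have "e * (b - \<sigma>) \<le> e * L" using \<sigma>(1) L \<open>e \<ge> 0\<close> by (intro mult_left_mono) auto
  ultimately have "m * exp (2 * B * (b - \<sigma>)) / 2 \<le> norm (\<delta> b) + e * L"
    using m0 by (simp add: algebra_simps)
  moreover have "m \<le> m * exp (2 * B * (b - \<sigma>))"
    using mult_left_mono[of 1 "exp (2 * B * (b - \<sigma>))" m] m0 B \<sigma>(1) by simp
  ultimately have mle: "m \<le> 2 * (norm (\<delta> b) + e * L)" by simp
  have "norm (\<delta> a) \<le> m * exp (2 * B * (b - a))" using le \<open>a \<le> b\<close> by auto
  also have "\<dots> \<le> (2 * (norm (\<delta> b) + e * L)) * exp (2 * B * L)"
    using mle m0 L B by (intro mult_mono) auto
  finally show ?thesis by (simp add: algebra_simps)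
qed

section \<open>Linear saddles\<close>

text \<open>\<open>z\<close> is a left eigenvector of the linear part, so
  \<open>exp (- l * (\<tau> - a))\<close> is an integrating factor, normalized to 1 at the earlier
  end. Its modulus is at most \<open>exp (- \<mu> * (\<tau> - a))\<close>, whose integral is at most
  \<open>1 / \<mu>\<close>: the accumulated error does not depend on the length of the interval,
  which is what makes half-lines accessible.\<close>

lemma unstable_functional_backward_bound:
  fixes \<delta> :: "real \<Rightarrow> 'a::euclidean_space" and z :: "'a \<Rightarrow> complex"
  assumes A: "bounded_linear A" and z: "bounded_linear z"
    and eig: "\<And>v. z (A v) = l * z v" and \<mu>: "0 < \<mu>" "\<mu> \<le> Re l"
    and K: "\<And>v. norm (z v) \<le> K * norm v" "K \<ge> 0"
    and "a \<le> b"
    and \<delta>: "\<And>s t. a \<le> s \<Longrightarrow> s \<le> t \<Longrightarrow> t \<le> b \<Longrightarrow> (h has_integral \<delta> t - \<delta> s) {s..t}"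
    and h: "\<And>\<tau>. \<tau> \<in> {a..b} \<Longrightarrow> norm (h \<tau> - A (\<delta> \<tau>)) \<le> R"
  shows "norm (z (\<delta> a)) \<le> norm (z (\<delta> b)) + K * R / \<mu>"
proof -
  interpret z: bounded_linear z by fact
  interpret A: bounded_linear A by fact
  have R0: "R \<ge> 0" using order_trans[OF norm_ge_zero h[of a]] \<open>a \<le> b\<close> by simp
  have cd: "continuous_on {a..b} \<delta>" using \<delta> by (rule integral_curve_continuous)
  have "continuous_on {a..b} (\<lambda>\<tau>. A (\<delta> \<tau>))" by (intro A.continuous_on cd)
  then have "bounded ((\<lambda>\<tau>. A (\<delta> \<tau>)) ` {a..b})"
    by (intro compact_imp_bounded compact_continuous_image) auto
  then obtain M where M: "\<And>\<tau>. \<tau> \<in> {a..b} \<Longrightarrow> norm (A (\<delta> \<tau>)) \<le> M"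
    unfolding bounded_iff by (metis imageI)
  define w where "w \<tau> = exp (- l * (of_real \<tau> - of_real a))" for \<tau>
  have nw: "norm (w \<tau>) \<le> exp (- \<mu> * (\<tau> - a))" if "\<tau> \<in> {a..b}" for \<tau>
    unfolding w_def using that \<mu> by (simp add: mult_right_mono)
  have "((\<lambda>\<tau>. (- l * w \<tau>) * z (\<delta> \<tau>) + w \<tau> * z (h \<tau>)) has_integral
      w b * z (\<delta> b) - w a * z (\<delta> a)) {a..b}"
  proof (rule integral_product_rule[OF bounded_bilinear_mult \<open>a \<le> b\<close>])
    show "(w has_vector_derivative - l * w \<tau>) (at \<tau> within {a..b})" for \<tau>
      unfolding w_def
      by (rule has_vector_derivative_real_field[where f="\<lambda>x. exp (- l * (x - of_real a))"])
         (auto intro!: derivative_eq_intros)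
    show "continuous_on {a..b} (\<lambda>\<tau>. - l * w \<tau>)"
      unfolding w_def by (intro continuous_intros)
    show "((\<lambda>\<tau>. z (h \<tau>)) has_integral z (\<delta> t) - z (\<delta> s)) {s..t}" if "a \<le> s" "s \<le> t" "t \<le> b" for s t
      using has_integral_linear[OF \<delta>[OF that] z] by (simp add: o_def z.diff)
    show "norm (z (h \<tau>)) \<le> K * (R + M)" if "\<tau> \<in> {a..b}" for \<tau>
    proof -
      have "norm (h \<tau>) \<le> R + M"
        using h[OF that] M[OF that] norm_triangle_sub[of "h \<tau>" "A (\<delta> \<tau>)"] by linarith
      then show ?thesis using K order_trans mult_left_mono by blast
    qed
  qed
  moreover have "(- l * w \<tau>) * z (\<delta> \<tau>) + w \<tau> * z (h \<tau>) = w \<tau> * z (h \<tau> - A (\<delta> \<tau>))" for \<tau>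
    by (simp add: z.diff eig algebra_simps)
  ultimately have I: "((\<lambda>\<tau>. w \<tau> * z (h \<tau> - A (\<delta> \<tau>))) has_integral w b * z (\<delta> b) - w a * z (\<delta> a)) {a..b}"
    by simp
  have J: "((\<lambda>\<tau>. K * R * exp (- \<mu> * (\<tau> - a))) has_integral
      (- (K * R / \<mu>) * exp (- \<mu> * (b - a))) - (- (K * R / \<mu>) * exp (- \<mu> * (a - a)))) {a..b}"
    using \<mu> \<open>a \<le> b\<close>
    by (intro fundamental_theorem_of_calculus)
       (auto simp: has_real_derivative_iff_has_vector_derivative[symmetric] intro!: derivative_eq_intros)
  have "norm (w b * z (\<delta> b) - w a * z (\<delta> a)) \<le> K * R / \<mu> - K * R / \<mu> * exp (- \<mu> * (b - a))"
  proof -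
    have "norm (integral {a..b} (\<lambda>\<tau>. w \<tau> * z (h \<tau> - A (\<delta> \<tau>))))
        \<le> integral {a..b} (\<lambda>\<tau>. K * R * exp (- \<mu> * (\<tau> - a)))"
    proof (rule integral_norm_bound_integral)
      fix \<tau> assume \<tau>: "\<tau> \<in> {a..b}"
      have "norm (z (h \<tau> - A (\<delta> \<tau>))) \<le> K * R"
        using K h[OF \<tau>] order_trans mult_left_mono by blast
      then show "norm (w \<tau> * z (h \<tau> - A (\<delta> \<tau>))) \<le> K * R * exp (- \<mu> * (\<tau> - a))"
        using nw[OF \<tau>] by (subst mult.commute, simp add: norm_mult mult_mono K R0)
    qed (use I J in blast)+
    then show ?thesis using integral_unique[OF I] integral_unique[OF J] by simp
  qed
  also have "\<dots> \<le> K * R / \<mu>" using K R0 \<mu> by simp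
  finally have "norm (w b * z (\<delta> b) - z (\<delta> a)) \<le> K * R / \<mu>" by (simp add: w_def)
  moreover have "norm (w b * z (\<delta> b)) \<le> 1 * norm (z (\<delta> b))"
    unfolding norm_mult using nw[of b] \<mu> \<open>a \<le> b\<close>
    by (intro mult_right_mono) (auto intro: order_trans)
  moreover have "norm (z (\<delta> a)) \<le> norm (w b * z (\<delta> b)) + norm (w b * z (\<delta> b) - z (\<delta> a))"
    by (metis norm_minus_commute norm_triangle_sub)
  ultimately show ?thesis by simp
qed

text \<open>\<open>z1\<close> and \<open>z2\<close> are left eigenvectors for the unstable eigenvalues, so the linearized
  dynamics is diagonal in these complex coordinates even when the eigenvalues are not real.\<close>

locale saddle_coordinates =
  fixes A :: "'a::euclidean_space \<Rightarrow> 'a" and zs z1 z2 :: "'a \<Rightarrow> complex"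
    and l1 l2 :: complex and ls :: real and es :: 'a and \<mu> K c :: real
  assumes A: "bounded_linear A"
    and zs: "bounded_linear zs" and z1: "bounded_linear z1" and z2: "bounded_linear z2"
    and z1_A: "z1 (A v) = l1 * z1 v" and z2_A: "z2 (A v) = l2 * z2 v"
    and es: "A es = ls *\<^sub>R es" "zs es = 1" "z1 es = 0" "z2 es = 0"
    and \<mu>: "0 < \<mu>" "\<mu> \<le> Re l1" "\<mu> \<le> Re l2" "\<mu> \<le> - ls"
    and K: "0 < K" "norm (zs v) \<le> K * norm v" "norm (z1 v) \<le> K * norm v" "norm (z2 v) \<le> K * norm v"
    and c: "0 < c" "norm v \<le> c * (norm (zs v) + norm (z1 v) + norm (z2 v))"
begin

text \<open>The norm is estimated at its maximum point \<open>\<sigma>\<close>. There the unstable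
  coordinates are bounded by the data at \<open>b\<close> plus the nonlinear error, the cone
  condition passes this on to the stable coordinate, and the smallness of \<open>\<eta>\<close> lets
  half of the maximum be absorbed. The constants are independent of \<open>b - a\<close>.\<close>

lemma backward_stability:
  fixes \<delta> :: "real \<Rightarrow> 'a"
  assumes "a \<le> b" and \<eta>: "0 \<le> \<eta>" "8 * c * K * \<eta> \<le> \<mu>" and e: "0 \<le> e1" "0 \<le> e2"
    and \<delta>: "\<And>s t. a \<le> s \<Longrightarrow> s \<le> t \<Longrightarrow> t \<le> b \<Longrightarrow> (h has_integral \<delta> t - \<delta> s) {s..t}"
    and h: "\<And>\<tau>. \<tau> \<in> {a..b} \<Longrightarrow> norm (h \<tau> - A (\<delta> \<tau>)) \<le> \<eta> * norm (\<delta> \<tau>) + e1"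
    and cone: "\<And>\<tau>. \<tau> \<in> {a..b} \<Longrightarrow>
      norm (zs (\<delta> \<tau>)) \<le> norm (z1 (\<delta> \<tau>)) + norm (z2 (\<delta> \<tau>)) + e2"
  shows "norm (\<delta> a) \<le> 8 * c * K * (norm (\<delta> b) + e1 / \<mu>) + 2 * c * e2"
proof -
  have "continuous_on {a..b} (\<lambda>\<tau>. norm (\<delta> \<tau>))"
    by (intro continuous_intros integral_curve_continuous[OF \<delta>])
  then obtain \<sigma> where \<sigma>: "\<sigma> \<in> {a..b}" "\<And>\<tau>. \<tau> \<in> {a..b} \<Longrightarrow> norm (\<delta> \<tau>) \<le> norm (\<delta> \<sigma>)"
    using continuous_attains_sup[of "{a..b}" "\<lambda>\<tau>. norm (\<delta> \<tau>)"] \<open>a \<le> b\<close> by auto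
  define D where "D = norm (\<delta> \<sigma>)"
  have hD: "norm (h \<tau> - A (\<delta> \<tau>)) \<le> \<eta> * D + e1" if "\<tau> \<in> {\<sigma>..b}" for \<tau>
  proof -
    have "\<tau> \<in> {a..b}" using that \<sigma>(1) by auto
    then show ?thesis
      using h[of \<tau>] mult_left_mono[OF \<sigma>(2)[of \<tau>] \<eta>(1)] unfolding D_def by simp
  qed
  have bd: "norm (z (\<delta> \<sigma>)) \<le> K * norm (\<delta> b) + K * (\<eta> * D + e1) / \<mu>"
    if "bounded_linear z" "\<And>v. z (A v) = l * z v" "\<mu> \<le> Re l" "\<And>v. norm (z v) \<le> K * norm v" for z l
  proof -
    have "norm (z (\<delta> \<sigma>)) \<le> norm (z (\<delta> b)) + K * (\<eta> * D + e1) / \<mu>"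
      by (rule unstable_functional_backward_bound[OF A that(1) that(2) \<mu>(1) that(3) that(4) _ _ \<delta> hD])
         (use \<sigma>(1) K(1) in auto)
    then show ?thesis using that(4)[of "\<delta> b"] by simp
  qed
  define q where "q = K * norm (\<delta> b) + K * (\<eta> * D + e1) / \<mu>"
  have q: "norm (z1 (\<delta> \<sigma>)) \<le> q" "norm (z2 (\<delta> \<sigma>)) \<le> q"
    unfolding q_def
    by (rule bd[OF z1 z1_A \<mu>(2) K(3)], rule bd[OF z2 z2_A \<mu>(3) K(4)])
  \<comment> \<open>Each of the two unstable coordinates is at most \<open>q\<close>, and through
    the cone condition their sum counts once more as a bound for the stable one.\<close>
  have "D \<le> c * (4 * q + e2)"
    unfolding D_def
    by (rule order_trans[OF c(2) mult_left_mono]) (use q cone[OF \<sigma>(1)] c(1) in auto)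
  also have "\<dots> = 4 * c * K * (norm (\<delta> b) + e1 / \<mu>) + c * e2 + (4 * c * K * \<eta> / \<mu>) * D"
    unfolding q_def by (simp add: algebra_simps add_divide_distrib)
  also have "(4 * c * K * \<eta> / \<mu>) * D \<le> (1 / 2) * D"
    using \<eta> \<mu>(1) by (intro mult_right_mono) (auto simp: D_def field_simps)
  finally have "D \<le> 8 * c * K * (norm (\<delta> b) + e1 / \<mu>) + 2 * c * e2" by simp
  then show ?thesis using \<sigma>(2)[of a] \<open>a \<le> b\<close> by (simp add: D_def)
qed

end

section \<open>Spectral coordinates from complex eigenvectors\<close>

lemma cmat_mult_cvec: "cmat A *v cvec v = cvec (A *v v)"
  by (simp add: vec_eq_iff matrix_vector_mult_def cmat_def cvec_def)

lemma bounded_linear_cvec: "bounded_linear cvec"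
proof -
  have "linear cvec"
    by (rule linearI) (simp_all add: cvec_def vec_eq_iff, simp add: scaleR_conv_of_real)
  then show ?thesis by (simp add: linear_conv_bounded_linear)
qed

text \<open>For a real matrix and a real eigenvalue the real and imaginary parts of an eigenvector
  satisfy the eigenvalue equation separately, and they do not both vanish.\<close>

lemma real_eigenvector:
  assumes "eigenpair A (complex_of_real l) w"
  obtains e where "e \<noteq> 0" "A *v e = l *s e"
proof -
  have w: "w \<noteq> 0" "cmat A *v w = complex_of_real l *s w" using assms by (auto simp: eigenpair_def)
  define x y where "x = (\<chi> i. Re (w $ i))" and "y = (\<chi> i. Im (w $ i))"
  have "A *v x = l *s x" "A *v y = l *s y"
    using arg_cong[OF w(2), of "\<lambda>v. \<chi> i. Re (v $ i)"] arg_cong[OF w(2), of "\<lambda>v. \<chi> i. Im (v $ i)"]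
    by (simp_all add: x_def y_def vec_eq_iff matrix_vector_mult_def cmat_def)
  moreover have "x \<noteq> 0 \<or> y \<noteq> 0"
    using w(1) by (auto simp: x_def y_def vec_eq_iff complex_eq_iff)
  ultimately show ?thesis using that by blast
qed

text \<open>The three eigenvectors are the columns of an invertible matrix \<open>E\<close>; the
  rows of its inverse are left eigenvectors and give the coordinates \<open>z i\<close>.
  \<open>K\<close> and \<open>1 / m\<close> express the equivalence of norms in finite
  dimension.\<close>

lemma saddle_coordinates_exist:
  assumes "saddle_with_unstable_plane M"
  obtains zs z1 z2 l1 l2 ls es \<mu> K c where "saddle_coordinates ((*v) M) zs z1 z2 l1 l2 ls es \<mu> K c"
    "\<And>v. v \<in> unstable_subspace M \<Longrightarrow> zs v = 0"
proof -
  obtain ls w l1 l2 v1 v2 where ls: "ls < 0" "eigenpair M (complex_of_real ls) w"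
    and l: "0 < Re l1" "0 < Re l2" and ev: "eigenpair M l1 v1" "eigenpair M l2 v2"
    and ind: "v1 \<noteq> v2" "vec.independent {v1, v2}"
    using assms unfolding saddle_with_unstable_plane_def by metis
  have W: "w \<noteq> 0" "cmat M *v w = complex_of_real ls *s w"
    and V: "cmat M *v v1 = l1 *s v1" "cmat M *v v2 = l2 *s v2"
    using ls ev by (auto simp: eigenpair_def)
  define E :: "complex^3^3" where "E = (\<chi> i j. (if j = 1 then w else if j = 2 then v1 else v2) $ i)"
  have E: "E *v x = x $ 1 *s w + x $ 2 *s v1 + x $ 3 *s v2" for x :: "complex^3"
    by (simp add: E_def matrix_vector_mult_def vec_eq_iff sum_3 mult.commute)
  have ind2: "c1 = 0 \<and> c2 = 0" if "c1 *s v1 + c2 *s v2 = 0" for c1 c2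
  proof -
    have "(\<Sum>v\<in>{v1, v2}. (if v = v1 then c1 else c2) *s v) = 0" using that ind(1) by simp
    from vec.independentD[OF ind(2) _ subset_refl this, of v1] vec.independentD[OF ind(2) _ subset_refl this, of v2]
    show ?thesis using ind(1) by simp
  qed
  have "x = 0" if "E *v x = 0" for x
  proof -
    have 0: "x $ 1 *s w + x $ 2 *s v1 + x $ 3 *s v2 = 0" using that E by simp
    \<comment> \<open>Applying \<open>cmat M\<close> minus \<open>ls\<close> removes
      \<open>w\<close> and leaves a relation between \<open>v1\<close> and \<open>v2\<close> alone.
      Its factors \<open>l1 - ls\<close> and \<open>l2 - ls\<close> are nonzero because the real
      parts have opposite signs.\<close>
    have "cmat M *v (x $ 1 *s w + x $ 2 *s v1 + x $ 3 *s v2) - of_real ls *s (x $ 1 *s w + x $ 2 *s v1 + x $ 3 *s v2) = 0"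
      unfolding 0 by simp
    then have "(x $ 2 * (l1 - of_real ls)) *s v1 + (x $ 3 * (l2 - of_real ls)) *s v2 = 0"
      by (simp add: vec.add vec.scale matrix_vector_right_distrib vector_scalar_commute W V
          vector_add_ldistrib vector_smult_assoc vector_ssub_ldistrib algebra_simps vec_eq_iff)
    from ind2[OF this] have "x $ 2 = 0" "x $ 3 = 0" using l ls by auto
    with 0 W(1) have "x $ 1 = 0" by simp
    then show ?thesis using \<open>x $ 2 = 0\<close> \<open>x $ 3 = 0\<close> by (simp add: vec_eq_iff forall_3)
  qed
  then obtain B where B: "B ** E = mat 1" using matrix_left_invertible_ker by blast
  then have B': "E ** B = mat 1" by (simp add: matrix_left_right_inverse)
  define D where "D x = (\<chi> i. (if i = 1 then of_real ls else if i = 2 then l1 else l2) * x $ i)" for x :: "complex^3"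
  have ME: "cmat M *v (E *v x) = E *v (D x)" for x
    unfolding E
    by (simp add: D_def matrix_vector_right_distrib vector_scalar_commute W V vector_smult_assoc mult.commute)
  have BE: "B *v (E *v x) = x" "E *v (B *v x) = x" for x
    using B B' by (simp_all add: matrix_vector_mul_assoc)
  have BM: "B *v (cmat M *v y) = D (B *v y)" for y
    using arg_cong[OF ME[of "B *v y"], of "(*v) B"] by (simp add: BE)
  define z where "z i v = (B *v cvec v) $ i" for i v
  have zlin: "bounded_linear (z i)" for i
  proof -
    have "linear (\<lambda>v. B *v v)"
    proof (rule linearI)
      show "B *v (x + y) = B *v x + B *v y" for x y by (rule matrix_vector_right_distrib)
      show "B *v (r *\<^sub>R x) = r *\<^sub>R (B *v x)" for r x
        by (simp add: vec_eq_iff matrix_vector_mult_def scaleR_sum_right)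
    qed
    then have "bounded_linear (\<lambda>v. B *v v)" by (simp add: linear_conv_bounded_linear)
    from bounded_linear_compose[OF bounded_linear_vec_nth bounded_linear_compose[OF this bounded_linear_cvec]]
    show ?thesis unfolding z_def .
  qed
  have zM: "z i (M *v v) = (if i = 1 then of_real ls else if i = 2 then l1 else l2) * z i v" for i v
    unfolding z_def cmat_mult_cvec[symmetric] BM by (simp add: D_def)
  obtain e where e: "e \<noteq> 0" "M *v e = ls *s e" using real_eigenvector[OF ls(2)] .
  have cinj: "v = 0" if "z 1 v = 0" "z 2 v = 0" "z 3 v = 0" for v
  proof -
    have "B *v cvec v = 0" using that by (simp add: z_def vec_eq_iff forall_3)
    then have "cvec v = 0" using BE(2)[of "cvec v"] by simp
    then show ?thesis by (simp add: cvec_def vec_eq_iff)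
  qed
  have ze: "z i e = 0" if "i \<noteq> 1" for i
  proof -
    interpret bounded_linear "z i" by (rule zlin)
    have "z i (M *v e) = of_real ls * z i e"
      unfolding e(2) scalar_mult_eq_scaleR scaleR by (rule scaleR_conv_of_real)
    then have "((if i = 2 then l1 else l2) - of_real ls) * z i e = 0"
      using zM[of i e] that by (simp add: algebra_simps)
    moreover have "(if i = 2 then l1 else l2) - of_real ls \<noteq> 0" using l ls by auto
    ultimately show ?thesis by simp
  qed
  \<comment> \<open>The real eigenvector \<open>e\<close> is only a complex multiple of the column
    \<open>w\<close>; dividing by \<open>\<kappa>\<close> normalizes the stable coordinate to 1 at
    \<open>e\<close>.\<close>
  define \<kappa> where "\<kappa> = z 1 e"
  have \<kappa>: "\<kappa> \<noteq> 0" using cinj[of e] ze e(1) by (auto simp: \<kappa>_def)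
  define zs where "zs v = z 1 v / \<kappa>" for v
  have zs: "bounded_linear zs" unfolding zs_def
    using bounded_linear_compose[OF bounded_linear_divide zlin] .
  define Z where "Z v = (zs v, z 2 v, z 3 v)" for v
  have Z: "bounded_linear Z" unfolding Z_def by (intro bounded_linear_Pair zs zlin)
  have "inj Z"
    using cinj \<kappa> by (subst linear_injective_0)
      (auto simp: Z_def zs_def bounded_linear.linear[OF Z] zero_prod_def)
  then obtain m where m: "m > 0" "\<And>v. norm (Z v) \<ge> m * norm v"
    using linear_inj_bounded_below_pos[of Z] bounded_linear.linear[OF Z] by (metis mult.commute)
  obtain K where K: "K > 0" "\<And>v. norm (Z v) \<le> norm v * K"
    using bounded_linear.pos_bounded[OF Z] by blast
  have NZ: "norm (zs v) \<le> norm (Z v)" "norm (z 2 v) \<le> norm (Z v)" "norm (z 3 v) \<le> norm (Z v)"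
    "norm (Z v) \<le> norm (zs v) + norm (z 2 v) + norm (z 3 v)" for v
  proof -
    show "norm (zs v) \<le> norm (Z v)" unfolding Z_def by (rule norm_fst_le)
    have *: "norm (z 2 v, z 3 v) \<le> norm (Z v)" unfolding Z_def by (rule norm_snd_le)
    show "norm (z 2 v) \<le> norm (Z v)" "norm (z 3 v) \<le> norm (Z v)"
      using order_trans[OF norm_fst_le *] order_trans[OF norm_snd_le *] by auto
    show "norm (Z v) \<le> norm (zs v) + norm (z 2 v) + norm (z 3 v)"
      unfolding Z_def using norm_Pair_le[of "zs v" "(z 2 v, z 3 v)"] norm_Pair_le[of "z 2 v" "z 3 v"] by simp
  qed
  define \<mu> where "\<mu> = Min {Re l1, Re l2, - ls}"
  have "saddle_coordinates ((*v) M) zs (z 2) (z 3) l1 l2 ls e \<mu> K (1 / m)"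
  proof (rule saddle_coordinates.intro)
    show "z 2 (M *v v) = l1 * z 2 v" "z 3 (M *v v) = l2 * z 3 v" for v
      using zM[of 2 v] zM[of 3 v] by auto
    show "M *v e = ls *\<^sub>R e" "zs e = 1" "z 2 e = 0" "z 3 e = 0"
      using e(2) \<kappa> ze[of 2] ze[of 3] by (auto simp: scalar_mult_eq_scaleR zs_def \<kappa>_def)
    show "0 < \<mu>" "\<mu> \<le> Re l1" "\<mu> \<le> Re l2" "\<mu> \<le> - ls" using l ls by (auto simp: \<mu>_def)
    show "norm (zs v) \<le> K * norm v" "norm (z 2 v) \<le> K * norm v" "norm (z 3 v) \<le> K * norm v" for v
      using NZ[of v] K(2)[of v] by (simp_all add: mult.commute)
    show "norm v \<le> 1 / m * (norm (zs v) + norm (z 2 v) + norm (z 3 v))" for v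
      using m(1) order_trans[OF m(2) NZ(4), of v] by (simp add: field_simps)
  qed (use K(1) m(1) zs zlin matrix_vector_mul_bounded_linear in simp_all)
  moreover have "zs v = 0" if "v \<in> unstable_subspace M" for v
  proof -
    \<comment> \<open>A left eigenvector for \<open>ls\<close> annihilates every eigenvector
      belonging to a different eigenvalue, in particular to any with positive real part, so its
      kernel contains the span of all of these.\<close>
    define S where "S = {x. (B *v x) $ 1 = 0}"
    have "vec.subspace S"
      by (auto simp: vec.subspace_def S_def matrix_vector_right_distrib vector_scalar_commute)
    moreover have "{w. \<exists>l. 0 < Re l \<and> eigenpair M l w} \<subseteq> S"
    proof safe
      fix x l' assume l': "0 < Re l'" and "eigenpair M l' x"
      then have "D (B *v x) = l' *s (B *v x)"
        using BM[of x] by (simp add: eigenpair_def vector_scalar_commute)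
      from arg_cong[OF this, of "\<lambda>v. v $ 1"] have "(of_real ls - l') * (B *v x) $ 1 = 0"
        by (simp add: D_def algebra_simps)
      moreover have "of_real ls - l' \<noteq> 0" using ls l' by auto
      ultimately show "x \<in> S" by (simp add: S_def)
    qed
    ultimately have "vec.span {w. \<exists>l. 0 < Re l \<and> eigenpair M l w} \<subseteq> S"
      by (rule vec.span_minimal[rotated])
    then show ?thesis using that by (auto simp: unstable_subspace_def S_def zs_def z_def)
  qed
  ultimately show ?thesis using that by blast
qed

section \<open>Local geometry of the unstable manifold\<close>

lemma C1_on_openE:
  assumes "open S" "C1_on S f"
  obtains D where "\<forall>x\<in>S. (f has_derivative blinfun_apply (D x)) (at x)"
    "\<forall>x\<in>S. frechet_derivative f (at x) = blinfun_apply (D x)" "continuous_on S D"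
proof -
  obtain D where D: "\<forall>x\<in>S. (f has_derivative blinfun_apply (D x)) (at x within S)" "continuous_on S D"
    using assms(2) unfolding C1_on_def by blast
  then have "\<forall>x\<in>S. (f has_derivative blinfun_apply (D x)) (at x)"
    using at_within_open[OF _ assms(1)] by simp
  then show ?thesis using that[of D] frechet_derivative_at[symmetric] D(2) by blast
qed

lemma C2_on_openE:
  assumes "open S" "C2_on S f"
  obtains D D' where "\<forall>x\<in>S. (f has_derivative blinfun_apply (D x)) (at x)"
    "\<forall>x\<in>S. frechet_derivative f (at x) = blinfun_apply (D x)"
    "\<forall>x\<in>S. (D has_derivative blinfun_apply (D' x)) (at x)" "continuous_on S D'"
proof -
  obtain D where D: "\<forall>x\<in>S. (f has_derivative blinfun_apply (D x)) (at x within S)" "C1_on S D"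
    using assms(2) unfolding C2_on_def by blast
  obtain D' where D': "\<forall>x\<in>S. (D has_derivative blinfun_apply (D' x)) (at x)"
    "\<forall>x\<in>S. frechet_derivative D (at x) = blinfun_apply (D' x)" "continuous_on S D'"
    using C1_on_openE[OF assms(1) D(2)] .
  have "\<forall>x\<in>S. (f has_derivative blinfun_apply (D x)) (at x)"
    using D(1) at_within_open[OF _ assms(1)] by simp
  then show ?thesis using that[of D D'] frechet_derivative_at[symmetric] D' by blast
qed

lemma C2_on_imp_C1_on:
  assumes "C2_on S f" shows "C1_on S f"
proof -
  obtain D where D: "\<And>x. x \<in> S \<Longrightarrow> (f has_derivative blinfun_apply (D x)) (at x within S)" "C1_on S D"
    using assms unfolding C2_on_def by blast
  have "continuous_on S D"
    using D(2) unfolding C1_on_def by (meson has_derivative_continuous_on)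
  with D(1) show ?thesis unfolding C1_on_def by blast
qed

text \<open>Continuity of the derivative gives strict differentiability: secants between two
  arbitrary points near \<open>a\<close> are controlled, not only those issuing from
  \<open>a\<close>. It is applied to the vector field and to surface charts.\<close>

lemma C1_on_strict_derivative:
  assumes "open S" "C1_on S f" "a \<in> S" "e > 0"
  obtains r where "r > 0" "ball a r \<subseteq> S"
    "\<And>x y. x \<in> ball a r \<Longrightarrow> y \<in> ball a r \<Longrightarrow>
      norm (f x - f y - frechet_derivative f (at a) (x - y)) \<le> e * norm (x - y)"
proof -
  obtain D where D: "\<forall>x\<in>S. (f has_derivative blinfun_apply (D x)) (at x)"
    "\<forall>x\<in>S. frechet_derivative f (at x) = blinfun_apply (D x)" "continuous_on S D"
    using C1_on_openE[OF assms(1,2)] .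
  obtain r1 where r1: "r1 > 0" "ball a r1 \<subseteq> S"
    using assms(1,3) openE by blast
  obtain r2 where r2: "r2 > 0" "\<And>x. x \<in> S \<Longrightarrow> dist x a < r2 \<Longrightarrow> dist (D x) (D a) < e"
    using D(3) assms(3,4) unfolding continuous_on_iff by metis
  define r where "r = min r1 r2"
  have r: "r > 0" "ball a r \<subseteq> S" using r1 r2 by (auto simp: r_def)
  have bd: "norm (f x - f y - frechet_derivative f (at a) (x - y)) \<le> e * norm (x - y)"
    if xy: "x \<in> ball a r" "y \<in> ball a r" for x y
  proof -
    have "norm (f x - f y - blinfun_apply (D a) (x - y)) \<le> norm (x - y) * e"
    proof (rule differentiable_bound_linearization[where S="ball a r" and f'="\<lambda>x. blinfun_apply (D x)"])
      show "y + t *\<^sub>R (x - y) \<in> ball a r" if "t \<in> {0..1}" for t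
        using convexD_alt[OF convex_ball xy(2,1), of t] that by (simp add: algebra_simps)
      show "(f has_derivative blinfun_apply (D z)) (at z within ball a r)" if "z \<in> ball a r" for z
        using D(1) r that has_derivative_at_withinI by blast
      show "onorm (blinfun_apply (D z) - blinfun_apply (D a)) \<le> e" if "z \<in> ball a r" for z
      proof -
        have "norm (D z - D a) < e"
          using r2(2)[of z] that r by (auto simp: dist_norm r_def norm_minus_commute)
        moreover have "onorm (blinfun_apply (D z) - blinfun_apply (D a)) = norm (D z - D a)"
          by (simp add: norm_blinfun.rep_eq minus_blinfun.rep_eq fun_diff_def)
        ultimately show ?thesis by simp
      qed
      show "a \<in> ball a r" using r by simp
    qed
    then show ?thesis using D(2) assms(3) by (simp add: mult.commute)
  qed
  show ?thesis by (rule that[OF r bd])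
qed

text \<open>No bound on second derivatives over all of \<open>S\<close> is at hand, so
  \<open>M\<close> comes from a compact tube around \<open>K\<close>, on which the continuous second
  derivative \<open>D'\<close> is bounded.\<close>

lemma C2_on_quadratic_remainder:
  fixes f :: "'a::euclidean_space \<Rightarrow> 'b::real_normed_vector"
  assumes "open S" "C2_on S f" "compact K" "K \<subseteq> S"
  obtains \<eta> M where "\<eta> > 0" "M > 0" "\<And>x. x \<in> K \<Longrightarrow> cball x \<eta> \<subseteq> S"
    "\<And>x y. x \<in> K \<Longrightarrow> y \<in> cball x \<eta> \<Longrightarrow>
      norm (f y - f x - frechet_derivative f (at x) (y - x)) \<le> M * (norm (y - x))\<^sup>2"
proof -
  obtain D D' where D: "\<forall>x\<in>S. (f has_derivative blinfun_apply (D x)) (at x)"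
    "\<forall>x\<in>S. frechet_derivative f (at x) = blinfun_apply (D x)"
    "\<forall>x\<in>S. (D has_derivative blinfun_apply (D' x)) (at x)" "continuous_on S D'"
    using C2_on_openE[OF assms(1,2)] .
  obtain \<eta> where \<eta>: "\<eta> > 0" "(\<Union>x\<in>K. cball x \<eta>) \<subseteq> S"
    using compact_subset_open_imp_cball_epsilon_subset[OF assms(3,1,4)] .
  have "compact (D' ` (\<Union>x\<in>K. cball x \<eta>))"
    by (intro compact_continuous_image compact_minkowski_sum_cball assms continuous_on_subset[OF D(4) \<eta>(2)])
  then obtain M where M: "M > 0" "\<And>z x. x \<in> K \<Longrightarrow> z \<in> cball x \<eta> \<Longrightarrow> norm (D' z) \<le> M"
    using compact_imp_bounded[of "D' ` (\<Union>x\<in>K. cball x \<eta>)"] unfolding bounded_pos by auto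
  have bd: "norm (f y - f x - frechet_derivative f (at x) (y - x)) \<le> M * (norm (y - x))\<^sup>2"
    if x: "x \<in> K" and y: "y \<in> cball x \<eta>" for x y
  proof -
    define C where "C = cball x (norm (y - x))"
    have C: "C \<subseteq> cball x \<eta>" using y by (auto simp: C_def dist_norm norm_minus_commute)
    then have CS: "C \<subseteq> S" using x \<eta>(2) by blast
    have "norm (f y - f x - blinfun_apply (D x) (y - x)) \<le> norm (y - x) * (M * norm (y - x))"
    proof (rule differentiable_bound_linearization[where S=C and f'="\<lambda>x. blinfun_apply (D x)"])
      show "x + t *\<^sub>R (y - x) \<in> C" if "t \<in> {0..1}" for t
        using that by (simp add: C_def dist_norm mult_left_le_one_le)
      show "(f has_derivative blinfun_apply (D z)) (at z within C)" if "z \<in> C" for z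
        using D(1) CS that has_derivative_at_withinI by blast
      show "onorm (blinfun_apply (D z) - blinfun_apply (D x)) \<le> M * norm (y - x)" if z: "z \<in> C" for z
      proof -
        have "norm (D z - D x) \<le> M * norm (z - x)"
        proof (rule differentiable_bound[where S=C and f'="\<lambda>x. blinfun_apply (D' x)"])
          show "(D has_derivative blinfun_apply (D' u)) (at u within C)" if "u \<in> C" for u
            using D(3) CS that has_derivative_at_withinI by blast
          show "onorm (blinfun_apply (D' u)) \<le> M" if "u \<in> C" for u
            using M(2)[OF x, of u] C that by (auto simp: norm_blinfun.rep_eq)
        qed (use z in \<open>auto simp: C_def\<close>)
        also have "\<dots> \<le> M * norm (y - x)"
          using z M(1) by (intro mult_left_mono) (auto simp: C_def dist_norm norm_minus_commute)
        finally show ?thesis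
          by (simp add: norm_blinfun.rep_eq minus_blinfun.rep_eq fun_diff_def)
      qed
    qed (simp add: C_def)
    then show ?thesis using D(2) x assms(4) by (auto simp: power2_eq_square ac_simps)
  qed
  have sub: "cball x \<eta> \<subseteq> S" if "x \<in> K" for x using \<eta>(2) that by blast
  show ?thesis by (rule that[OF \<eta>(1) M(1) sub bd])
qed

text \<open>The tangent plane at \<open>x0\<close> lies in the kernel of \<open>zs\<close>, so on it
  the norm is controlled by \<open>z1\<close> and \<open>z2\<close> alone. In a chart every secant
  near \<open>x0\<close> is a tangent vector up to a small relative error, so the estimate extends
  to all pairs of points.\<close>

lemma C2_surface_cone:
  assumes coords: "saddle_coordinates A zs z1 z2 l1 l2 ls es \<mu> K c"
    and S: "C2_surface S" "x0 \<in> S" and tangent: "\<And>v. v \<in> tangent_space S x0 \<Longrightarrow> zs v = 0"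
  obtains R where "R > 0" "\<And>x y. x \<in> S \<inter> ball x0 R \<Longrightarrow> y \<in> S \<inter> ball x0 R \<Longrightarrow>
    norm (zs (x - y)) \<le> norm (z1 (x - y)) + norm (z2 (x - y))"
proof -
  interpret saddle_coordinates A zs z1 z2 l1 l2 ls es \<mu> K c by fact
  obtain U and V :: "(real^2) set" and \<phi> \<psi> where U: "open U" "x0 \<in> U" and V: "open V" "C2_on V \<phi>"
    "\<And>u. u \<in> V \<Longrightarrow> inj (frechet_derivative \<phi> (at u))" and hom: "homeomorphism V (S \<inter> U) \<phi> \<psi>"
    using S unfolding C2_surface_def by metis
  define u0 where "u0 = \<psi> x0"
  have u0: "u0 \<in> V" "\<phi> u0 = x0"
    using hom S U unfolding u0_def homeomorphism_def by auto
  define D where "D = frechet_derivative \<phi> (at u0)"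
  have der: "(\<phi> has_derivative D) (at u0)"
    using C1_on_openE[OF V(1) C2_on_imp_C1_on[OF V(2)]] u0(1) unfolding D_def by metis
  have linD: "linear D" using der has_derivative_linear by blast
  obtain m where m: "m > 0" "\<And>v. m * norm v \<le> norm (D v)"
    using linear_inj_bounded_below_pos[OF linD] V(3)[OF u0(1)] D_def by metis
  have zsD: "zs (D v) = 0" for v
  proof (rule tangent)
    have c0: "((\<lambda>s. u0 + s *\<^sub>R v) has_derivative (\<lambda>s. s *\<^sub>R v)) (at 0)"
      by (auto intro!: derivative_eq_intros)
    have "((\<lambda>s. \<phi> (u0 + s *\<^sub>R v)) has_derivative (\<lambda>s. D (s *\<^sub>R v))) (at 0)"
      using has_derivative_compose[OF c0, of \<phi> D] der by simp
    then have "((\<lambda>s. \<phi> (u0 + s *\<^sub>R v)) has_vector_derivative D v) (at 0)"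
      unfolding has_vector_derivative_def by (simp add: linear_scale[OF linD])
    moreover have "\<forall>\<^sub>F s in nhds 0. \<phi> (u0 + s *\<^sub>R v) \<in> S"
    proof -
      have "((\<lambda>s. u0 + s *\<^sub>R v) \<longlongrightarrow> u0 + 0 *\<^sub>R v) (nhds 0)"
        by (intro tendsto_intros filterlim_ident)
      then have "\<forall>\<^sub>F s in nhds 0. u0 + s *\<^sub>R v \<in> V"
        using topological_tendstoD[OF _ V(1)] u0(1) by fastforce
      then show ?thesis
        by eventually_elim (use hom in \<open>auto simp: homeomorphism_def\<close>)
    qed
    ultimately show "D v \<in> tangent_space S x0"
      unfolding tangent_space_def using u0(2) by (intro CollectI exI[of _ "\<lambda>s. \<phi> (u0 + s *\<^sub>R v)"]) auto
  qed
  \<comment> \<open>An error of size \<open>K * e * norm v\<close> arises in each of the three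
    coordinates; this \<open>e\<close> makes their sum equal to the lower bound
    \<open>m * norm v / c\<close> for the unstable coordinates of \<open>D v\<close>.\<close>
  define e where "e = m / (3 * c * K)"
  have e: "e > 0" using m c K by (simp add: e_def)
  obtain r where r: "r > 0" "ball u0 r \<subseteq> V" "\<And>x y. x \<in> ball u0 r \<Longrightarrow> y \<in> ball u0 r \<Longrightarrow>
      norm (\<phi> x - \<phi> y - D (x - y)) \<le> e * norm (x - y)"
    using C1_on_strict_derivative[OF V(1) C2_on_imp_C1_on[OF V(2)] u0(1) e] unfolding D_def by metis
  \<comment> \<open>Continuity of the inverse chart is where embeddedness enters: points of
    \<open>S\<close> close to \<open>x0\<close> in space have parameters close to \<open>u0\<close>,
    so no other sheet of \<open>S\<close> approaches \<open>x0\<close>.\<close>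
  have "continuous_on (S \<inter> U) \<psi>" using hom homeomorphism_def by blast
  then obtain R1 where R1: "R1 > 0" "\<And>x. x \<in> S \<inter> U \<Longrightarrow> dist x x0 < R1 \<Longrightarrow> dist (\<psi> x) u0 < r"
    using S U r(1) unfolding continuous_on_iff u0_def by (metis IntI)
  obtain R2 where R2: "R2 > 0" "ball x0 R2 \<subseteq> U" using U openE by blast
  define R where "R = min R1 R2"
  have chart: "\<psi> x \<in> ball u0 r \<and> \<phi> (\<psi> x) = x" if "x \<in> S \<inter> ball x0 R" for x
  proof -
    have "x \<in> S \<inter> U" "dist x x0 < R1" using that R2 by (auto simp: R_def dist_commute)
    then show ?thesis using R1(2)[of x] hom by (auto simp: homeomorphism_def dist_commute)
  qed
  have cone: "norm (zs (x - y)) \<le> norm (z1 (x - y)) + norm (z2 (x - y))"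
    if xy: "x \<in> S \<inter> ball x0 R" "y \<in> S \<inter> ball x0 R" for x y
  proof -
    define v where "v = \<psi> x - \<psi> y"
    define d where "d = x - y - D v"
    have d: "norm d \<le> e * norm v"
      using r(3)[of "\<psi> x" "\<psi> y"] chart[OF xy(1)] chart[OF xy(2)] by (simp add: v_def d_def)
    have eq: "x - y = D v + d" by (simp add: d_def)
    have Kd: "norm (z d) \<le> K * e * norm v" if "\<And>v. norm (z v) \<le> K * norm v" for z :: "real^3 \<Rightarrow> complex"
      using order_trans[OF that mult_left_mono[OF d]] K(1) by (simp add: mult.assoc)
    have "norm (zs (x - y)) \<le> K * e * norm v"
      unfolding eq bounded_linear.linear[OF zs, THEN linear_add] zsD using Kd[OF K(2)] by simp
    also have "\<dots> = m * norm v / c - 2 * (K * e * norm v)"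
      using c K by (simp add: e_def field_simps)
    also have "m * norm v / c \<le> norm (z1 (D v)) + norm (z2 (D v))"
      using order_trans[OF m(2) c(2), of v] zsD c(1) by (simp add: field_simps)
    also have "norm (z1 (D v)) \<le> norm (z1 (x - y)) + K * e * norm v"
      unfolding eq bounded_linear.linear[OF z1, THEN linear_add]
      using Kd[OF K(3)] norm_diff_ineq[of "z1 (D v)" "z1 d"] by linarith
    also have "norm (z2 (D v)) \<le> norm (z2 (x - y)) + K * e * norm v"
      unfolding eq bounded_linear.linear[OF z2, THEN linear_add]
      using Kd[OF K(4)] norm_diff_ineq[of "z2 (D v)" "z2 d"] by linarith
    finally show ?thesis by simp
  qed
  have "R > 0" using R1 R2 by (simp add: R_def)
  then show ?thesis by (rule that[OF _ cone])
qed

section \<open>The adjoint solution\<close>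

text \<open>First-order form, at the identity, of
  \<open>cross3 (X *v u) (X *v v) = cof X *v cross3 u v\<close> with the cofactor matrix
  \<open>cof X\<close>; the linearized cofactor is the trace of \<open>M\<close> times the identity
  minus the transpose of \<open>M\<close>. This is the origin of the divergence in the Melnikov
  integrand.\<close>

lemma cross3_matrix_derivation:
  fixes M :: "real^3^3"
  shows "cross3 (M *v u) v + cross3 u (M *v v) = trace M *\<^sub>R cross3 u v - cross3 u v v* M"
  by (simp add: vec_eq_iff forall_3 cross3_simps matrix_vector_mult_def sum_3 trace_def vector_matrix_mult_def)

text \<open>Cramer's rule for \<open>u\<close>, \<open>w\<close> and \<open>cross3 u w\<close>,
  multiplied by the determinant \<open>(norm (cross3 u w))\<^sup>2\<close> to avoid division; the
  coefficient of the third vector vanishes by assumption.\<close>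

lemma cross3_span_decomposition:
  assumes "v \<bullet> cross3 u w = 0"
  shows "(norm (cross3 u w))\<^sup>2 *\<^sub>R v = (cross3 v w \<bullet> cross3 u w) *\<^sub>R u + (cross3 u v \<bullet> cross3 u w) *\<^sub>R w"
proof -
  have "(norm (cross3 u w))\<^sup>2 *\<^sub>R v =
    (cross3 v w \<bullet> cross3 u w) *\<^sub>R u + (cross3 u v \<bullet> cross3 u w) *\<^sub>R w + (v \<bullet> cross3 u w) *\<^sub>R cross3 u w"
    unfolding power2_norm_eq_inner
    by (simp add: vec_eq_iff forall_3 cross3_def inner_vec_def sum_3) (algebra)
  then show ?thesis using assms by simp
qed

lemma bounded_bilinear_cross3: "bounded_bilinear cross3"
  using bilinear_cross bilinear_conv_bounded_bilinear by blast

lemma has_vector_derivative_cross3: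
  assumes "(u has_vector_derivative u') (at x within S)" "(v has_vector_derivative v') (at x within S)"
  shows "((\<lambda>x. cross3 (u x) (v x)) has_vector_derivative cross3 (u x) v' + cross3 u' (v x)) (at x within S)"
  using bounded_bilinear.has_vector_derivative[OF bounded_bilinear_cross3 assms] .

lemma jac_mult:
  assumes "open S" "C1_on S f" "x \<in> S"
  shows "jac f x *v v = frechet_derivative f (at x) v"
proof -
  obtain D where "\<forall>x\<in>S. (f has_derivative blinfun_apply (D x)) (at x)"
    "\<forall>x\<in>S. frechet_derivative f (at x) = blinfun_apply (D x)" "continuous_on S D"
    using C1_on_openE[OF assms(1,2)] .
  then have "linear (frechet_derivative f (at x))"
    using assms(3) by (simp add: bounded_linear.linear blinfun.bounded_linear_right)
  then show ?thesis unfolding jac_def by simp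
qed

lemma continuous_on_jac:
  assumes "open S" "C1_on S f"
  shows "continuous_on S (jac f)"
proof -
  obtain D where D0: "\<forall>x\<in>S. (f has_derivative blinfun_apply (D x)) (at x)" and D: "\<forall>x\<in>S. frechet_derivative f (at x) = blinfun_apply (D x)" "continuous_on S D"
    using C1_on_openE[OF assms(1,2)] .
  have "continuous_on S (\<lambda>x. \<chi> i j. blinfun_apply (D x) (axis j 1) $ i)"
    by (intro continuous_intros D(2))
  moreover have "jac f x = (\<chi> i j. blinfun_apply (D x) (axis j 1) $ i)" if "x \<in> S" for x
    using D(1) that by (simp add: jac_def matrix_def)
  ultimately show ?thesis by (simp cong: continuous_on_cong)
qed

section \<open>Differential equations along the sheet\<close>

locale unstable_sheet =
  fixes \<Omega> :: "(real^3) set" and f :: "real^3 \<Rightarrow> real^3" and a :: "real^3" and P :: real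
    and xb :: "real \<Rightarrow> real \<Rightarrow> real^3"
  assumes open_\<Omega>: "open \<Omega>" and C2_f: "C2_on \<Omega> f" and a: "a \<in> \<Omega>" "f a = 0"
    and saddle: "saddle_with_unstable_plane (jac f a)"
    and param: "unstable_parametrization f \<Omega> a P xb"
begin

lemma C1_f: "C1_on \<Omega> f"
  using C2_f by (rule C2_on_imp_C1_on)

lemma xb_in: "p \<le> P \<Longrightarrow> xb p \<alpha> \<in> \<Omega>"
  and xb_periodic: "p \<le> P \<Longrightarrow> xb p (\<alpha> + 1) = xb p \<alpha>"
  and xb_flow: "p \<le> P \<Longrightarrow> ((\<lambda>q. xb q \<alpha>) has_vector_derivative f (xb p \<alpha>)) (at p within {..P})"
  and xb_lim: "((\<lambda>p. xb p \<alpha>) \<longlongrightarrow> a) at_bot"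
  and normal_nonzero: "p \<le> P \<Longrightarrow> normal_vec f xb p \<alpha> \<noteq> 0"
  and surface: "C2_surface (param_set a xb {..<P})"
  and tangent: "tangent_space (param_set a xb {..<P}) a = unstable_subspace (jac f a)"
  using param unfolding unstable_parametrization_def by blast+

lemma continuous_f: "continuous_on \<Omega> f"
proof -
  obtain D where "\<forall>x\<in>\<Omega>. (f has_derivative blinfun_apply (D x)) (at x)"
    "\<forall>x\<in>\<Omega>. frechet_derivative f (at x) = blinfun_apply (D x)" "continuous_on \<Omega> D"
    using C1_on_openE[OF open_\<Omega> C1_f] .
  then show ?thesis by (meson has_derivative_at_withinI has_derivative_continuous_on)
qed

lemma has_derivative_f: "x \<in> \<Omega> \<Longrightarrow> (f has_derivative (*v) (jac f x)) (at x)"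
proof -
  assume x: "x \<in> \<Omega>"
  obtain D where "\<forall>x\<in>\<Omega>. (f has_derivative blinfun_apply (D x)) (at x)"
    "\<forall>x\<in>\<Omega>. frechet_derivative f (at x) = blinfun_apply (D x)" "continuous_on \<Omega> D"
    using C1_on_openE[OF open_\<Omega> C1_f] .
  moreover have "(*v) (jac f x) = frechet_derivative f (at x)"
    using jac_mult[OF open_\<Omega> C1_f x] by blast
  ultimately show ?thesis using x by simp
qed

lemma xb_C1:
  obtains D where "\<forall>p\<le>P. \<forall>\<alpha>. ((\<lambda>(p, \<alpha>). xb p \<alpha>) has_derivative blinfun_apply (D (p, \<alpha>))) (at (p, \<alpha>) within {..P} \<times> UNIV)"
    "continuous_on ({..P} \<times> UNIV) D"
  using param unfolding unstable_parametrization_def C1_on_def by fastforce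

lemma continuous_xb: "continuous_on ({..P} \<times> UNIV) (\<lambda>(p, \<alpha>). xb p \<alpha>)"
proof -
  obtain D where "\<forall>p\<le>P. \<forall>\<alpha>. ((\<lambda>(p, \<alpha>). xb p \<alpha>) has_derivative blinfun_apply (D (p, \<alpha>))) (at (p, \<alpha>) within {..P} \<times> UNIV)"
    "continuous_on ({..P} \<times> UNIV) D"
    using xb_C1 .
  then show ?thesis
    by (intro has_derivative_continuous_on[where f'="\<lambda>x. blinfun_apply (D x)"]) auto
qed

lemma xb_partials:
  obtains D where "\<forall>p\<le>P. \<forall>\<alpha>. ((\<lambda>(p, \<alpha>). xb p \<alpha>) has_derivative blinfun_apply (D (p, \<alpha>))) (at (p, \<alpha>) within {..P} \<times> UNIV)"
    "continuous_on ({..P} \<times> UNIV) D"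
    "\<forall>p\<le>P. \<forall>\<alpha>. ((\<lambda>\<beta>. xb p \<beta>) has_vector_derivative blinfun_apply (D (p, \<alpha>)) (0, 1)) (at \<alpha>)"
    "\<forall>p\<le>P. \<forall>\<alpha>. blinfun_apply (D (p, \<alpha>)) (0, 1) = xb_alpha xb p \<alpha>"
    "\<forall>p\<le>P. \<forall>\<alpha>. blinfun_apply (D (p, \<alpha>)) (1, 0) = f (xb p \<alpha>)"
proof -
  obtain D where D: "\<forall>p\<le>P. \<forall>\<alpha>. ((\<lambda>(p, \<alpha>). xb p \<alpha>) has_derivative blinfun_apply (D (p, \<alpha>))) (at (p, \<alpha>) within {..P} \<times> UNIV)"
    "continuous_on ({..P} \<times> UNIV) D"
    using xb_C1 .
  have 1: "((\<lambda>\<beta>. xb p \<beta>) has_vector_derivative blinfun_apply (D (p, \<alpha>)) (0, 1)) (at \<alpha>)" if "p \<le> P" for p \<alpha>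
  proof -
    have "((\<lambda>\<beta>. (p, \<beta>)) has_derivative (\<lambda>h. (0, h))) (at \<alpha>)"
      by (auto intro!: derivative_eq_intros)
    moreover have "((\<lambda>(p, \<alpha>). xb p \<alpha>) has_derivative blinfun_apply (D (p, \<alpha>))) (at (p, \<alpha>) within range (\<lambda>\<beta>. (p, \<beta>)))"
      by (rule has_derivative_subset[OF D(1)[rule_format, OF that]]) (use that in auto)
    ultimately have "((\<lambda>\<beta>. xb p \<beta>) has_derivative (\<lambda>h. blinfun_apply (D (p, \<alpha>)) (0, h))) (at \<alpha>)"
      using has_derivative_in_compose[of "\<lambda>\<beta>. (p, \<beta>)" "\<lambda>h. (0, h)" \<alpha> UNIV "\<lambda>(p, \<alpha>). xb p \<alpha>"] by simp
    moreover have "(\<lambda>h. blinfun_apply (D (p, \<alpha>)) (0, h)) = (\<lambda>h. h *\<^sub>R blinfun_apply (D (p, \<alpha>)) (0, 1))"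
      using blinfun.scaleR_right[of "D (p, \<alpha>)" _ "(0, 1)"] by (intro ext) (metis scaleR_Pair scaleR_zero_right real_scaleR_def mult.right_neutral)
    ultimately show ?thesis by (simp only: has_vector_derivative_def)
  qed
  have 2: "blinfun_apply (D (p, \<alpha>)) (0, 1) = xb_alpha xb p \<alpha>" if "p \<le> P" for p \<alpha>
    unfolding xb_alpha_def using vector_derivative_at[OF 1[OF that]] by simp
  have 3: "blinfun_apply (D (p, \<alpha>)) (1, 0) = f (xb p \<alpha>)" if "p \<le> P" for p \<alpha>
  proof -
    have "((\<lambda>q. (q, \<alpha>)) has_derivative (\<lambda>h. (h, 0))) (at p within {..P})"
      by (auto intro!: derivative_eq_intros)
    moreover have "((\<lambda>(p, \<alpha>). xb p \<alpha>) has_derivative blinfun_apply (D (p, \<alpha>))) (at (p, \<alpha>) within (\<lambda>q. (q, \<alpha>)) ` {..P})"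
      by (rule has_derivative_subset[OF D(1)[rule_format, OF that]]) auto
    ultimately have "((\<lambda>q. xb q \<alpha>) has_derivative (\<lambda>h. blinfun_apply (D (p, \<alpha>)) (h, 0))) (at p within {..P})"
      using has_derivative_in_compose[of "\<lambda>q. (q, \<alpha>)" "\<lambda>h. (h, 0)" p "{..P}" "\<lambda>(p, \<alpha>). xb p \<alpha>"] by simp
    moreover have "(\<lambda>h. blinfun_apply (D (p, \<alpha>)) (h, 0)) = (\<lambda>h. h *\<^sub>R blinfun_apply (D (p, \<alpha>)) (1, 0))"
      using blinfun.scaleR_right[of "D (p, \<alpha>)" _ "(1, 0)"] by (intro ext) (metis scaleR_Pair scaleR_zero_right real_scaleR_def mult.right_neutral)
    ultimately have "((\<lambda>q. xb q \<alpha>) has_vector_derivative blinfun_apply (D (p, \<alpha>)) (1, 0)) (at p within {..P})"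
      by (simp only: has_vector_derivative_def)
    \<comment> \<open>At \<open>p = P\<close> only a left-hand derivative is available, so
      uniqueness is invoked on an interval that ends at \<open>p\<close>.\<close>
    then have "((\<lambda>q. xb q \<alpha>) has_vector_derivative blinfun_apply (D (p, \<alpha>)) (1, 0)) (at p within {p - 1..p})"
      "((\<lambda>q. xb q \<alpha>) has_vector_derivative f (xb p \<alpha>)) (at p within {p - 1..p})"
      using has_vector_derivative_within_subset[OF xb_flow[OF that], of "{p - 1..p}"] that
      by (auto intro: has_vector_derivative_within_subset)
    then show ?thesis
      using vector_derivative_unique_within_closed_interval[of "p - 1" p p] by simp
  qed
  show ?thesis by (rule that[OF D]) (use 1 2 3 in blast)+
qed

lemma xb_alpha_deriv:
  assumes "p \<le> P"
  shows "((\<lambda>\<beta>. xb p \<beta>) has_vector_derivative xb_alpha xb p \<alpha>) (at \<alpha>)"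
  by (rule xb_partials) (use assms in simp)

lemma continuous_xb_alpha: "continuous_on ({..P} \<times> UNIV) (\<lambda>(p, \<alpha>). xb_alpha xb p \<alpha>)"
proof -
  obtain D where "\<forall>p\<le>P. \<forall>\<alpha>. ((\<lambda>(p, \<alpha>). xb p \<alpha>) has_derivative blinfun_apply (D (p, \<alpha>))) (at (p, \<alpha>) within {..P} \<times> UNIV)" and D: "continuous_on ({..P} \<times> UNIV) D"
    and "\<forall>p\<le>P. \<forall>\<alpha>. ((\<lambda>\<beta>. xb p \<beta>) has_vector_derivative blinfun_apply (D (p, \<alpha>)) (0, 1)) (at \<alpha>)"
    and D2: "\<forall>p\<le>P. \<forall>\<alpha>. blinfun_apply (D (p, \<alpha>)) (0, 1) = xb_alpha xb p \<alpha>"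
    and "\<forall>p\<le>P. \<forall>\<alpha>. blinfun_apply (D (p, \<alpha>)) (1, 0) = f (xb p \<alpha>)"
    using xb_partials .
  have "continuous_on ({..P} \<times> UNIV) (\<lambda>x. blinfun_apply (D x) (0, 1))"
    by (intro continuous_intros D)
  then show ?thesis
    by (rule continuous_on_eq) (use D2 in auto)
qed

lemma continuous_on_xb_slice:
  assumes "b \<le> P"
  shows "continuous_on {c..b} (\<lambda>p. xb p \<alpha>)" "continuous_on {c..b} (\<lambda>p. xb_alpha xb p \<alpha>)"
proof -
  have *: "continuous_on {c..b} (\<lambda>p. (p, \<alpha>))" "(\<lambda>p. (p, \<alpha>)) ` {c..b} \<subseteq> {..P} \<times> UNIV"
    using assms by (auto intro!: continuous_intros)
  show "continuous_on {c..b} (\<lambda>p. xb p \<alpha>)" "continuous_on {c..b} (\<lambda>p. xb_alpha xb p \<alpha>)"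
    using continuous_on_compose2[OF continuous_xb *] continuous_on_compose2[OF continuous_xb_alpha *] by simp_all
qed

lemma continuous_on_along_xb:
  assumes "b \<le> P" "continuous_on \<Omega> h"
  shows "continuous_on {c..b} (\<lambda>p. h (xb p \<alpha>))"
  using assms xb_in by (intro continuous_on_compose2[OF assms(2) continuous_on_xb_slice(1)]) auto

lemma xb_integral:
  assumes "s \<le> t" "t \<le> P"
  shows "((\<lambda>p. f (xb p \<alpha>)) has_integral xb t \<alpha> - xb s \<alpha>) {s..t}"
  using assms by (intro fundamental_theorem_of_calculus has_vector_derivative_within_subset[OF xb_flow]) auto

text \<open>\<open>xb\<close> is only C1, so mixed partial derivatives cannot simply be
  interchanged. Instead the integral equation for \<open>xb q \<beta> - xb c \<beta>\<close> is
  differentiated under the integral sign in the label, and the resulting integral equation is then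
  differentiated in time.\<close>

lemma variational_equation:
  assumes "c \<le> p" "p \<le> P"
  shows "((\<lambda>q. xb_alpha xb q \<alpha>) has_vector_derivative jac f (xb p \<alpha>) *v xb_alpha xb p \<alpha>) (at p within {c..P})"
proof -
  define k where "k \<beta> s = jac f (xb s \<beta>) *v xb_alpha xb s \<beta>" for \<beta> s
  have eq: "xb_alpha xb q \<alpha> = xb_alpha xb c \<alpha> + integral {c..q} (k \<alpha>)" if q: "q \<in> {c..P}" for q
  proof -
    have "((\<lambda>\<beta>. integral (cbox c q) (\<lambda>s. f (xb s \<beta>))) has_vector_derivative integral (cbox c q) (k \<alpha>)) (at \<alpha> within UNIV)"
    proof (rule leibniz_rule_vector_derivative)
      fix \<beta> s assume "s \<in> cbox c q"
      then have s: "s \<le> P" using q by auto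
      show "((\<lambda>\<beta>. f (xb s \<beta>)) has_vector_derivative k \<beta> s) (at \<beta> within UNIV)"
        using vector_derivative_diff_chain_within[OF xb_alpha_deriv[OF s] has_derivative_at_withinI[OF has_derivative_f[OF xb_in[OF s]]], of \<beta>]
        by (simp add: o_def k_def)
    next
      show "(\<lambda>s. f (xb s \<beta>)) integrable_on cbox c q" for \<beta>
        using xb_integral[of c q] q by auto
      have sub: "\<And>y. y \<in> UNIV \<times> cbox c q \<Longrightarrow> (snd y, fst y) \<in> {..P} \<times> UNIV" using q by auto
      have sw: "continuous_on (UNIV \<times> cbox c q) (\<lambda>y. (snd y, fst y))" by (intro continuous_intros)
      have "continuous_on (UNIV \<times> cbox c q) (\<lambda>y. xb (snd y) (fst y))"
        "continuous_on (UNIV \<times> cbox c q) (\<lambda>y. xb_alpha xb (snd y) (fst y))"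
        using continuous_on_compose2[OF continuous_xb sw] continuous_on_compose2[OF continuous_xb_alpha sw] sub
        by (auto simp: image_subset_iff)
      moreover from this(1) have "continuous_on (UNIV \<times> cbox c q) (\<lambda>y. jac f (xb (snd y) (fst y)))"
        by (rule continuous_on_compose2[OF continuous_on_jac[OF open_\<Omega> C1_f]]) (use xb_in q in auto)
      ultimately show "continuous_on (UNIV \<times> cbox c q) (\<lambda>(\<beta>, s). k \<beta> s)"
        unfolding k_def split_beta matrix_vector_mult_def by (intro continuous_intros)
    qed auto
    moreover have "integral (cbox c q) (\<lambda>s. f (xb s \<beta>)) = xb q \<beta> - xb c \<beta>" for \<beta>
      using xb_integral[of c q \<beta>] q by (auto intro: integral_unique)
    ultimately have "((\<lambda>\<beta>. xb q \<beta> - xb c \<beta>) has_vector_derivative integral {c..q} (k \<alpha>)) (at \<alpha>)"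
      by simp
    moreover have "((\<lambda>\<beta>. xb q \<beta> - xb c \<beta>) has_vector_derivative xb_alpha xb q \<alpha> - xb_alpha xb c \<alpha>) (at \<alpha>)"
      using q assms by (intro has_vector_derivative_diff xb_alpha_deriv) auto
    ultimately have "integral {c..q} (k \<alpha>) = xb_alpha xb q \<alpha> - xb_alpha xb c \<alpha>"
      by (rule vector_derivative_unique_at)
    then show ?thesis by simp
  qed
  have "continuous_on {c..P} (k \<alpha>)"
    unfolding k_def matrix_vector_mult_def
    by (intro continuous_intros continuous_on_xb_slice continuous_on_along_xb continuous_on_jac[OF open_\<Omega> C1_f] order_refl)
  then have "((\<lambda>q. xb_alpha xb c \<alpha> + integral {c..q} (k \<alpha>)) has_vector_derivative 0 + k \<alpha> p) (at p within {c..P})"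
    using assms by (intro has_vector_derivative_add has_vector_derivative_const integral_has_vector_derivative) auto
  then have "((\<lambda>q. xb_alpha xb q \<alpha>) has_vector_derivative 0 + k \<alpha> p) (at p within {c..P})"
    by (rule has_vector_derivative_transform[rotated 2]) (use assms in simp, rule eq)
  then show ?thesis by (simp add: k_def)
qed

text \<open>The exponential factor turns the normal into a solution of the adjoint variational equation.\<close>

definition adjoint_normal :: "real \<Rightarrow> real \<Rightarrow> real \<Rightarrow> real^3" where
  "adjoint_normal p \<alpha> \<tau> = exp (integral {\<tau>..p} (\<lambda>\<xi>. divergence f (xb \<xi> \<alpha>))) *\<^sub>R normal_vec f xb \<tau> \<alpha>"

lemma adjoint_normal_self [simp]: "adjoint_normal p \<alpha> p = normal_vec f xb p \<alpha>"
  by (simp add: adjoint_normal_def)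

lemma continuous_divergence: "continuous_on \<Omega> (divergence f)"
  unfolding divergence_def[abs_def] trace_def
  by (intro continuous_intros continuous_on_jac[OF open_\<Omega> C1_f])

text \<open>Along a trajectory both \<open>f (xb \<tau> \<alpha>)\<close> and
  \<open>xb_alpha xb \<tau> \<alpha>\<close> solve the variational equation, so their cross product
  evolves by the linearized cofactor of the Jacobian.\<close>

lemma normal_vec_deriv:
  assumes "c \<le> \<tau>" "\<tau> \<le> P"
  shows "((\<lambda>\<tau>. normal_vec f xb \<tau> \<alpha>) has_vector_derivative
    divergence f (xb \<tau> \<alpha>) *\<^sub>R normal_vec f xb \<tau> \<alpha> - normal_vec f xb \<tau> \<alpha> v* jac f (xb \<tau> \<alpha>))
    (at \<tau> within {c..P})"
proof -
  have x: "((\<lambda>q. xb q \<alpha>) has_vector_derivative f (xb \<tau> \<alpha>)) (at \<tau> within {c..P})"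
    using assms by (intro has_vector_derivative_within_subset[OF xb_flow]) auto
  have "((\<lambda>q. f (xb q \<alpha>)) has_vector_derivative jac f (xb \<tau> \<alpha>) *v f (xb \<tau> \<alpha>)) (at \<tau> within {c..P})"
    using vector_derivative_diff_chain_within[OF x has_derivative_at_withinI[OF has_derivative_f[OF xb_in[OF assms(2)]]]]
    by (simp add: o_def)
  from has_vector_derivative_cross3[OF this variational_equation[OF assms]]
  show ?thesis
    unfolding normal_vec_def divergence_def cross3_matrix_derivation[symmetric]
    by (simp add: add.commute)
qed

lemma adjoint_normal_deriv:
  assumes "c \<le> \<tau>" "\<tau> \<le> p" "p \<le> P"
  shows "(adjoint_normal p \<alpha> has_vector_derivative - (adjoint_normal p \<alpha> \<tau> v* jac f (xb \<tau> \<alpha>))) (at \<tau> within {c..p})"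
proof -
  define d where "d \<xi> = divergence f (xb \<xi> \<alpha>)" for \<xi>
  have cd: "continuous_on {c..p} d"
    unfolding d_def by (rule continuous_on_along_xb[OF assms(3) continuous_divergence])
  \<comment> \<open>The variable sits in the lower limit of the exponent; rewritten as
    \<open>G p - G \<tau>\<close>, the exponential contributes a factor \<open>- d \<tau>\<close>
    that cancels the divergence term of the normal.\<close>
  define G where "G \<tau> = integral {c..\<tau>} d" for \<tau>
  have "(G has_vector_derivative d \<tau>) (at \<tau> within {c..p})"
    unfolding G_def using assms by (intro integral_has_vector_derivative cd) auto
  then have G: "(G has_real_derivative d \<tau>) (at \<tau> within {c..p})"
    by (simp add: has_real_derivative_iff_has_vector_derivative)
  have "((\<lambda>\<tau>. exp (G p - G \<tau>)) has_real_derivative exp (G p - G \<tau>) * (- d \<tau>)) (at \<tau> within {c..p})"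
    by (auto intro!: derivative_eq_intros G)
  moreover have "((\<lambda>\<tau>. normal_vec f xb \<tau> \<alpha>) has_vector_derivative
    d \<tau> *\<^sub>R normal_vec f xb \<tau> \<alpha> - normal_vec f xb \<tau> \<alpha> v* jac f (xb \<tau> \<alpha>)) (at \<tau> within {c..p})"
    unfolding d_def using assms
    by (intro has_vector_derivative_within_subset[OF normal_vec_deriv[of c \<tau>]]) auto
  ultimately
  have der: "((\<lambda>\<tau>. exp (G p - G \<tau>) *\<^sub>R normal_vec f xb \<tau> \<alpha>) has_vector_derivative
     exp (G p - G \<tau>) *\<^sub>R (d \<tau> *\<^sub>R normal_vec f xb \<tau> \<alpha> - normal_vec f xb \<tau> \<alpha> v* jac f (xb \<tau> \<alpha>))
      + (exp (G p - G \<tau>) * (- d \<tau>)) *\<^sub>R normal_vec f xb \<tau> \<alpha>) (at \<tau> within {c..p})"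
    by (rule has_vector_derivative_scaleR)
  have eq: "exp (G p - G q) *\<^sub>R normal_vec f xb q \<alpha> = adjoint_normal p \<alpha> q" if "q \<in> {c..p}" for q
  proof -
    have "integral {c..q} d + integral {q..p} d = integral {c..p} d"
      using that by (intro Henstock_Kurzweil_Integration.integral_combine integrable_continuous_real cd) auto
    then show ?thesis by (simp add: adjoint_normal_def G_def d_def[abs_def] algebra_simps)
  qed
  have "(adjoint_normal p \<alpha> has_vector_derivative
      exp (G p - G \<tau>) *\<^sub>R (d \<tau> *\<^sub>R normal_vec f xb \<tau> \<alpha> - normal_vec f xb \<tau> \<alpha> v* jac f (xb \<tau> \<alpha>))
      + (exp (G p - G \<tau>) * (- d \<tau>)) *\<^sub>R normal_vec f xb \<tau> \<alpha>) (at \<tau> within {c..p})"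
    by (rule has_vector_derivative_transform[OF _ _ der]) (use assms eq in auto)
  moreover have "adjoint_normal p \<alpha> \<tau> v* jac f (xb \<tau> \<alpha>) =
      exp (G p - G \<tau>) *\<^sub>R (normal_vec f xb \<tau> \<alpha> v* jac f (xb \<tau> \<alpha>))"
    using eq[of \<tau>, symmetric] assms by (simp add: scaleR_vector_matrix_assoc)
  ultimately show ?thesis by (simp add: algebra_simps)
qed

end

text \<open>The integrating factor \<open>exp (- m * x)\<close> turns the differential inequality
  into monotonicity. The rate may have either sign: \<open>- 2 * B\<close> limits the backward
  growth of the squared adjoint norm, while \<open>\<mu>\<close> yields backward decay of a squared
  component near \<open>a\<close>.\<close>

lemma exp_weighted_mono:
  fixes u :: "real \<Rightarrow> real"
  assumes "a \<le> b" and u: "\<And>x. x \<in> {a..b} \<Longrightarrow> (u has_real_derivative u' x) (at x within {a..b})"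
    and ge: "\<And>x. x \<in> {a..b} \<Longrightarrow> u' x \<ge> m * u x"
  shows "u a \<le> exp (- m * (b - a)) * u b"
proof -
  define v where "v x = exp (- m * x) * u x" for x
  have v: "(v has_real_derivative exp (- m * x) * (u' x - m * u x)) (at x within {a..b})" if "x \<in> {a..b}" for x
    unfolding v_def by (rule derivative_eq_intros u[OF that] refl | simp add: algebra_simps)+
  have "v a \<le> v b"
  proof (rule DERIV_nonneg_imp_increasing_open[OF \<open>a \<le> b\<close>])
    fix x assume x: "a < x" "x < b"
    then have "DERIV v x :> exp (- m * x) * (u' x - m * u x)"
      using v[of x] at_within_Icc_at[of a x b] by simp
    then show "\<exists>y. DERIV v x :> y \<and> 0 \<le> y"
      using ge[of x] x by (intro exI conjI) auto
  next
    show "continuous_on {a..b} v"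
      by (rule DERIV_continuous_on[OF v])
  qed
  then have le: "exp (m * a) * v a \<le> exp (m * a) * v b" by simp
  moreover have "exp (m * a) * exp (- m * a) = 1" by (simp add: exp_minus)
  moreover have "exp (m * a) * exp (- m * b) = exp (- m * (b - a))"
    by (subst exp_add[symmetric]) (simp add: right_diff_distrib)
  ultimately have "exp (m * a) * v a = u a" "exp (m * a) * v b = exp (- m * (b - a)) * u b"
    unfolding v_def mult.assoc[symmetric] by simp_all
  with le show ?thesis by simp
qed

locale local_saddle = unstable_sheet \<Omega> f a P xb
  + saddle_coordinates "(*v) (jac f a)" zs z1 z2 l1 l2 ls es \<mu> K c
  for \<Omega> f a P xb zs z1 z2 l1 l2 ls es \<mu> K c +
  fixes R :: real
  assumes R: "R > 0" "ball a R \<subseteq> \<Omega>"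
    and near_linear: "\<And>x y. x \<in> ball a R \<Longrightarrow> y \<in> ball a R \<Longrightarrow>
      norm (f x - f y - jac f a *v (x - y)) \<le> \<mu> / (8 * c * K) * norm (x - y)"
    and cone: "\<And>x y. x \<in> param_set a xb {..P} \<inter> ball a R \<Longrightarrow> y \<in> param_set a xb {..P} \<inter> ball a R \<Longrightarrow>
      norm (zs (x - y)) \<le> norm (z1 (x - y)) + norm (z2 (x - y))"
    and jac_near: "\<And>x. x \<in> ball a R \<Longrightarrow>
      norm (jac f x *v es - jac f a *v es) \<le> \<mu> / (6 * K)"

lemma (in unstable_sheet) xb_frac:
  assumes "p \<le> P" shows "xb p (frac \<alpha>) = xb p \<alpha>"
proof -
  have n: "xb p (\<beta> + real n) = xb p \<beta>" for n \<beta>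
  proof (induction n)
    case (Suc n)
    have "xb p (\<beta> + real (Suc n)) = xb p ((\<beta> + real n) + 1)" by (simp add: ac_simps)
    then show ?case using xb_periodic[OF assms] Suc by simp
  qed simp
  show ?thesis
  proof (cases "\<lfloor>\<alpha>\<rfloor> \<ge> 0")
    case True
    then have "\<alpha> = frac \<alpha> + real (nat \<lfloor>\<alpha>\<rfloor>)" by (simp add: frac_def)
    then show ?thesis using n by metis
  next
    case False
    then have "frac \<alpha> = \<alpha> + real (nat (- \<lfloor>\<alpha>\<rfloor>))" by (simp add: frac_def)
    then show ?thesis using n by metis
  qed
qed

lemma (in unstable_sheet) xb_not_fixed:
  assumes "p \<le> P" shows "xb p \<alpha> \<noteq> a"
  using normal_nonzero[OF assms, of \<alpha>] a(2) by (auto simp: normal_vec_def)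

lemma (in unstable_sheet) local_saddle_exists:
  obtains zs z1 z2 l1 l2 ls es \<mu> K c R where "local_saddle \<Omega> f a P xb zs z1 z2 l1 l2 ls es \<mu> K c R"
proof -
  obtain zs z1 z2 l1 l2 ls es \<mu> K c
    where coords: "saddle_coordinates ((*v) (jac f a)) zs z1 z2 l1 l2 ls es \<mu> K c"
    and zs0: "\<And>v. v \<in> unstable_subspace (jac f a) \<Longrightarrow> zs v = 0"
    by (rule saddle_coordinates_exist[OF saddle]) (rule that)
  interpret saddle_coordinates "(*v) (jac f a)" zs z1 z2 l1 l2 ls es \<mu> K c by fact
  define S where "S = param_set a xb {..<P}"
  have zst: "zs v = 0" if "v \<in> tangent_space S a" for v
    using that zs0 tangent unfolding S_def by simp
  have "C2_surface S" "a \<in> S" using surface by (simp_all add: S_def param_set_def)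
  obtain R1 where R1: "R1 > 0" "\<And>x y. x \<in> S \<inter> ball a R1 \<Longrightarrow> y \<in> S \<inter> ball a R1 \<Longrightarrow>
    norm (zs (x - y)) \<le> norm (z1 (x - y)) + norm (z2 (x - y))"
    by (rule C2_surface_cone[OF coords \<open>C2_surface S\<close> \<open>a \<in> S\<close> zst]) (assumption, rule that)
  have pos: "\<mu> / (8 * c * K) > 0" using \<mu> c K by simp
  obtain R2 where R2: "R2 > 0" "ball a R2 \<subseteq> \<Omega>" "\<And>x y. x \<in> ball a R2 \<Longrightarrow> y \<in> ball a R2 \<Longrightarrow>
      norm (f x - f y - frechet_derivative f (at a) (x - y)) \<le> \<mu> / (8 * c * K) * norm (x - y)"
    by (rule C1_on_strict_derivative[OF open_\<Omega> C1_f a(1) pos]) (rule that)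
  \<comment> \<open>The closed boundary curve \<open>p = P\<close> avoids \<open>a\<close>, hence
    has positive distance from it; inside a smaller ball every sheet point has \<open>p < P\<close>
    or is \<open>a\<close>, and so belongs to the embedded surface.\<close>
  obtain R3 where R3: "R3 > 0" "\<And>\<alpha>. R3 \<le> dist (xb P \<alpha>) a"
  proof -
    have c1: "continuous_on {0..1} (\<lambda>\<alpha>. dist (xb P \<alpha>) a)"
    proof (intro continuous_intros)
      have "continuous_on {0..1} (\<lambda>\<alpha>. (P, \<alpha>))" "(\<lambda>\<alpha>. (P, \<alpha>)) ` {0..1::real} \<subseteq> {..P} \<times> UNIV"
        by (auto intro!: continuous_intros)
      from continuous_on_compose2[OF continuous_xb this] show "continuous_on {0..1} (xb P)" by simp
    qed
    obtain \<alpha>0 where "\<alpha>0 \<in> {0..1}" "\<And>\<alpha>. \<alpha> \<in> {0..1} \<Longrightarrow> dist (xb P \<alpha>0) a \<le> dist (xb P \<alpha>) a"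
      using continuous_attains_inf[OF _ _ c1] by auto
    then have "dist (xb P \<alpha>0) a \<le> dist (xb P \<alpha>) a" for \<alpha>
      using xb_frac[of P \<alpha>] frac_ge_0[of \<alpha>] less_imp_le[OF frac_lt_1[of \<alpha>]]
      by (metis atLeastAtMost_iff order_refl)
    with that[of "dist (xb P \<alpha>0) a"] xb_not_fixed[of P \<alpha>0] show ?thesis by simp
  qed
  have cj: "continuous_on \<Omega> (\<lambda>x. jac f x *v es)"
    unfolding matrix_vector_mult_def by (intro continuous_intros continuous_on_jac[OF open_\<Omega> C1_f])
  have "\<mu> / (6 * K) > 0" using \<mu> K by simp
  with cj a(1) obtain R4 where R4: "R4 > 0"
    "\<And>x. x \<in> \<Omega> \<Longrightarrow> dist x a < R4 \<Longrightarrow> dist (jac f x *v es) (jac f a *v es) < \<mu> / (6 * K)"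
    unfolding continuous_on_iff by metis
  define R where "R = Min {R1, R2, R3, R4}"
  have RR: "R > 0" "R \<le> R1" "R \<le> R2" "R \<le> R3" "R \<le> R4" using R1(1) R2(1) R3(1) R4(1) by (auto simp: R_def)
  have sub: "param_set a xb {..P} \<inter> ball a R \<subseteq> S \<inter> ball a R1"
  proof
    fix x assume x: "x \<in> param_set a xb {..P} \<inter> ball a R"
    then have xd: "dist x a < R" by (simp add: dist_commute)
    have "x \<in> S"
    proof (cases "x = a")
      case False
      then obtain p \<alpha> where px: "p \<le> P" "x = xb p \<alpha>" using x by (auto simp: param_set_def)
      then have "p \<noteq> P" using R3(2)[of \<alpha>] xd RR by auto
      then show ?thesis using px unfolding S_def param_set_def by force
    qed (simp add: S_def param_set_def)
    then show "x \<in> S \<inter> ball a R1" using xd RR by (auto simp: dist_commute)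
  qed
  have "local_saddle \<Omega> f a P xb zs z1 z2 l1 l2 ls es \<mu> K c R"
  proof (intro local_saddle.intro local_saddle_axioms.intro unstable_sheet_axioms coords)
    show "R > 0" "ball a R \<subseteq> \<Omega>" using RR R2(2) by (auto intro: subset_trans[OF subset_ball])
    show "norm (f x - f y - jac f a *v (x - y)) \<le> \<mu> / (8 * c * K) * norm (x - y)"
      if "x \<in> ball a R" "y \<in> ball a R" for x y
      using R2(3)[of x y] that RR jac_mult[OF open_\<Omega> C1_f a(1)] by simp
    show "norm (zs (x - y)) \<le> norm (z1 (x - y)) + norm (z2 (x - y))"
      if "x \<in> param_set a xb {..P} \<inter> ball a R" "y \<in> param_set a xb {..P} \<inter> ball a R" for x y
      using R1(2) sub that by blast
    show "norm (jac f x *v es - jac f a *v es) \<le> \<mu> / (6 * K)" if "x \<in> ball a R" for x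
    proof -
      have "x \<in> \<Omega>" "dist x a < R4" using that RR R2(2) by (auto simp: dist_commute)
      from R4(2)[OF this] show ?thesis by (simp add: dist_norm)
    qed
  qed
  then show ?thesis by (rule that)
qed

context local_saddle
begin

text \<open>Backward stability turns a single visit to a small ball into confinement at all earlier
  times. Having made such a visit by a fixed time is an open condition on the label, so finitely
  many entry times serve the whole compact circle.\<close>

lemma uniformly_near_fixed_point:
  assumes "r > 0"
  obtains p0 where "p0 < P" "\<And>p \<alpha>. p \<le> p0 \<Longrightarrow> \<alpha> \<in> {0..1} \<Longrightarrow> xb p \<alpha> \<in> ball a r"
proof -
  define r' where "r' = min r R / 2"
  \<comment> \<open>The constant of \<open>backward_stability\<close>, increased by 1 so that the
    bound also holds at the starting time.\<close>
  define C where "C = 8 * c * K + 1"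
  have C: "C \<ge> 1" using c K by (simp add: C_def)
  have r': "r' > 0" "r' < r" "r' < R" using assms R by (auto simp: r'_def)
  have trap: "norm (xb s \<alpha> - a) < r'" if q: "q \<le> P" "dist (xb q \<alpha>) a < r' / C" and "s \<le> q" for q \<alpha> s
  proof -
    have k: "C * norm (xb q \<alpha> - a) < r'" using q(2) C by (simp add: dist_norm field_simps)
    have "norm (xb s \<alpha> - a) \<le> C * norm (xb q \<alpha> - a)"
    proof (rule backward_bootstrap[OF _ _ k _ \<open>s \<le> q\<close>])
      show "continuous_on {..q} (\<lambda>s. xb s \<alpha> - a)"
      proof (intro continuous_intros)
        have "continuous_on {..q} (\<lambda>p. (p, \<alpha>))" "(\<lambda>p. (p, \<alpha>)) ` {..q} \<subseteq> {..P} \<times> UNIV"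
          using q by (auto intro!: continuous_intros)
        from continuous_on_compose2[OF continuous_xb this] show "continuous_on {..q} (\<lambda>p. xb p \<alpha>)" by simp
      qed
      show "norm (xb q \<alpha> - a) \<le> C * norm (xb q \<alpha> - a)"
        using C mult_right_mono[of 1 C "norm (xb q \<alpha> - a)"] by simp
      fix s assume s: "s \<le> q" and close: "\<And>\<sigma>. s \<le> \<sigma> \<Longrightarrow> \<sigma> \<le> q \<Longrightarrow> norm (xb \<sigma> \<alpha> - a) \<le> r'"
      have inb: "xb \<sigma> \<alpha> \<in> ball a R" if "\<sigma> \<in> {s..q}" for \<sigma>
        using close[of \<sigma>] that r' by (auto simp: dist_norm norm_minus_commute)
      \<comment> \<open>There is no forcing, and the cone condition is exact because
        \<open>a\<close> itself belongs to \<open>param_set\<close>; hence both defects are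
        zero.\<close>
      have "norm (xb s \<alpha> - a) \<le> 8 * c * K * (norm (xb q \<alpha> - a) + 0 / \<mu>) + 2 * c * 0"
      proof (rule backward_stability[where \<eta>="\<mu> / (8 * c * K)" and h="\<lambda>\<sigma>. f (xb \<sigma> \<alpha>)" and \<delta>="\<lambda>s. xb s \<alpha> - a"])
        show "((\<lambda>\<sigma>. f (xb \<sigma> \<alpha>)) has_integral (xb v \<alpha> - a) - (xb u \<alpha> - a)) {u..v}"
          if "s \<le> u" "u \<le> v" "v \<le> q" for u v
          using xb_integral[of u v \<alpha>] that q by simp
        show "norm (f (xb \<sigma> \<alpha>) - jac f a *v (xb \<sigma> \<alpha> - a)) \<le> \<mu> / (8 * c * K) * norm (xb \<sigma> \<alpha> - a) + 0"
          if "\<sigma> \<in> {s..q}" for \<sigma>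
          using near_linear[OF inb[OF that], of a] R a(2) by simp
        show "norm (zs (xb \<sigma> \<alpha> - a)) \<le> norm (z1 (xb \<sigma> \<alpha> - a)) + norm (z2 (xb \<sigma> \<alpha> - a)) + 0"
          if "\<sigma> \<in> {s..q}" for \<sigma>
        proof -
          have "\<sigma> \<le> P" using that q by auto
          then show ?thesis
            using cone[of "xb \<sigma> \<alpha>" a] inb[OF that] R by (auto simp: param_set_def)
        qed
      qed (use s c K \<mu> in auto)
      also have "\<dots> \<le> C * norm (xb q \<alpha> - a)" unfolding C_def distrib_right by simp
      finally show "norm (xb s \<alpha> - a) \<le> C * norm (xb q \<alpha> - a)" .
    qed
    then show ?thesis using k by simp
  qed
  have "\<exists>q<P. dist (xb q \<alpha>) a < r' / C" for \<alpha>
  proof -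
    have "\<forall>\<^sub>F p in at_bot. dist (xb p \<alpha>) a < r' / C"
      using tendstoD[OF xb_lim[of \<alpha>]] r' C by simp
    then have ev: "\<forall>\<^sub>F p in at_bot. p < P \<and> dist (xb p \<alpha>) a < r' / C"
      using eventually_conj[OF eventually_gt_at_bot[of P]] by simp
    then show ?thesis using eventually_happens[OF ev] by auto
  qed
  then obtain q where q: "\<And>\<alpha>. q \<alpha> < P" "\<And>\<alpha>. dist (xb (q \<alpha>) \<alpha>) a < r' / C" by metis
  define V where "V \<alpha> = {\<beta>. dist (xb (q \<alpha>) \<beta>) a < r' / C}" for \<alpha>
  have "open (V \<alpha>)" for \<alpha>
  proof -
    have "continuous_on UNIV (\<lambda>\<beta>. (q \<alpha>, \<beta>))" "(\<lambda>\<beta>. (q \<alpha>, \<beta>)) ` UNIV \<subseteq> {..P} \<times> UNIV"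
      using q(1)[of \<alpha>] by (auto intro!: continuous_intros)
    from continuous_on_compose2[OF continuous_xb this] have "continuous_on UNIV (\<lambda>\<beta>. xb (q \<alpha>) \<beta>)" by simp
    then show ?thesis unfolding V_def by (intro open_Collect_less continuous_intros)
  qed
  moreover have "{0..1} \<subseteq> (\<Union>\<alpha>\<in>{0..1}. V \<alpha>)" using q(2) by (auto simp: V_def)
  ultimately obtain I where I: "I \<subseteq> {0..1}" "finite I" "{0..1} \<subseteq> (\<Union>\<alpha>\<in>I. V \<alpha>)"
    using compactE_image[OF compact_Icc, of "{0..1}" V] by metis
  have "I \<noteq> {}" using I(3) by auto
  define p0 where "p0 = Min (q ` I)"
  have "p0 < P" using I \<open>I \<noteq> {}\<close> q(1) by (auto simp: p0_def Min_less_iff)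
  moreover have "xb p \<alpha> \<in> ball a r" if "p \<le> p0" "\<alpha> \<in> {0..1}" for p \<alpha>
  proof -
    obtain i where i: "i \<in> I" "\<alpha> \<in> V i" using I(3) \<open>\<alpha> \<in> {0..1}\<close> by auto
    have "p \<le> q i" using order_trans[OF that(1)[unfolded p0_def] Min_le[of "q ` I" "q i"]] I(2) i(1) by simp
    from trap[OF less_imp_le[OF q(1)] _ this, of \<alpha>] i(2) r' show ?thesis
      by (auto simp: V_def dist_norm norm_minus_commute)
  qed
  ultimately show ?thesis by (rule that)
qed

text \<open>A vector orthogonal to the normal is a combination of the two partial derivatives of
  \<open>xb\<close>, hence the velocity at 0 of the image of a straight path of parameters. The
  secant cone condition along this path, divided by the parameter \<open>h\<close>, holds for
  \<open>v\<close> up to an arbitrarily small error.\<close>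

lemma tangent_cone:
  assumes p: "p < P" "xb p \<alpha> \<in> ball a R" and v: "v \<bullet> normal_vec f xb p \<alpha> = 0"
  shows "norm (zs v) \<le> norm (z1 v) + norm (z2 v)"
proof -
  define N where "N = normal_vec f xb p \<alpha>"
  have N: "norm N > 0" using normal_nonzero[of p \<alpha>] p by (simp add: N_def)
  define c1 c2 where "c1 = cross3 v (xb_alpha xb p \<alpha>) \<bullet> N / (norm N)\<^sup>2"
    and "c2 = cross3 (f (xb p \<alpha>)) v \<bullet> N / (norm N)\<^sup>2"
  have "(norm N)\<^sup>2 *\<^sub>R v = (norm N)\<^sup>2 *\<^sub>R (c1 *\<^sub>R f (xb p \<alpha>) + c2 *\<^sub>R xb_alpha xb p \<alpha>)"
    using cross3_span_decomposition[of v "f (xb p \<alpha>)" "xb_alpha xb p \<alpha>"] v N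
    unfolding normal_vec_def[symmetric] N_def[symmetric] c1_def c2_def
    by (simp add: scaleR_add_right)
  then have veq: "v = c1 *\<^sub>R f (xb p \<alpha>) + c2 *\<^sub>R xb_alpha xb p \<alpha>" using N by simp
  obtain D where D: "\<forall>p\<le>P. \<forall>\<alpha>. ((\<lambda>(p, \<alpha>). xb p \<alpha>) has_derivative blinfun_apply (D (p, \<alpha>))) (at (p, \<alpha>) within {..P} \<times> UNIV)"
    and "continuous_on ({..P} \<times> UNIV) D"
    and "\<forall>p\<le>P. \<forall>\<alpha>. ((\<lambda>\<beta>. xb p \<beta>) has_vector_derivative blinfun_apply (D (p, \<alpha>)) (0, 1)) (at \<alpha>)"
    and D2: "\<forall>p\<le>P. \<forall>\<alpha>. blinfun_apply (D (p, \<alpha>)) (0, 1) = xb_alpha xb p \<alpha>"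
    and D1: "\<forall>p\<le>P. \<forall>\<alpha>. blinfun_apply (D (p, \<alpha>)) (1, 0) = f (xb p \<alpha>)"
    using xb_partials .
  have "blinfun_apply (D (p, \<alpha>)) (c1 *\<^sub>R (1, 0) + c2 *\<^sub>R (0, 1)) = v"
    unfolding blinfun.add_right blinfun.scaleR_right using D1 D2 p veq by simp
  then have Dv: "blinfun_apply (D (p, \<alpha>)) (c1, c2) = v" by simp
  \<comment> \<open>Since \<open>p < P\<close>, the point is interior to the parameter domain and
    the path may leave it in any direction.\<close>
  have "at (p, \<alpha>) within {..P} \<times> UNIV = at (p, \<alpha>)"
    by (rule at_within_open_subset[of _ "{..<P} \<times> UNIV"]) (use p in \<open>auto intro!: open_Times\<close>)
  then have der: "((\<lambda>(p, \<alpha>). xb p \<alpha>) has_derivative blinfun_apply (D (p, \<alpha>))) (at (p, \<alpha>))"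
    using D p by (metis less_imp_le)
  have path: "((\<lambda>h. (p + h * c1, \<alpha> + h * c2)) has_derivative (\<lambda>h. (h * c1, h * c2))) (at 0)"
    by (auto intro!: derivative_eq_intros)
  define \<gamma> where "\<gamma> h = xb (p + h * c1) (\<alpha> + h * c2)" for h
  have "((\<lambda>h. (\<lambda>(p, \<alpha>). xb p \<alpha>) (p + h * c1, \<alpha> + h * c2)) has_derivative
      (\<lambda>h. blinfun_apply (D (p, \<alpha>)) (h * c1, h * c2))) (at 0)"
    by (rule has_derivative_compose[OF path]) (use der in simp)
  moreover have "blinfun_apply (D (p, \<alpha>)) (h * c1, h * c2) = h *\<^sub>R v" for h
    using blinfun.scaleR_right[of "D (p, \<alpha>)" h "(c1, c2)"] Dv by simp
  ultimately have \<gamma>: "(\<gamma> has_derivative (\<lambda>h. h *\<^sub>R v)) (at 0)"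
    by (simp add: \<gamma>_def[abs_def])
  have "\<forall>\<^sub>F h in nhds 0. p + h * c1 < P \<and> \<gamma> h \<in> ball a R"
  proof (intro eventually_conj)
    have "((\<lambda>h. p + h * c1) \<longlongrightarrow> p + 0 * c1) (nhds 0)" by (intro tendsto_intros filterlim_ident)
    then show "\<forall>\<^sub>F h in nhds 0. p + h * c1 < P" using order_tendstoD(2) p by fastforce
    have "isCont \<gamma> 0" using \<gamma> has_derivative_continuous by blast
    then have "(\<gamma> \<longlongrightarrow> \<gamma> 0) (nhds 0)" by (simp add: continuous_at tendsto_at_iff_tendsto_nhds)
    then show "\<forall>\<^sub>F h in nhds 0. \<gamma> h \<in> ball a R"
      using topological_tendstoD[OF _ open_ball, of \<gamma> "\<gamma> 0"] p by (simp add: \<gamma>_def)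
  qed
  then obtain d0 where d0: "d0 > 0" "\<And>h. \<bar>h\<bar> < d0 \<Longrightarrow> p + h * c1 < P \<and> \<gamma> h \<in> ball a R"
    unfolding eventually_nhds_metric by (auto simp: dist_norm)
  have "norm (zs v) \<le> norm (z1 v) + norm (z2 v) + 3 * K * e" if "e > 0" for e
  proof -
    obtain d1 where d1: "d1 > 0" "\<And>h. \<bar>h\<bar> < d1 \<Longrightarrow> norm (\<gamma> h - \<gamma> 0 - h *\<^sub>R v) \<le> e * \<bar>h\<bar>"
      using \<gamma> \<open>e > 0\<close> unfolding has_derivative_at_alt by (metis diff_zero real_norm_def)
    define h where "h = min d0 d1 / 2"
    have h: "h > 0" "h < d0" "h < d1" using d0(1) d1(1) by (auto simp: h_def)
    define g where "g = \<gamma> h - \<gamma> 0"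
    have gv: "norm (g - h *\<^sub>R v) \<le> e * h" using d1(2)[of h] h by (simp add: g_def)
    have Kz: "norm (z g - z (h *\<^sub>R v)) \<le> K * (e * h)" if "bounded_linear z" "\<And>v. norm (z v) \<le> K * norm v"
      for z :: "real^3 \<Rightarrow> complex"
    proof -
      have "z g - z (h *\<^sub>R v) = z (g - h *\<^sub>R v)" using linear_diff[OF bounded_linear.linear[OF that(1)]] by simp
      then show ?thesis using order_trans[OF that(2) mult_left_mono[OF gv]] K(1) by simp
    qed
    have sc: "norm (z (h *\<^sub>R v)) = h * norm (z v)" if "bounded_linear z" for z :: "real^3 \<Rightarrow> complex"
      using h linear_scale[OF bounded_linear.linear[OF that]] by simp
    have cn: "norm (zs g) \<le> norm (z1 g) + norm (z2 g)"
    proof -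
      have "\<gamma> h \<in> param_set a xb {..P} \<inter> ball a R" "\<gamma> 0 \<in> param_set a xb {..P} \<inter> ball a R"
        using d0(2)[of h] d0(2)[of 0] h d0(1) by (auto simp: param_set_def \<gamma>_def intro!: less_imp_le)
      then show ?thesis unfolding g_def by (rule cone)
    qed
    have "h * norm (zs v) \<le> norm (zs g) + K * (e * h)"
      using Kz[OF zs K(2)] sc[OF zs] norm_triangle_sub[of "zs (h *\<^sub>R v)" "zs g"] by (simp add: norm_minus_commute)
    also note cn
    also have "norm (z1 g) \<le> h * norm (z1 v) + K * (e * h)"
      using Kz[OF z1 K(3)] sc[OF z1] norm_triangle_sub[of "z1 g" "z1 (h *\<^sub>R v)"] by simp
    also have "norm (z2 g) \<le> h * norm (z2 v) + K * (e * h)"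
      using Kz[OF z2 K(4)] sc[OF z2] norm_triangle_sub[of "z2 g" "z2 (h *\<^sub>R v)"] by simp
    finally have "h * norm (zs v) \<le> h * (norm (z1 v) + norm (z2 v) + 3 * K * e)"
      by (simp add: algebra_simps)
    then show ?thesis using h mult_le_cancel_left_pos by blast
  qed
  note approx = this
  show ?thesis
  proof (rule field_le_epsilon)
    fix x :: real assume "x > 0"
    then show "norm (zs v) \<le> norm (z1 v) + norm (z2 v) + x"
      using approx[of "x / (3 * K)"] K(1) by simp
  qed
qed

text \<open>If the normal were almost orthogonal to \<open>es\<close>, then \<open>es\<close> would
  be almost tangent; but \<open>zs\<close> equals 1 there while \<open>z1\<close> and
  \<open>z2\<close> vanish, against the cone condition. The vector \<open>v\<close> in the proof is
  the orthogonal projection of \<open>es\<close> to the tangent plane, scaled by the squared length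
  of \<open>N\<close>.\<close>

lemma normal_transverse:
  assumes "p < P" "xb p \<alpha> \<in> ball a R"
  shows "norm (normal_vec f xb p \<alpha>) \<le> 3 * K * \<bar>normal_vec f xb p \<alpha> \<bullet> es\<bar>"
proof -
  define N where "N = normal_vec f xb p \<alpha>"
  define v where "v = (N \<bullet> N) *\<^sub>R es - (N \<bullet> es) *\<^sub>R N"
  have "v \<bullet> N = 0" by (simp add: v_def inner_diff_left inner_commute[of es N])
  then have cn: "norm (zs v) \<le> norm (z1 v) + norm (z2 v)"
    using tangent_cone[OF assms] by (simp add: N_def)
  have zv: "z v = (N \<bullet> N) *\<^sub>R z es - (N \<bullet> es) *\<^sub>R z N" if "bounded_linear z" for z :: "real^3 \<Rightarrow> complex"
    using linear_diff[OF bounded_linear.linear[OF that]] linear_scale[OF bounded_linear.linear[OF that]]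
    by (simp add: v_def)
  have "(norm N)\<^sup>2 \<le> norm (zs v) + \<bar>N \<bullet> es\<bar> * norm (zs N)"
    using norm_triangle_sub[of "(N \<bullet> N) *\<^sub>R zs es" "(N \<bullet> es) *\<^sub>R zs N"] es(2)
    by (simp add: zv[OF zs] power2_norm_eq_inner)
  also note cn
  also have "norm (z1 v) + norm (z2 v) + \<bar>N \<bullet> es\<bar> * norm (zs N) = \<bar>N \<bullet> es\<bar> * (norm (z1 N) + norm (z2 N) + norm (zs N))"
    using es by (simp add: zv[OF z1] zv[OF z2] algebra_simps)
  also have "\<dots> \<le> \<bar>N \<bullet> es\<bar> * (3 * K * norm N)"
    using K(2-4)[of N] by (intro mult_left_mono) auto
  finally have "norm N * norm N \<le> norm N * (3 * K * \<bar>N \<bullet> es\<bar>)"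
    by (simp add: power2_eq_square algebra_simps)
  moreover have "norm N > 0" using normal_nonzero[of p \<alpha>] assms by (simp add: N_def)
  ultimately show ?thesis unfolding N_def by simp
qed

end

text \<open>The curve is sampled on a grid of width \<open>1 / Suc n\<close>, so that for each grid
  index a single function \<open>g x\<close> of time occurs. Gluing countably many of them is
  measurable, and continuity in the space variable gives the pointwise limit.\<close>

lemma caratheodory_measurable:
  fixes g :: "'a::{second_countable_topology, real_normed_vector} \<Rightarrow> real \<Rightarrow> 'b::{second_countable_topology, real_normed_vector}"
  assumes g: "\<And>x. x \<in> S \<Longrightarrow> g x \<in> borel_measurable lebesgue"
    and cont: "\<And>t. continuous_on S (\<lambda>x. g x t)"
    and \<gamma>: "continuous_on {..b} \<gamma>" "\<And>\<tau>. \<tau> \<le> b \<Longrightarrow> \<gamma> \<tau> \<in> S"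
  shows "(\<lambda>\<tau>. g (\<gamma> \<tau>) (\<tau> + d)) \<in> borel_measurable (lebesgue_on {..b})"
proof -
  \<comment> \<open>Rounding down keeps sample times inside \<open>{..b}\<close>, where
    \<open>\<gamma>\<close> is controlled.\<close>
  define q where "q n \<tau> = real_of_int \<lfloor>real (Suc n) * \<tau>\<rfloor> / real (Suc n)" for n \<tau>
  have q_le: "q n \<tau> \<le> \<tau>" for n \<tau>
    unfolding q_def by (simp add: divide_le_eq mult.commute del: of_nat_Suc)
  have q_ge: "\<tau> - 1 / real (Suc n) \<le> q n \<tau>" for n \<tau>
  proof -
    have "real (Suc n) * \<tau> - 1 \<le> real_of_int \<lfloor>real (Suc n) * \<tau>\<rfloor>" by linarith
    then have "(real (Suc n) * \<tau> - 1) / real (Suc n) \<le> q n \<tau>"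
      unfolding q_def by (intro divide_right_mono) auto
    then show ?thesis by (simp add: diff_divide_distrib del: of_nat_Suc)
  qed
  have lim_q: "(\<lambda>n. q n \<tau>) \<longlonglongrightarrow> \<tau>" for \<tau>
  proof (rule tendsto_sandwich)
    have "(\<lambda>n. \<tau> - 1 / real (Suc n)) \<longlonglongrightarrow> \<tau> - 0"
      by (intro tendsto_intros LIMSEQ_Suc[OF lim_1_over_n])
    then show "(\<lambda>n. \<tau> - 1 / real (Suc n)) \<longlonglongrightarrow> \<tau>" by simp
  qed (use q_ge q_le in auto)
  show ?thesis
  proof (rule borel_measurable_LIMSEQ_metric)
    fix \<tau> assume "\<tau> \<in> space (lebesgue_on {..b})"
    then have \<tau>: "\<tau> \<le> b" by simp
    have "(\<lambda>n. \<gamma> (q n \<tau>)) \<longlonglongrightarrow> \<gamma> \<tau>"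
      using \<tau> by (intro continuous_on_tendsto_compose[OF \<gamma>(1) lim_q] always_eventually allI)
        (auto intro: order_trans[OF q_le])
    then show "(\<lambda>n. g (\<gamma> (q n \<tau>)) (\<tau> + d)) \<longlonglongrightarrow> g (\<gamma> \<tau>) (\<tau> + d)"
      using \<tau> by (intro continuous_on_tendsto_compose[OF cont] always_eventually allI \<gamma>(2))
        (auto intro: order_trans[OF q_le])
  next
    fix n
    \<comment> \<open>\<open>min b\<close> makes the sample point lie in \<open>S\<close> for every
      integer; at the indices reached from \<open>\<tau> \<le> b\<close> it changes nothing.\<close>
    define x where "x i = \<gamma> (min b (real_of_int i / real (Suc n)))" for i :: int
    have "(\<lambda>\<tau>. g (x \<lfloor>real (Suc n) * \<tau>\<rfloor>) (\<tau> + d)) \<in> borel_measurable (lebesgue_on {..b})"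
    proof (rule measurable_compose_countable)
      fix i :: int
      have sh: "(\<lambda>\<tau>. d + 1 *\<^sub>R \<tau>) \<in> lebesgue \<rightarrow>\<^sub>M (lebesgue :: real measure)"
        using lebesgue_affine_measurable[where c="\<lambda>_. 1" and t=d] by simp
      have "g (x i) \<in> borel_measurable lebesgue" unfolding x_def by (intro g \<gamma>) auto
      from measurable_compose[OF sh this]
      have "(\<lambda>\<tau>. g (x i) (\<tau> + d)) \<in> borel_measurable lebesgue" by (simp add: add.commute)
      then show "(\<lambda>\<tau>. g (x i) (\<tau> + d)) \<in> borel_measurable (lebesgue_on {..b})"
        by (rule measurable_restrict_space1)
    next
      have "(\<lambda>\<tau>. \<lfloor>real (Suc n) * \<tau>\<rfloor>) \<in> lebesgue \<rightarrow>\<^sub>M count_space UNIV"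
        by (rule measurable_compose[OF measurable_completion]) measurable
      then show "(\<lambda>\<tau>. \<lfloor>real (Suc n) * \<tau>\<rfloor>) \<in> lebesgue_on {..b} \<rightarrow>\<^sub>M count_space UNIV"
        by (rule measurable_restrict_space1)
    qed
    moreover have eq: "g (x \<lfloor>real (Suc n) * \<tau>\<rfloor>) (\<tau> + d) = g (\<gamma> (q n \<tau>)) (\<tau> + d)"
      if "\<tau> \<in> space (lebesgue_on {..b})" for \<tau>
      using that order_trans[OF q_le, of \<tau> b n] by (simp add: x_def q_def min_absorb2 del: of_nat_Suc)
    ultimately show "(\<lambda>\<tau>. g (\<gamma> (q n \<tau>)) (\<tau> + d)) \<in> borel_measurable (lebesgue_on {..b})"
      by (rule measurable_cong[THEN iffD1, rotated])
  qed
qed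

lemma has_integral_exp_to_minus_infinity:
  fixes \<kappa> :: real
  assumes "\<kappa> > 0"
  shows "((\<lambda>\<tau>. exp (- \<kappa> * (p - \<tau>))) has_integral exp (- \<kappa> * (p - s)) / \<kappa>) {..s}"
proof -
  have "((\<lambda>x. exp (- \<kappa> * x)) has_integral exp (- \<kappa> * (- s)) / \<kappa>) {- s..}"
    by (rule has_integral_exp_minus_to_infinity[OF assms])
  then have "(\<lambda>x. exp (- \<kappa> * x)) absolutely_integrable_on {- s..} \<and>
      integral {- s..} (\<lambda>x. exp (- \<kappa> * x)) = exp (- \<kappa> * (- s)) / \<kappa>"
    by (auto intro!: nonnegative_absolutely_integrable_1 dest: integral_unique)
  then have "(\<lambda>x. exp (- \<kappa> * - x)) absolutely_integrable_on {..s} \<and>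
      integral {..s} (\<lambda>x. exp (- \<kappa> * - x)) = exp (- \<kappa> * (- s)) / \<kappa>"
    by (subst has_absolute_integral_reflect_real[where B="{- s..}"]) auto
  then have "((\<lambda>x. exp (- \<kappa> * - x)) has_integral exp (- \<kappa> * (- s)) / \<kappa>) {..s}"
    using set_lebesgue_integral_eq_integral(1) has_integral_iff by blast
  from has_integral_mult_right[OF this, of "exp (- \<kappa> * p)"]
  show ?thesis by (simp add: exp_add[symmetric] algebra_simps)
qed

context local_saddle
begin

text \<open>Later than \<open>p0\<close> only a stretch of length at most \<open>P - p0\<close>
  remains, on which the bound on the Jacobian limits growth by a constant. Earlier than
  \<open>p0\<close>, the component \<open>\<theta>\<close> along \<open>es\<close> has derivative
  \<open>- (ls * \<theta> + r)\<close> with small \<open>r\<close> and \<open>ls < 0\<close>.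
  Squares are used because they are differentiable also at zero.\<close>

lemma adjoint_decay:
  assumes B: "\<And>x v. x \<in> \<Omega> \<Longrightarrow> norm (jac f x *v v) \<le> B * norm v" "B \<ge> 0"
  obtains \<kappa> C where "\<kappa> > 0" "C > 0" "\<And>p \<alpha> \<tau>. p \<le> P \<Longrightarrow> \<alpha> \<in> {0..1} \<Longrightarrow> \<tau> \<le> p \<Longrightarrow>
    norm (adjoint_normal p \<alpha> \<tau>) \<le> C * exp (- \<kappa> * (p - \<tau>)) * norm (normal_vec f xb p \<alpha>)"
proof -
  obtain p0 where p0: "p0 < P" "\<And>p \<alpha>. p \<le> p0 \<Longrightarrow> \<alpha> \<in> {0..1} \<Longrightarrow> xb p \<alpha> \<in> ball a R"
    by (rule uniformly_near_fixed_point[OF R(1)]) (rule that)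
  have w2: "((\<lambda>\<tau>. (adjoint_normal p \<alpha> \<tau> \<bullet> v \<tau>)) has_real_derivative
       adjoint_normal p \<alpha> \<tau> \<bullet> v' - adjoint_normal p \<alpha> \<tau> \<bullet> (jac f (xb \<tau> \<alpha>) *v v \<tau>)) (at \<tau> within {s..q})"
    if "s \<le> \<tau>" "\<tau> \<le> q" "q \<le> p" "p \<le> P" "(v has_vector_derivative v') (at \<tau> within {s..q})" for p \<alpha> \<tau> s q v v'
  proof -
    have "(adjoint_normal p \<alpha> has_vector_derivative - (adjoint_normal p \<alpha> \<tau> v* jac f (xb \<tau> \<alpha>))) (at \<tau> within {s..q})"
      by (rule has_vector_derivative_within_subset[OF adjoint_normal_deriv[of s]]) (use that in auto)
    from bounded_bilinear.has_vector_derivative[OF bounded_bilinear_inner this that(5)]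
    show ?thesis
      by (simp add: has_real_derivative_iff_has_vector_derivative dot_lmul_matrix)
  qed
  have fin: "(norm (adjoint_normal p \<alpha> \<tau>))\<^sup>2 \<le> exp (2 * B * (q - \<tau>)) * (norm (adjoint_normal p \<alpha> q))\<^sup>2"
    if "\<tau> \<le> q" "q \<le> p" "p \<le> P" for p \<alpha> \<tau> q
  proof -
    define w where "w = adjoint_normal p \<alpha>"
    have "w \<tau> \<bullet> w \<tau> \<le> exp (- (- 2 * B) * (q - \<tau>)) * (w q \<bullet> w q)"
    proof (rule exp_weighted_mono[OF that(1)])
      fix x assume x: "x \<in> {\<tau>..q}"
      have "(w has_vector_derivative - (w x v* jac f (xb x \<alpha>))) (at x within {\<tau>..q})"
        unfolding w_def
        by (rule has_vector_derivative_within_subset[OF adjoint_normal_deriv[of \<tau>]]) (use x that in auto)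
      from w2[of \<tau> x q p w _ \<alpha>, OF _ _ _ _ this] x that
      show "((\<lambda>x. w x \<bullet> w x) has_real_derivative - 2 * (w x \<bullet> (jac f (xb x \<alpha>) *v w x))) (at x within {\<tau>..q})"
        by (simp add: w_def dot_lmul_matrix inner_commute[of _ "_ v* _"])
      have "w x \<bullet> (jac f (xb x \<alpha>) *v w x) \<le> norm (w x) * (B * norm (w x))"
        using B(1)[OF xb_in, of x] x that
        by (intro order_trans[OF norm_cauchy_schwarz] mult_left_mono) auto
      then show "- 2 * B * (w x \<bullet> w x) \<le> - 2 * (w x \<bullet> (jac f (xb x \<alpha>) *v w x))"
        by (simp add: power2_norm_eq_inner[symmetric] power2_eq_square algebra_simps)
    qed
    then show ?thesis by (simp add: w_def power2_norm_eq_inner)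
  qed
  have near: "(norm (adjoint_normal p \<alpha> \<tau>))\<^sup>2 \<le> (3 * K * norm es)\<^sup>2 * exp (- \<mu> * (q - \<tau>)) * (norm (adjoint_normal p \<alpha> q))\<^sup>2"
    if "\<tau> \<le> q" "q \<le> p" "p \<le> P" "q \<le> p0" "\<alpha> \<in> {0..1}" for p \<alpha> \<tau> q
  proof -
    define w where "w = adjoint_normal p \<alpha>"
    have tr: "norm (w x) \<le> 3 * K * \<bar>w x \<bullet> es\<bar>" if "x \<le> p0" for x
    proof -
      have "norm (normal_vec f xb x \<alpha>) \<le> 3 * K * \<bar>normal_vec f xb x \<alpha> \<bullet> es\<bar>"
        using p0 \<open>x \<le> p0\<close> \<open>\<alpha> \<in> {0..1}\<close> by (intro normal_transverse) auto
      then show ?thesis unfolding w_def adjoint_normal_def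
        by (simp add: abs_mult mult_left_mono mult.left_commute)
    qed
    have "(w \<tau> \<bullet> es)\<^sup>2 \<le> exp (- \<mu> * (q - \<tau>)) * (w q \<bullet> es)\<^sup>2"
    proof (rule exp_weighted_mono[OF that(1)])
      fix x assume x: "x \<in> {\<tau>..q}"
      have "((\<lambda>_. es) has_vector_derivative 0) (at x within {\<tau>..q})" by simp
      from w2[of \<tau> x q p "\<lambda>_. es" 0 \<alpha>, OF _ _ _ _ this] x that
      have "((\<lambda>x. w x \<bullet> es) has_real_derivative - (w x \<bullet> (jac f (xb x \<alpha>) *v es))) (at x within {\<tau>..q})"
        by (simp add: w_def)
      then show "((\<lambda>x. (w x \<bullet> es)\<^sup>2) has_real_derivative
          2 * (w x \<bullet> es) * (- (w x \<bullet> (jac f (xb x \<alpha>) *v es)))) (at x within {\<tau>..q})"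
        by (auto intro!: derivative_eq_intros)
      define \<theta> where "\<theta> = w x \<bullet> es"
      define r where "r = w x \<bullet> (jac f (xb x \<alpha>) *v es - jac f a *v es)"
      have eq: "w x \<bullet> (jac f (xb x \<alpha>) *v es) = ls * \<theta> + r"
        by (simp add: r_def inner_diff_right es(1) \<theta>_def)
      have "\<bar>r\<bar> \<le> norm (w x) * (\<mu> / (6 * K))"
        unfolding r_def
        by (rule order_trans[OF Cauchy_Schwarz_ineq2 mult_left_mono[OF jac_near]]) (use p0(2)[of x \<alpha>] x that in auto)
      also have "\<dots> \<le> (3 * K * \<bar>\<theta>\<bar>) * (\<mu> / (6 * K))"
        using tr[of x] x that \<mu> K unfolding \<theta>_def by (intro mult_right_mono) auto
      \<comment> \<open>The derivative of \<open>\<theta>\<^sup>2\<close> doubles everything: the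
        linear part supplies the rate \<open>2 * \<mu>\<close>, the error takes
        \<open>\<mu>\<close>, and \<open>\<mu>\<close> is left.\<close>
      also have "\<dots> = \<mu> / 2 * \<bar>\<theta>\<bar>" using K by simp
      finally have "\<bar>\<theta>\<bar> * \<bar>r\<bar> \<le> \<bar>\<theta>\<bar> * (\<mu> / 2 * \<bar>\<theta>\<bar>)" by (intro mult_left_mono) auto
      then have "\<theta> * r \<le> \<mu> / 2 * \<theta>\<^sup>2"
        by (metis abs_ge_self abs_mult abs_mult_self_eq mult.left_commute order_trans power2_eq_square)
      moreover have "\<mu> * \<theta>\<^sup>2 \<le> - ls * \<theta>\<^sup>2" using \<mu> by (intro mult_right_mono) auto
      ultimately show "\<mu> * (w x \<bullet> es)\<^sup>2 \<le> 2 * (w x \<bullet> es) * (- (w x \<bullet> (jac f (xb x \<alpha>) *v es)))"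
        unfolding eq \<theta>_def[symmetric] by (simp add: power2_eq_square algebra_simps)
    qed
    also have "(w q \<bullet> es)\<^sup>2 \<le> (norm (w q) * norm es)\<^sup>2"
      by (rule power2_le_iff_abs_le[THEN iffD2]) (auto intro: Cauchy_Schwarz_ineq2)
    finally have le: "(w \<tau> \<bullet> es)\<^sup>2 \<le> exp (- \<mu> * (q - \<tau>)) * (norm (w q) * norm es)\<^sup>2" by simp
    have "(norm (w \<tau>))\<^sup>2 \<le> (3 * K * \<bar>w \<tau> \<bullet> es\<bar>)\<^sup>2"
      using tr[of \<tau>] that by (intro power_mono) auto
    also have "\<dots> = (3 * K)\<^sup>2 * (w \<tau> \<bullet> es)\<^sup>2" by (simp add: power_mult_distrib)
    also have "\<dots> \<le> (3 * K)\<^sup>2 * (exp (- \<mu> * (q - \<tau>)) * (norm (w q) * norm es)\<^sup>2)"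
      by (intro mult_left_mono le) auto
    finally show ?thesis by (simp add: w_def power_mult_distrib ac_simps)
  qed
  define L where "L = P - p0"
  \<comment> \<open>The summand 1 covers \<open>\<tau> > p0\<close>, where the split point is
    \<open>\<tau>\<close> itself; the exponential pays for growth at rate \<open>2 * B\<close> and
    for missing decay at rate \<open>\<mu>\<close> over a stretch of length at most
    \<open>L\<close>.\<close>
  define C2 where "C2 = (1 + (3 * K * norm es)\<^sup>2) * exp ((2 * B + \<mu>) * L)"
  have C2: "C2 > 0" unfolding C2_def by (intro mult_pos_pos add_pos_nonneg) auto
  have sq: "(norm (adjoint_normal p \<alpha> \<tau>))\<^sup>2 \<le> C2 * exp (- \<mu> * (p - \<tau>)) * (norm (normal_vec f xb p \<alpha>))\<^sup>2"
    if p: "p \<le> P" "\<alpha> \<in> {0..1}" "\<tau> \<le> p" for p \<alpha> \<tau>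
  proof -
    \<comment> \<open>The split point is \<open>p0\<close> moved into \<open>{\<tau>..p}\<close>:
      \<open>near\<close> applies below it and \<open>fin\<close> above it.\<close>
    define q where "q = min p (max p0 \<tau>)"
    have q: "\<tau> \<le> q" "q \<le> p" using p by (auto simp: q_def)
    have pq: "p - q \<le> L" using p p0 by (auto simp: q_def L_def)
    have L: "L \<ge> 0" using p0 by (simp add: L_def)
    have 1: "(norm (adjoint_normal p \<alpha> q))\<^sup>2 \<le> exp (2 * B * L) * (norm (normal_vec f xb p \<alpha>))\<^sup>2"
    proof -
      have "(norm (adjoint_normal p \<alpha> q))\<^sup>2 \<le> exp (2 * B * (p - q)) * (norm (adjoint_normal p \<alpha> p))\<^sup>2"
        using fin[OF q(2) order_refl p(1)] .
      also have "\<dots> \<le> exp (2 * B * L) * (norm (adjoint_normal p \<alpha> p))\<^sup>2"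
        using pq B(2) by (intro mult_right_mono) (auto intro: mult_left_mono)
      finally show ?thesis by simp
    qed
    have 2: "(norm (adjoint_normal p \<alpha> \<tau>))\<^sup>2 \<le> (1 + (3 * K * norm es)\<^sup>2) * exp (- \<mu> * (q - \<tau>)) * (norm (adjoint_normal p \<alpha> q))\<^sup>2"
    proof (cases "\<tau> \<le> p0")
      case True
      then have "q \<le> p0" by (simp add: q_def)
      from near[OF q p(1) this p(2)]
      have "(norm (adjoint_normal p \<alpha> \<tau>))\<^sup>2 \<le> (3 * K * norm es)\<^sup>2 * exp (- \<mu> * (q - \<tau>)) * (norm (adjoint_normal p \<alpha> q))\<^sup>2" .
      also have "\<dots> \<le> (1 + (3 * K * norm es)\<^sup>2) * exp (- \<mu> * (q - \<tau>)) * (norm (adjoint_normal p \<alpha> q))\<^sup>2"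
        by (intro mult_right_mono) auto
      finally show ?thesis .
    next
      case False
      then have "q = \<tau>" using p by (simp add: q_def)
      then show ?thesis by (simp add: algebra_simps)
    qed
    have "exp (- \<mu> * (q - \<tau>)) \<le> exp (\<mu> * L) * exp (- \<mu> * (p - \<tau>))"
    proof -
      have "\<mu> * (p - q) \<le> \<mu> * L" using pq \<mu>(1) by (intro mult_left_mono) auto
      then show ?thesis by (simp add: exp_add[symmetric] algebra_simps)
    qed
    then have "(1 + (3 * K * norm es)\<^sup>2) * exp (- \<mu> * (q - \<tau>)) * (norm (adjoint_normal p \<alpha> q))\<^sup>2
      \<le> (1 + (3 * K * norm es)\<^sup>2) * (exp (\<mu> * L) * exp (- \<mu> * (p - \<tau>))) * (exp (2 * B * L) * (norm (normal_vec f xb p \<alpha>))\<^sup>2)"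
      using 1 by (intro mult_mono) auto
    also have "\<dots> = C2 * exp (- \<mu> * (p - \<tau>)) * (norm (normal_vec f xb p \<alpha>))\<^sup>2"
      by (simp add: C2_def distrib_right exp_add)
    finally show ?thesis using 2 by linarith
  qed
  \<comment> \<open>Taking square roots halves the decay rate.\<close>
  show ?thesis
  proof (rule that[of "\<mu> / 2" "sqrt C2"])
    show "\<mu> / 2 > 0" "sqrt C2 > 0" using \<mu> C2 by auto
    fix p \<alpha> \<tau> assume p: "p \<le> P" "\<alpha> \<in> {0..1::real}" "\<tau> \<le> p"
    have "exp (of_nat 2 * (- (\<mu> / 2) * (p - \<tau>))) = (exp (- (\<mu> / 2) * (p - \<tau>)))\<^sup>2"
      by (rule exp_of_nat_mult)
    then have e2: "(exp (- (\<mu> / 2) * (p - \<tau>)))\<^sup>2 = exp (- \<mu> * (p - \<tau>))" by simp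
    have eq: "C2 * exp (- \<mu> * (p - \<tau>)) * (norm (normal_vec f xb p \<alpha>))\<^sup>2 =
        (sqrt C2 * exp (- (\<mu> / 2) * (p - \<tau>)) * norm (normal_vec f xb p \<alpha>))\<^sup>2"
      unfolding power_mult_distrib e2 using C2 by simp
    show "norm (adjoint_normal p \<alpha> \<tau>) \<le> sqrt C2 * exp (- (\<mu> / 2) * (p - \<tau>)) * norm (normal_vec f xb p \<alpha>)"
    proof (rule power2_le_imp_le[OF ord_le_eq_trans[OF sq[OF p] eq]])
      show "0 \<le> sqrt C2 * exp (- (\<mu> / 2) * (p - \<tau>)) * norm (normal_vec f xb p \<alpha>)"
        using C2 by (intro mult_nonneg_nonneg) auto
    qed
  qed
qed

end

section \<open>Shadowing\<close>

lemma has_integral_translate: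
  fixes h :: "real \<Rightarrow> 'a::banach"
  assumes "(h has_integral I) {u + d..v + d}"
  shows "((\<lambda>\<tau>. h (\<tau> + d)) has_integral I) {u..v}"
proof -
  have "((\<lambda>\<tau>. h (1 *\<^sub>R \<tau> + d)) has_integral (1 / (\<bar>1\<bar> ^ DIM(real))) *\<^sub>R I) ((\<lambda>x. (1 / 1) *\<^sub>R x + - ((1 / 1) *\<^sub>R d)) ` cbox (u + d) (v + d))"
    by (rule has_integral_affinity) (use assms in auto)
  then show ?thesis by (simp add: image_diff_atLeastAtMost)
qed

lemma C1_on_cball_lipschitz:
  assumes "open S" "C1_on S h" "\<And>z. z \<in> S \<Longrightarrow> onorm (frechet_derivative h (at z)) \<le> B"
    and "cball x \<eta> \<subseteq> S" "y \<in> cball x \<eta>"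
  shows "norm (h y - h x) \<le> B * norm (y - x)"
proof -
  obtain D where D: "\<forall>x\<in>S. (h has_derivative blinfun_apply (D x)) (at x)"
    "\<forall>x\<in>S. frechet_derivative h (at x) = blinfun_apply (D x)" "continuous_on S D"
    using C1_on_openE[OF assms(1,2)] .
  show ?thesis
  proof (rule differentiable_bound[where f'="\<lambda>x. frechet_derivative h (at x)"])
    show "(h has_derivative frechet_derivative h (at z)) (at z within cball x \<eta>)" if "z \<in> cball x \<eta>" for z
      using D that assms(4) by (metis has_derivative_at_withinI subsetD)
    show "onorm (frechet_derivative h (at z)) \<le> B" if "z \<in> cball x \<eta>" for z
      using assms(3,4) that by blast
    show "x \<in> cball x \<eta>" using assms(5) order_trans[OF zero_le_dist[of x y]] by auto
  qed (use assms(5) in auto)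
qed

context local_saddle
begin

text \<open>The noncompact end of the parameter domain is mapped into a small ball around
  \<open>a\<close>, and the rest is the image of a compact rectangle. This supplies uniform radii
  and uniform Taylor constants along the sheet.\<close>

lemma sheet_in_compact:
  obtains S where "compact S" "S \<subseteq> \<Omega>" "\<And>p \<alpha>. p \<le> P \<Longrightarrow> \<alpha> \<in> {0..1} \<Longrightarrow> xb p \<alpha> \<in> S"
proof -
  obtain p0 where p0: "p0 < P" "\<And>p \<alpha>. p \<le> p0 \<Longrightarrow> \<alpha> \<in> {0..1} \<Longrightarrow> xb p \<alpha> \<in> ball a (R / 2)"
    by (rule uniformly_near_fixed_point[of "R / 2"]) (use R in simp, rule that)
  define S where "S = cball a (R / 2) \<union> (\<lambda>(p, \<alpha>). xb p \<alpha>) ` ({p0..P} \<times> {0..1})"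
  show ?thesis
  proof (rule that[of S])
    have "compact ((\<lambda>(p, \<alpha>). xb p \<alpha>) ` ({p0..P} \<times> {0..1}))"
      by (intro compact_continuous_image compact_Times continuous_on_subset[OF continuous_xb]) auto
    then show "compact S" unfolding S_def by (intro compact_Un) auto
    have "cball a (R / 2) \<subseteq> ball a R" using R by auto
    then show "S \<subseteq> \<Omega>" using R xb_in unfolding S_def by auto
    show "xb p \<alpha> \<in> S" if "p \<le> P" "\<alpha> \<in> {0..1}" for p \<alpha>
      using p0(2)[of p \<alpha>] that unfolding S_def by (cases "p \<le> p0") (auto simp: less_imp_le)
  qed
qed

text \<open>Backward in time \<open>Y\<close> could leave the sheet only along the stable direction of \<open>a\<close>; staying
  within \<open>O(\<epsilon>)\<close> of the sheet rules this out, so \<open>Y\<close> shadows the trajectory with label \<open>\<alpha>\<close>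
  for all negative times.\<close>

lemma shadowing:
  assumes B: "\<And>x. x \<in> \<Omega> \<Longrightarrow> onorm (frechet_derivative f (at x)) \<le> B" "B > 0"
    and nonneg: "Bg \<ge> 0" "CG \<ge> 0" "Cx \<ge> 0"
  obtains C \<epsilon>0 where "C > 0" "\<epsilon>0 > 0"
    "\<forall>\<epsilon> p \<alpha> Y G. 0 < \<epsilon> \<and> \<epsilon> < \<epsilon>0 \<and> p \<le> P \<and> \<alpha> \<in> {0..1} \<and>
      (\<forall>u v. u \<le> v \<and> v \<le> p \<longrightarrow> ((\<lambda>\<tau>. f (Y \<tau>) + \<epsilon> *\<^sub>R G \<tau>) has_integral Y v - Y u) {u..v}) \<and>
      (\<forall>\<tau>\<le>p. norm (G \<tau>) \<le> Bg \<and> infdist (Y \<tau>) (param_set a xb {..P}) \<le> CG * \<epsilon>) \<and>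
      norm (Y p - xb p \<alpha>) \<le> Cx * \<epsilon> \<longrightarrow> (\<forall>\<tau>\<le>p. norm (Y \<tau> - xb \<tau> \<alpha>) \<le> C * \<epsilon>)"
proof -
  obtain p0 where p0: "p0 < P" "\<And>p \<alpha>. p \<le> p0 \<Longrightarrow> \<alpha> \<in> {0..1} \<Longrightarrow> xb p \<alpha> \<in> ball a (R / 4)"
    by (rule uniformly_near_fixed_point[of "R / 4"]) (use R in simp, rule that)
  obtain S where S: "compact S" "S \<subseteq> \<Omega>" "\<And>p \<alpha>. p \<le> P \<Longrightarrow> \<alpha> \<in> {0..1} \<Longrightarrow> xb p \<alpha> \<in> S"
    by (rule sheet_in_compact) (rule that)
  obtain \<eta>1 where \<eta>1: "\<eta>1 > 0" "(\<Union>x\<in>S. cball x \<eta>1) \<subseteq> \<Omega>"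
    using compact_subset_open_imp_cball_epsilon_subset[OF S(1) open_\<Omega> S(2)] .
  \<comment> \<open>A distance budget: with \<open>xb\<close> within \<open>R / 4\<close> of
    \<open>a\<close>, the point \<open>Y\<close> is within \<open>R / 2\<close>, and a sheet point
    chosen within \<open>R / 8\<close> of \<open>Y\<close> is still in
    \<open>ball a R\<close>.\<close>
  define \<eta> where "\<eta> = min \<eta>1 (R / 8)"
  have \<eta>: "\<eta> > 0" "\<eta> \<le> R / 8" using \<eta>1 R by (auto simp: \<eta>_def)
  have tube: "cball x \<eta> \<subseteq> \<Omega>" if "x \<in> S" for x
  proof -
    have "cball x \<eta> \<subseteq> cball x \<eta>1" by (auto simp: \<eta>_def)
    then show ?thesis using \<eta>1(2) that by blast
  qed
  define L where "L = P - p0"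
  \<comment> \<open>\<open>C4\<close> is the Gronwall bound down to the neighbourhood of
    \<open>a\<close>; \<open>C5\<close> is the output of \<open>backward_stability\<close> started
    there, with forcing \<open>Bg * \<epsilon>\<close> and cone defect
    \<open>3 * K * ((CG + 1) * \<epsilon>)\<close>.\<close>
  define C4 where "C4 = 2 * exp (2 * B * L) * (Cx + Bg * L)"
  define C5 where "C5 = 8 * c * K * (C4 + Bg / \<mu>) + 2 * c * (3 * K * (CG + 1))"
  define C where "C = C4 + C5 + Cx + 1"
  have L: "L > 0" using p0 by (simp add: L_def)
  have Cpos: "C4 \<ge> 0" "C5 \<ge> 0"
    using L nonneg c K \<mu> B by (auto simp: C4_def C5_def)
  then have C: "C > 0" "C4 \<le> C" "C5 \<le> C" "Cx \<le> C" using nonneg by (auto simp: C_def)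
  \<comment> \<open>The first bound gives \<open>C * \<epsilon> < \<eta>\<close>, the gap needed by
    the bootstrap; the second keeps the chosen sheet point within \<open>R / 8\<close> of
    \<open>Y\<close>.\<close>
  define \<epsilon>0 where "\<epsilon>0 = min (\<eta> / C) (R / 8 / (CG + 1))"
  have \<epsilon>0: "\<epsilon>0 > 0" using \<eta> C R nonneg by (simp add: \<epsilon>0_def)
  have main: "norm (Y \<tau> - xb \<tau> \<alpha>) \<le> C * \<epsilon>"
    if \<epsilon>: "0 < \<epsilon>" "\<epsilon> < \<epsilon>0" and p: "p \<le> P" "\<alpha> \<in> {0..1}"
      and Y: "\<And>u v. u \<le> v \<Longrightarrow> v \<le> p \<Longrightarrow> ((\<lambda>\<tau>. f (Y \<tau>) + \<epsilon> *\<^sub>R G \<tau>) has_integral Y v - Y u) {u..v}"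
      and G: "\<And>\<tau>. \<tau> \<le> p \<Longrightarrow> norm (G \<tau>) \<le> Bg"
      and dist: "\<And>\<tau>. \<tau> \<le> p \<Longrightarrow> infdist (Y \<tau>) (param_set a xb {..P}) \<le> CG * \<epsilon>"
      and start: "norm (Y p - xb p \<alpha>) \<le> Cx * \<epsilon>" and \<tau>: "\<tau> \<le> p" for \<epsilon> p \<alpha> Y G \<tau>
  proof -
    define \<delta> where "\<delta> \<tau> = Y \<tau> - xb \<tau> \<alpha>" for \<tau>
    define h where "h \<tau> = f (Y \<tau>) + \<epsilon> *\<^sub>R G \<tau> - f (xb \<tau> \<alpha>)" for \<tau>
    have "\<epsilon> < \<eta> / C" "\<epsilon> < R / 8 / (CG + 1)" using \<epsilon> by (auto simp: \<epsilon>0_def)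
    then have small: "C * \<epsilon> < \<eta>" "(CG + 1) * \<epsilon> < R / 8"
      using C nonneg by (auto simp: field_simps)
    have hint: "(h has_integral \<delta> v - \<delta> u) {u..v}" if "u \<le> v" "v \<le> p" for u v
    proof -
      have "(h has_integral (Y v - Y u) - (xb v \<alpha> - xb u \<alpha>)) {u..v}"
        unfolding h_def using that p by (intro has_integral_diff Y xb_integral) auto
      then show ?thesis by (simp add: \<delta>_def algebra_simps)
    qed
    have "continuous_on {..p} \<delta>"
    proof -
      have "continuous_on {u..p} \<delta>" for u
        by (rule integral_curve_continuous[where h=h]) (rule hint)
      then have "continuous (at x within {..p}) \<delta>" if "x \<le> p" for x
      proof -
        have "continuous (at x within {x - 1..p}) \<delta>"
          using \<open>\<And>u. continuous_on {u..p} \<delta>\<close>[of "x - 1"] that by (auto simp: continuous_on_eq_continuous_within)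
        moreover have "at x within {x - 1..p} = at x within {..p}"
          by (rule at_within_nhd[of _ "{x - 1<..}"]) auto
        ultimately show ?thesis by simp
      qed
      then show ?thesis by (simp add: continuous_on_eq_continuous_within)
    qed
    then have "norm (\<delta> \<tau>) \<le> C * \<epsilon>"
    proof (rule backward_bootstrap[OF _ _ small(1) _ \<tau>])
      show "norm (\<delta> p) \<le> C * \<epsilon>"
        unfolding \<delta>_def using order_trans[OF start mult_right_mono[OF C(4)]] \<epsilon> by simp
      fix s assume s: "s \<le> p" and close: "\<And>\<sigma>. s \<le> \<sigma> \<Longrightarrow> \<sigma> \<le> p \<Longrightarrow> norm (\<delta> \<sigma>) \<le> \<eta>"
      have fY: "norm (f (Y \<sigma>) - f (xb \<sigma> \<alpha>)) \<le> B * norm (\<delta> \<sigma>)" if "s \<le> \<sigma>" "\<sigma> \<le> p" for \<sigma>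
        unfolding \<delta>_def
        using close[OF that] p that
        by (intro C1_on_cball_lipschitz[OF open_\<Omega> C1_f B(1) tube] S(3))
           (auto simp: \<delta>_def dist_norm norm_minus_commute)
      have eG: "norm (\<epsilon> *\<^sub>R G \<sigma>) \<le> Bg * \<epsilon>" if "\<sigma> \<le> p" for \<sigma>
        using G[OF that] \<epsilon> by (simp add: mult.commute mult_left_mono)
      \<comment> \<open>Gronwall is used on \<open>{s1..p}\<close>, of length at most
        \<open>L\<close>, and the saddle estimate on \<open>{s..s1}\<close>, which is nondegenerate
        only if \<open>s1 \<le> p0\<close>.\<close>
      define s1 where "s1 = max s (min p p0)"
      have s1: "s \<le> s1" "s1 \<le> p" using s by (auto simp: s1_def)
      have near1: "norm (\<delta> s1) \<le> C4 * \<epsilon>"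
      proof -
        have "norm (\<delta> s1) \<le> 2 * exp (2 * B * L) * (norm (\<delta> p) + Bg * \<epsilon> * L)"
        proof (rule backward_gronwall[OF s1(2) _ B(2)])
          show "p - s1 \<le> L" using p p0 by (auto simp: s1_def L_def)
          show "0 \<le> Bg * \<epsilon>" using nonneg \<epsilon> by simp
          show "(h has_integral \<delta> v - \<delta> u) {u..v}" if "s1 \<le> u" "u \<le> v" "v \<le> p" for u v
            using hint that by blast
          show "norm (h \<sigma>) \<le> B * norm (\<delta> \<sigma>) + Bg * \<epsilon>" if "\<sigma> \<in> {s1..p}" for \<sigma>
          proof -
            have \<sigma>: "s \<le> \<sigma>" "\<sigma> \<le> p" using that s1 by auto
            have "h \<sigma> = (f (Y \<sigma>) - f (xb \<sigma> \<alpha>)) + \<epsilon> *\<^sub>R G \<sigma>" by (simp add: h_def)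
            then show ?thesis using norm_triangle_mono[OF fY[OF \<sigma>] eG[OF \<sigma>(2)]] by simp
          qed
        qed
        also have "\<dots> \<le> 2 * exp (2 * B * L) * (Cx * \<epsilon> + Bg * \<epsilon> * L)"
          using start by (intro mult_left_mono add_right_mono) (auto simp: \<delta>_def)
        also have "\<dots> = C4 * \<epsilon>" by (simp add: C4_def algebra_simps)
        finally show ?thesis .
      qed
      show "norm (\<delta> s) \<le> C * \<epsilon>"
      proof (cases "s = s1")
        case True
        then show ?thesis using order_trans[OF near1 mult_right_mono[OF C(2)]] \<epsilon> by simp
      next
        case False
        then have s1p0: "s1 \<le> p0" by (auto simp: s1_def split: if_splits)
        have "norm (\<delta> s) \<le> 8 * c * K * (norm (\<delta> s1) + Bg * \<epsilon> / \<mu>) + 2 * c * (3 * K * ((CG + 1) * \<epsilon>))"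
        proof (rule backward_stability[where \<eta>="\<mu> / (8 * c * K)" and h=h])
          show "s \<le> s1" by fact
          show "(h has_integral \<delta> v - \<delta> u) {u..v}" if "s \<le> u" "u \<le> v" "v \<le> s1" for u v
            using hint that s1 by auto
          fix \<sigma> assume \<sigma>: "\<sigma> \<in> {s..s1}"
          have xbb: "xb \<sigma> \<alpha> \<in> ball a (R / 4)" using p0(2)[of \<sigma> \<alpha>] \<sigma> s1p0 p by auto
          have dY: "norm (\<delta> \<sigma>) \<le> R / 8" using close[of \<sigma>] \<sigma> s1 \<eta> by auto
          have xn: "norm (xb \<sigma> \<alpha> - a) < R / 4" using xbb by (simp add: dist_norm norm_minus_commute)
          have Yn: "norm (Y \<sigma> - a) < R / 2"
            using norm_triangle_ineq[of "\<delta> \<sigma>" "xb \<sigma> \<alpha> - a"] dY xn R by (simp add: \<delta>_def)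
          have Yb: "Y \<sigma> \<in> ball a R" using Yn R by (simp add: dist_norm norm_minus_commute)
          have xb': "xb \<sigma> \<alpha> \<in> ball a R" using xn R by (simp add: dist_norm norm_minus_commute)
          have eq: "h \<sigma> - jac f a *v \<delta> \<sigma> = (f (Y \<sigma>) - f (xb \<sigma> \<alpha>) - jac f a *v \<delta> \<sigma>) + \<epsilon> *\<^sub>R G \<sigma>"
            by (simp add: h_def)
          show "norm (h \<sigma> - jac f a *v \<delta> \<sigma>) \<le> \<mu> / (8 * c * K) * norm (\<delta> \<sigma>) + Bg * \<epsilon>"
            unfolding eq using near_linear[OF Yb xb'] eG[of \<sigma>] \<sigma> s1
            by (intro norm_triangle_mono) (auto simp: \<delta>_def)
          have ne: "param_set a xb {..P} \<noteq> {}" by (simp add: param_set_def)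
          \<comment> \<open>The infimum need not be attained; the slack \<open>\<epsilon>\<close>
            provides an actual sheet point \<open>z\<close>.\<close>
          have "infdist (Y \<sigma>) (param_set a xb {..P}) < (CG + 1) * \<epsilon>"
            using dist[of \<sigma>] \<sigma> s1 \<epsilon> by (simp add: distrib_right)
          then have "(INF z\<in>param_set a xb {..P}. dist (Y \<sigma>) z) < (CG + 1) * \<epsilon>"
            by (simp add: infdist_notempty[OF ne])
          then obtain z where z: "z \<in> param_set a xb {..P}" "norm (Y \<sigma> - z) < (CG + 1) * \<epsilon>"
            using cINF_less_iff[OF ne bdd_below_image_dist] by (auto simp: dist_norm)
          have "norm (z - a) < R"
            using norm_triangle_ineq[of "z - Y \<sigma>" "Y \<sigma> - a"] z(2) small(2) Yn R(1)
            by (simp add: norm_minus_commute)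
          then have zb: "z \<in> ball a R" by (simp add: dist_norm norm_minus_commute)
          have xp: "xb \<sigma> \<alpha> \<in> param_set a xb {..P}"
            using \<sigma> s1 p by (auto simp: param_set_def)
          have cn: "norm (zs (z - xb \<sigma> \<alpha>)) \<le> norm (z1 (z - xb \<sigma> \<alpha>)) + norm (z2 (z - xb \<sigma> \<alpha>))"
            using cone z(1) zb xp xb' by blast
          \<comment> \<open>The second summand is a secant of the sheet and satisfies the cone
            condition exactly; the first costs \<open>K * ((CG + 1) * \<epsilon>)\<close> in each of
            the three coordinates.\<close>
          have dec: "\<delta> \<sigma> = (Y \<sigma> - z) + (z - xb \<sigma> \<alpha>)" by (simp add: \<delta>_def)
          have Kd: "norm (Z (Y \<sigma> - z)) \<le> K * ((CG + 1) * \<epsilon>)" if "\<And>v. norm (Z v) \<le> K * norm v" for Z :: "real^3 \<Rightarrow> complex"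
            using order_trans[OF that mult_left_mono[OF less_imp_le[OF z(2)]]] K(1) by simp
          have add: "Z (\<delta> \<sigma>) = Z (Y \<sigma> - z) + Z (z - xb \<sigma> \<alpha>)" if "bounded_linear Z" for Z :: "real^3 \<Rightarrow> complex"
            unfolding dec by (rule linear_add[OF bounded_linear.linear[OF that]])
          have "norm (zs (\<delta> \<sigma>)) \<le> K * ((CG + 1) * \<epsilon>) + norm (zs (z - xb \<sigma> \<alpha>))"
            unfolding add[OF zs] using norm_triangle_ineq[of "zs (Y \<sigma> - z)" "zs (z - xb \<sigma> \<alpha>)"] Kd[OF K(2)] by linarith
          moreover have "norm (z1 (z - xb \<sigma> \<alpha>)) \<le> norm (z1 (\<delta> \<sigma>)) + K * ((CG + 1) * \<epsilon>)"
            unfolding add[OF z1] using norm_diff_ineq[of "z1 (z - xb \<sigma> \<alpha>)" "z1 (Y \<sigma> - z)"] Kd[OF K(3)]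
            by (simp add: add.commute)
          moreover have "norm (z2 (z - xb \<sigma> \<alpha>)) \<le> norm (z2 (\<delta> \<sigma>)) + K * ((CG + 1) * \<epsilon>)"
            unfolding add[OF z2] using norm_diff_ineq[of "z2 (z - xb \<sigma> \<alpha>)" "z2 (Y \<sigma> - z)"] Kd[OF K(4)]
            by (simp add: add.commute)
          ultimately show "norm (zs (\<delta> \<sigma>)) \<le> norm (z1 (\<delta> \<sigma>)) + norm (z2 (\<delta> \<sigma>)) + 3 * K * ((CG + 1) * \<epsilon>)"
            using cn by linarith
        qed (use \<mu> c K nonneg \<epsilon> in auto)
        also have "\<dots> \<le> 8 * c * K * (C4 * \<epsilon> + Bg * \<epsilon> / \<mu>) + 2 * c * (3 * K * ((CG + 1) * \<epsilon>))"
          using near1 c(1) K(1) by (intro add_right_mono mult_left_mono) auto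
        also have "\<dots> = C5 * \<epsilon>" by (simp add: C5_def algebra_simps)
        also have "\<dots> \<le> C * \<epsilon>" using mult_right_mono[OF C(3), of \<epsilon>] \<epsilon> by simp
        finally show ?thesis .
      qed
    qed
    then show ?thesis by (simp add: \<delta>_def)
  qed
  show ?thesis
  proof (rule that[OF C(1) \<epsilon>0], intro allI impI, elim conjE)
    fix \<epsilon> p \<alpha> \<tau> and Y G :: "real \<Rightarrow> real^3"
    assume *: "0 < \<epsilon>" "\<epsilon> < \<epsilon>0" "p \<le> P" "\<alpha> \<in> {0..1}"
      and Y: "\<forall>u v. u \<le> v \<and> v \<le> p \<longrightarrow> ((\<lambda>\<tau>. f (Y \<tau>) + \<epsilon> *\<^sub>R G \<tau>) has_integral Y v - Y u) {u..v}"
      and G: "\<forall>\<tau>\<le>p. norm (G \<tau>) \<le> Bg \<and> infdist (Y \<tau>) (param_set a xb {..P}) \<le> CG * \<epsilon>"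
      and start: "norm (Y p - xb p \<alpha>) \<le> Cx * \<epsilon>" "\<tau> \<le> p"
    show "norm (Y \<tau> - xb \<tau> \<alpha>) \<le> C * \<epsilon>"
      by (rule main[where \<epsilon>=\<epsilon> and G=G and Y=Y and p=p and \<alpha>=\<alpha> and \<tau>=\<tau>, OF * _ _ _ start]) (use Y G in auto)
  qed
qed

end

section \<open>The Melnikov expansion\<close>

context local_saddle
begin

text \<open>The decay of the adjoint solution against a bounded \<open>g\<close> dominates the
  integrand by an exponential, so measurability suffices for convergence. The second part allows
  truncation to \<open>{s..p}\<close>, where the product rule is available.\<close>

lemma melnikov_integrand_bound:
  assumes g: "\<And>x. x \<in> \<Omega> \<Longrightarrow> g x \<in> borel_measurable lebesgue"
    and cont: "\<And>t. continuous_on \<Omega> (\<lambda>x. g x t)"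
    and Bg: "\<And>x t. x \<in> \<Omega> \<Longrightarrow> norm (g x t) \<le> Bg"
    and decay: "\<kappa> > 0" "\<And>\<tau>. \<tau> \<le> p \<Longrightarrow> norm (adjoint_normal p \<alpha> \<tau>) \<le> D * exp (- \<kappa> * (p - \<tau>))"
    and p: "p \<le> P"
  shows "melnikov_integrand f g xb p \<alpha> t integrable_on {..p}"
    and "s \<le> p \<Longrightarrow> norm (melnikov f g xb p \<alpha> t - integral {s..p} (melnikov_integrand f g xb p \<alpha> t))
      \<le> D * Bg * (exp (- \<kappa> * (p - s)) / \<kappa>)"
proof -
  define m where "m = melnikov_integrand f g xb p \<alpha> t"
  have m: "m \<tau> = adjoint_normal p \<alpha> \<tau> \<bullet> g (xb \<tau> \<alpha>) (\<tau> + (t - p))" for \<tau>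
    by (simp add: m_def melnikov_integrand_def adjoint_normal_def add_diff_eq)
  have D0: "D \<ge> 0" using order_trans[OF norm_ge_zero decay(2)[of p]] by simp
  have le: "norm (m \<tau>) \<le> D * Bg * exp (- \<kappa> * (p - \<tau>))" if "\<tau> \<le> p" for \<tau>
  proof -
    have "norm (m \<tau>) \<le> norm (adjoint_normal p \<alpha> \<tau>) * norm (g (xb \<tau> \<alpha>) (\<tau> + (t - p)))"
      unfolding m real_norm_def by (rule Cauchy_Schwarz_ineq2)
    also have "\<dots> \<le> D * exp (- \<kappa> * (p - \<tau>)) * Bg"
      using decay(2)[OF that] Bg[OF xb_in, of \<tau> \<alpha>] that p D0 by (intro mult_mono) auto
    finally show ?thesis by (simp add: ac_simps)
  qed
  have cxb: "continuous_on {..p} (\<lambda>\<tau>. xb \<tau> \<alpha>)"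
  proof -
    have "continuous_on {..p} (\<lambda>p. (p, \<alpha>))" "(\<lambda>p. (p, \<alpha>)) ` {..p} \<subseteq> {..P} \<times> UNIV"
      using p by (auto intro!: continuous_intros)
    from continuous_on_compose2[OF continuous_xb this] show ?thesis by simp
  qed
  have cw: "adjoint_normal p \<alpha> \<in> borel_measurable (lebesgue_on {..p})"
  proof (rule continuous_imp_measurable_on_sets_lebesgue)
    have "continuous (at x within {..p}) (adjoint_normal p \<alpha>)" if "x \<le> p" for x
    proof -
      have "continuous (at x within {x - 1..p}) (adjoint_normal p \<alpha>)"
        using has_vector_derivative_continuous[OF adjoint_normal_deriv[of "x - 1" x p]] that p by simp
      moreover have "at x within {x - 1..p} = at x within {..p}"
        by (rule at_within_nhd[of _ "{x - 1<..}"]) auto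
      ultimately show ?thesis by simp
    qed
    then show "continuous_on {..p} (adjoint_normal p \<alpha>)" by (simp add: continuous_on_eq_continuous_within)
  qed simp
  have "(\<lambda>\<tau>. g (xb \<tau> \<alpha>) (\<tau> + (t - p))) \<in> borel_measurable (lebesgue_on {..p})"
    by (rule caratheodory_measurable[OF g cont cxb]) (use xb_in p in auto)
  then have meas: "m \<in> borel_measurable (lebesgue_on {..p})"
    unfolding m[abs_def] by (intro borel_measurable_inner cw)
  have E: "((\<lambda>\<tau>. D * Bg * exp (- \<kappa> * (p - \<tau>))) has_integral D * Bg * (exp (- \<kappa> * (p - s)) / \<kappa>)) {..s}" for s
    by (intro has_integral_mult_right has_integral_exp_to_minus_infinity decay(1))
  have int: "m integrable_on {..p}"
    by (rule measurable_bounded_by_integrable_imp_integrable[OF meas]) (use E le in auto)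
  then show "melnikov_integrand f g xb p \<alpha> t integrable_on {..p}" by (simp add: m_def)
  show "norm (melnikov f g xb p \<alpha> t - integral {s..p} (melnikov_integrand f g xb p \<alpha> t))
      \<le> D * Bg * (exp (- \<kappa> * (p - s)) / \<kappa>)" if s: "s \<le> p"
  proof -
    have i1: "m integrable_on {..s}"
    proof (rule measurable_bounded_by_integrable_imp_integrable)
      show "m \<in> borel_measurable (lebesgue_on {..s})"
        using measurable_restrict_mono[OF meas] s by simp
    qed (use E le s in auto)
    have i2: "m integrable_on {s..p}"
      using integrable_on_subinterval[OF int] by simp
    have "(m has_integral integral {..s} m + integral {s..p} m) ({..s} \<union> {s..p})"
      by (rule has_integral_Un[OF integrable_integral[OF i1] integrable_integral[OF i2]])
         (rule negligible_subset[of "{s}"], use s in auto)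
    moreover have "{..s} \<union> {s..p} = {..p}" using s by auto
    ultimately have "melnikov f g xb p \<alpha> t - integral {s..p} m = integral {..s} m"
      by (simp add: melnikov_def m_def[symmetric] integral_unique)
    also have "norm \<dots> \<le> integral {..s} (\<lambda>\<tau>. D * Bg * exp (- \<kappa> * (p - \<tau>)))"
      using le s E by (intro integral_norm_bound_integral i1) auto
    also have "\<dots> = D * Bg * (exp (- \<kappa> * (p - s)) / \<kappa>)" using E by (rule integral_unique)
    finally show ?thesis by (simp add: m_def)
  qed
qed

text \<open>Pairing the deviation \<open>Y - xb\<close> with the adjoint solution \<open>adjoint_normal\<close> cancels the
  linear part of its evolution; what remains is the Melnikov integrand and a quadratic error.\<close>

lemma normal_deviation_estimate:
  assumes f_quad: "\<And>\<tau>. \<tau> \<le> p \<Longrightarrow> norm (f (Y \<tau>) - f (xb \<tau> \<alpha>) - jac f (xb \<tau> \<alpha>) *v (Y \<tau> - xb \<tau> \<alpha>)) \<le> M * \<epsilon>\<^sup>2"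
    and g_lip: "\<And>\<tau>. \<tau> \<le> p \<Longrightarrow> norm (g (Y \<tau>) (\<tau> + (t - p)) - g (xb \<tau> \<alpha>) (\<tau> + (t - p))) \<le> M' * \<epsilon>"
    and g: "\<And>x. x \<in> \<Omega> \<Longrightarrow> g x \<in> borel_measurable lebesgue"
    and cont: "\<And>t. continuous_on \<Omega> (\<lambda>x. g x t)"
    and Bg: "\<And>x t. x \<in> \<Omega> \<Longrightarrow> norm (g x t) \<le> Bg"
    and decay: "\<kappa> > 0" "\<And>\<tau>. \<tau> \<le> p \<Longrightarrow> norm (adjoint_normal p \<alpha> \<tau>) \<le> D * exp (- \<kappa> * (p - \<tau>))"
    and p: "p \<le> P" and \<epsilon>: "0 < \<epsilon>"
    and Y: "\<And>u v. u \<le> v \<Longrightarrow> v \<le> p \<Longrightarrow>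
      ((\<lambda>\<tau>. f (Y \<tau>) + \<epsilon> *\<^sub>R g (Y \<tau>) (\<tau> + (t - p))) has_integral Y v - Y u) {u..v}"
    and YO: "\<And>\<tau>. \<tau> \<le> p \<Longrightarrow> Y \<tau> \<in> \<Omega>"
    and close: "\<And>\<tau>. \<tau> \<le> p \<Longrightarrow> norm (Y \<tau> - xb \<tau> \<alpha>) \<le> C * \<epsilon>"
  shows "\<bar>normal_vec f xb p \<alpha> \<bullet> (Y p - xb p \<alpha>) - \<epsilon> * melnikov f g xb p \<alpha> t\<bar> \<le> D * (M + M') * \<epsilon>\<^sup>2 / \<kappa>"
proof -
  define w where "w = adjoint_normal p \<alpha>"
  define m where "m = melnikov_integrand f g xb p \<alpha> t"
  define \<delta> where "\<delta> \<tau> = Y \<tau> - xb \<tau> \<alpha>" for \<tau>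
  define h where "h \<tau> = f (Y \<tau>) + \<epsilon> *\<^sub>R g (Y \<tau>) (\<tau> + (t - p)) - f (xb \<tau> \<alpha>)" for \<tau>
  have m: "m \<tau> = w \<tau> \<bullet> g (xb \<tau> \<alpha>) (\<tau> + (t - p))" for \<tau>
    by (simp add: m_def w_def melnikov_integrand_def adjoint_normal_def add_diff_eq)
  have D0: "D \<ge> 0" using order_trans[OF norm_ge_zero decay(2)[of p]] by simp
  have mint: "m integrable_on {..p}"
    unfolding m_def by (rule melnikov_integrand_bound(1)[OF g cont Bg decay p])
  have mtail: "norm (melnikov f g xb p \<alpha> t - integral {s..p} m) \<le> D * Bg * (exp (- \<kappa> * (p - s)) / \<kappa>)"
    if "s \<le> p" for s
    unfolding m_def by (rule melnikov_integrand_bound(2)[OF g cont Bg decay p that])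
  have hint: "(h has_integral \<delta> v - \<delta> u) {u..v}" if "u \<le> v" "v \<le> p" for u v
  proof -
    have "(h has_integral (Y v - Y u) - (xb v \<alpha> - xb u \<alpha>)) {u..v}"
      unfolding h_def using that p by (intro has_integral_diff Y xb_integral) auto
    then show ?thesis by (simp add: \<delta>_def algebra_simps)
  qed
  \<comment> \<open>All dependence on the cut-off \<open>s\<close> is collected in a multiple of
    \<open>exp (- \<kappa> * (p - s))\<close>, which disappears when \<open>s\<close> tends to minus
    infinity.\<close>
  have est: "\<bar>w p \<bullet> \<delta> p - \<epsilon> * melnikov f g xb p \<alpha> t\<bar>
      \<le> D * (M + M') * \<epsilon>\<^sup>2 / \<kappa> + (D * C * \<epsilon> + \<epsilon> * (D * Bg / \<kappa>)) * exp (- \<kappa> * (p - s))" if s: "s \<le> p" for s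
  proof -
    have cj: "continuous_on {s..p} (\<lambda>\<tau>. jac f (xb \<tau> \<alpha>))"
      by (rule continuous_on_along_xb[OF p continuous_on_jac[OF open_\<Omega> C1_f]])
    have wder: "(w has_vector_derivative - (w \<tau> v* jac f (xb \<tau> \<alpha>))) (at \<tau> within {s..p})" if "\<tau> \<in> {s..p}" for \<tau>
      unfolding w_def using that p by (intro adjoint_normal_deriv) auto
    have cw: "continuous_on {s..p} w"
      using has_vector_derivative_continuous[OF wder] by (simp add: continuous_on_eq_continuous_within)
    have cw': "continuous_on {s..p} (\<lambda>\<tau>. - (w \<tau> v* jac f (xb \<tau> \<alpha>)))"
      unfolding vector_matrix_mult_def by (intro continuous_intros cw cj)
    have c\<delta>: "continuous_on {s..p} \<delta>"
      by (rule integral_curve_continuous[where h=h]) (rule hint)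
    have "continuous_on {s..p} Y"
      using continuous_on_add[OF c\<delta> continuous_on_xb_slice(1)[OF p, of s \<alpha>]] by (simp add: \<delta>_def)
    then have "continuous_on {s..p} (\<lambda>\<tau>. f (Y \<tau>) - f (xb \<tau> \<alpha>))"
      by (intro continuous_on_diff continuous_on_along_xb[OF p] continuous_f continuous_on_compose2[OF continuous_f])
         (use YO in auto)
    then have "bounded ((\<lambda>\<tau>. f (Y \<tau>) - f (xb \<tau> \<alpha>)) ` {s..p})"
      by (intro compact_imp_bounded compact_continuous_image) auto
    then obtain M0 where M0: "\<And>\<tau>. \<tau> \<in> {s..p} \<Longrightarrow> norm (f (Y \<tau>) - f (xb \<tau> \<alpha>)) \<le> M0"
      unfolding bounded_iff by (metis imageI)
    have "((\<lambda>\<tau>. (- (w \<tau> v* jac f (xb \<tau> \<alpha>))) \<bullet> \<delta> \<tau> + w \<tau> \<bullet> h \<tau>) has_integral w p \<bullet> \<delta> p - w s \<bullet> \<delta> s) {s..p}"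
    proof (rule integral_product_rule[OF bounded_bilinear_inner s wder cw'])
      show "(h has_integral \<delta> v - \<delta> u) {u..v}" if "s \<le> u" "u \<le> v" "v \<le> p" for u v
        using hint that by blast
      show "norm (h \<tau>) \<le> M0 + \<epsilon> * Bg" if "\<tau> \<in> {s..p}" for \<tau>
      proof -
        have "h \<tau> = (f (Y \<tau>) - f (xb \<tau> \<alpha>)) + \<epsilon> *\<^sub>R g (Y \<tau>) (\<tau> + (t - p))" by (simp add: h_def)
        moreover have "norm (\<epsilon> *\<^sub>R g (Y \<tau>) (\<tau> + (t - p))) \<le> \<epsilon> * Bg"
          using Bg[OF YO] that \<epsilon> by simp
        ultimately show ?thesis using norm_triangle_mono[OF M0[OF that]] by simp
      qed
    qed
    then have "((\<lambda>\<tau>. (- (w \<tau> v* jac f (xb \<tau> \<alpha>))) \<bullet> \<delta> \<tau> + w \<tau> \<bullet> h \<tau> - \<epsilon> * m \<tau>) has_integral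
        w p \<bullet> \<delta> p - w s \<bullet> \<delta> s - \<epsilon> * integral {s..p} m) {s..p}"
      by (intro has_integral_diff has_integral_mult_right integrable_integral integrable_on_subinterval[OF mint]) auto
    \<comment> \<open>The transposed Jacobian acting on \<open>w\<close> becomes the linear part
      subtracted from the difference of \<open>f\<close>, and \<open>\<epsilon> * m \<tau>\<close>
      subtracts the forcing at the unperturbed point; both remaining brackets are small.\<close>
    moreover have "(- (w \<tau> v* jac f (xb \<tau> \<alpha>))) \<bullet> \<delta> \<tau> + w \<tau> \<bullet> h \<tau> - \<epsilon> * m \<tau> =
        w \<tau> \<bullet> ((f (Y \<tau>) - f (xb \<tau> \<alpha>) - jac f (xb \<tau> \<alpha>) *v \<delta> \<tau>)
          + \<epsilon> *\<^sub>R (g (Y \<tau>) (\<tau> + (t - p)) - g (xb \<tau> \<alpha>) (\<tau> + (t - p))))" for \<tau>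
      by (simp add: m h_def dot_lmul_matrix inner_add_right inner_diff_right right_diff_distrib)
    ultimately have I: "((\<lambda>\<tau>. w \<tau> \<bullet> ((f (Y \<tau>) - f (xb \<tau> \<alpha>) - jac f (xb \<tau> \<alpha>) *v \<delta> \<tau>)
          + \<epsilon> *\<^sub>R (g (Y \<tau>) (\<tau> + (t - p)) - g (xb \<tau> \<alpha>) (\<tau> + (t - p))))) has_integral
        w p \<bullet> \<delta> p - w s \<bullet> \<delta> s - \<epsilon> * integral {s..p} m) {s..p}"
      by simp
    define k where "k = D * (M + M') * \<epsilon>\<^sup>2"
    \<comment> \<open>The signs of \<open>M\<close> and \<open>M'\<close> are read off the norm
      estimates at \<open>\<tau> = p\<close>.\<close>
    have MM: "0 \<le> (M + M') * \<epsilon>\<^sup>2"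
    proof -
      have "0 \<le> M * \<epsilon>\<^sup>2" using order_trans[OF norm_ge_zero f_quad[of p]] by simp
      moreover have "0 \<le> M' * \<epsilon> * \<epsilon>" using order_trans[OF norm_ge_zero g_lip[of p]] \<epsilon> by simp
      ultimately show ?thesis by (simp add: power2_eq_square algebra_simps)
    qed
    have Ebig: "((\<lambda>\<tau>. k * exp (- \<kappa> * (p - \<tau>))) has_integral k * (exp (- \<kappa> * (p - p)) / \<kappa>)) {..p}"
      by (intro has_integral_mult_right has_integral_exp_to_minus_infinity decay(1))
    have Eint: "(\<lambda>\<tau>. k * exp (- \<kappa> * (p - \<tau>))) integrable_on {s..p}"
      by (intro integrable_continuous_real continuous_intros)
    have k0: "k \<ge> 0" unfolding k_def using D0 MM by (simp add: mult.assoc)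
    have "\<bar>w p \<bullet> \<delta> p - w s \<bullet> \<delta> s - \<epsilon> * integral {s..p} m\<bar> \<le> integral {s..p} (\<lambda>\<tau>. k * exp (- \<kappa> * (p - \<tau>)))"
      unfolding integral_unique[OF I, symmetric] real_norm_def[symmetric]
    proof (rule integral_norm_bound_integral[OF has_integral_integrable[OF I] Eint])
      fix \<tau> assume \<tau>: "\<tau> \<in> {s..p}"
      have "norm ((f (Y \<tau>) - f (xb \<tau> \<alpha>) - jac f (xb \<tau> \<alpha>) *v \<delta> \<tau>)
          + \<epsilon> *\<^sub>R (g (Y \<tau>) (\<tau> + (t - p)) - g (xb \<tau> \<alpha>) (\<tau> + (t - p)))) \<le> M * \<epsilon>\<^sup>2 + \<epsilon> * (M' * \<epsilon>)"
        using f_quad[of \<tau>] g_lip[of \<tau>] \<tau> \<epsilon> by (intro norm_triangle_mono) (auto simp: \<delta>_def)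
      also have "\<dots> = (M + M') * \<epsilon>\<^sup>2" by (simp add: power2_eq_square algebra_simps)
      finally show "norm (w \<tau> \<bullet> ((f (Y \<tau>) - f (xb \<tau> \<alpha>) - jac f (xb \<tau> \<alpha>) *v \<delta> \<tau>)
          + \<epsilon> *\<^sub>R (g (Y \<tau>) (\<tau> + (t - p)) - g (xb \<tau> \<alpha>) (\<tau> + (t - p))))) \<le> k * exp (- \<kappa> * (p - \<tau>))"
        using decay(2)[of \<tau>] \<tau> D0 MM unfolding w_def k_def real_norm_def
        by (intro order_trans[OF Cauchy_Schwarz_ineq2]) (subst mult.assoc, subst mult.assoc, subst (3) mult.commute,
          subst mult.assoc[symmetric], rule mult_mono, auto)
    qed
    also have "\<dots> \<le> integral {..p} (\<lambda>\<tau>. k * exp (- \<kappa> * (p - \<tau>)))"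
      using k0 Ebig by (intro integral_subset_le Eint) auto
    also have "\<dots> = k / \<kappa>" using integral_unique[OF Ebig] by simp
    finally have 1: "\<bar>w p \<bullet> \<delta> p - w s \<bullet> \<delta> s - \<epsilon> * integral {s..p} m\<bar> \<le> k / \<kappa>" .
    \<comment> \<open>Since \<open>\<delta>\<close> stays of size \<open>C * \<epsilon>\<close> on
      the whole half-line, the decay of \<open>w\<close> alone removes the boundary term.\<close>
    have 2: "\<bar>w s \<bullet> \<delta> s\<bar> \<le> (D * exp (- \<kappa> * (p - s))) * (C * \<epsilon>)"
      using decay(2)[OF s] close[OF s] D0
      by (intro order_trans[OF Cauchy_Schwarz_ineq2] mult_mono) (auto simp: w_def \<delta>_def)
    have 3: "\<bar>\<epsilon> * (melnikov f g xb p \<alpha> t - integral {s..p} m)\<bar> \<le> \<epsilon> * (D * Bg * (exp (- \<kappa> * (p - s)) / \<kappa>))"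
      using mult_left_mono[OF mtail[OF s], of \<epsilon>] \<epsilon> unfolding abs_mult real_norm_def by simp
    have "w p \<bullet> \<delta> p - \<epsilon> * melnikov f g xb p \<alpha> t = (w p \<bullet> \<delta> p - w s \<bullet> \<delta> s - \<epsilon> * integral {s..p} m)
        + w s \<bullet> \<delta> s - \<epsilon> * (melnikov f g xb p \<alpha> t - integral {s..p} m)"
      by (simp add: algebra_simps)
    then have "\<bar>w p \<bullet> \<delta> p - \<epsilon> * melnikov f g xb p \<alpha> t\<bar>
      \<le> k / \<kappa> + (D * exp (- \<kappa> * (p - s))) * (C * \<epsilon>) + \<epsilon> * (D * Bg * (exp (- \<kappa> * (p - s)) / \<kappa>))"
      using 1 2 3 by linarith
    also have "\<dots> = k / \<kappa> + (D * C * \<epsilon> + \<epsilon> * (D * Bg / \<kappa>)) * exp (- \<kappa> * (p - s))"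
      by (simp add: algebra_simps)
    finally show ?thesis by (simp add: k_def)
  qed
  have "((\<lambda>s. exp (- \<kappa> * (p - s))) \<longlongrightarrow> 0) at_bot"
    using decay(1) by real_asymp
  then have "((\<lambda>s. D * (M + M') * \<epsilon>\<^sup>2 / \<kappa> + (D * C * \<epsilon> + \<epsilon> * (D * Bg / \<kappa>)) * exp (- \<kappa> * (p - s)))
      \<longlongrightarrow> D * (M + M') * \<epsilon>\<^sup>2 / \<kappa> + (D * C * \<epsilon> + \<epsilon> * (D * Bg / \<kappa>)) * 0) at_bot"
    by (intro tendsto_intros)
  then have "\<bar>w p \<bullet> \<delta> p - \<epsilon> * melnikov f g xb p \<alpha> t\<bar>
      \<le> D * (M + M') * \<epsilon>\<^sup>2 / \<kappa> + (D * C * \<epsilon> + \<epsilon> * (D * Bg / \<kappa>)) * 0"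
    by (rule tendsto_lowerbound)
       (use est in \<open>auto intro: eventually_mono[OF eventually_le_at_bot[of p]]\<close>)
  then show ?thesis by (simp add: w_def \<delta>_def)
qed

end

section \<open>Uniform constants and the normalized displacement\<close>

theorem theorem1:
  fixes \<Omega> :: "(real^3) set"
    and f :: "real^3 \<Rightarrow> real^3"
    and g :: "real^3 \<Rightarrow> real \<Rightarrow> real^3"
    and a :: "real^3"
    and P T :: real
    and xb :: "real \<Rightarrow> real \<Rightarrow> real^3"
    and a_eps :: "real \<Rightarrow> real \<Rightarrow> real^3"
    and \<Gamma> :: "real \<Rightarrow> real \<Rightarrow> (real^3) set"
    and xu :: "real \<Rightarrow> real \<Rightarrow> real \<Rightarrow> real \<Rightarrow> real^3"
  defines "F \<equiv> \<lambda>\<epsilon> x t. f x + \<epsilon> *\<^sub>R g x t"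
  assumes "open \<Omega>"
    and "C2_on \<Omega> f"
    and "\<exists>B. \<forall>x\<in>\<Omega>. onorm (frechet_derivative f (at x)) \<le> B"
    and "\<forall>t. C2_on \<Omega> (\<lambda>x. g x t)"
    and "\<forall>x\<in>\<Omega>. g x \<in> borel_measurable lebesgue"
    and "\<exists>B. \<forall>x\<in>\<Omega>. \<forall>t. norm (g x t) \<le> B"
    and "\<exists>B. \<forall>x\<in>\<Omega>. \<forall>t. onorm (frechet_derivative (\<lambda>z. g z t) (at x)) \<le> B"
    and "a \<in> \<Omega>" and "f a = 0"
    and "saddle_with_unstable_plane (jac f a)"
    and "unstable_parametrization f \<Omega> a P xb"
    and "\<forall>\<^sub>F \<epsilon> in at_right 0. hyperbolic_trajectory_on (F \<epsilon>) \<Omega> {..T} (a_eps \<epsilon>)"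
    and "\<exists>C. \<forall>\<^sub>F \<epsilon> in at_right 0. \<forall>t\<le>T. norm (a_eps \<epsilon> t - a) \<le> C * \<epsilon>"
    and "\<forall>\<^sub>F \<epsilon> in at_right 0. unstable_manifold_part (F \<epsilon>) \<Omega> (a_eps \<epsilon>) T (\<Gamma> \<epsilon>)"
    and "\<exists>C. \<forall>\<^sub>F \<epsilon> in at_right 0. \<forall>t\<le>T. \<forall>x\<in>\<Gamma> \<epsilon> t. infdist x (param_set a xb {..P}) \<le> C * \<epsilon>"
    and "\<forall>\<^sub>F \<epsilon> in at_right 0. \<forall>p\<le>P. \<forall>\<alpha>\<in>{0..<1}. \<forall>t\<le>T. xu p \<alpha> \<epsilon> t \<in> \<Gamma> \<epsilon> t"
    and "\<exists>C. \<forall>\<^sub>F \<epsilon> in at_right 0. \<forall>p\<le>P. \<forall>\<alpha>\<in>{0..<1}. \<forall>t\<le>T.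
           norm (xu p \<alpha> \<epsilon> t - xb p \<alpha>) \<le> C * \<epsilon>"
  shows "(\<forall>p\<le>P. \<forall>\<alpha>\<in>{0..<1}. \<forall>t\<le>T. melnikov_integrand f g xb p \<alpha> t integrable_on {..p}) \<and>
    (\<exists>C. \<forall>\<^sub>F \<epsilon> in at_right 0. \<forall>p\<le>P. \<forall>\<alpha>\<in>{0..<1}. \<forall>t\<le>T.
       \<bar>normal_displacement f xb xu p \<alpha> \<epsilon> t -
          \<epsilon> * (melnikov f g xb p \<alpha> t / norm (normal_vec f xb p \<alpha>))\<bar> \<le> C * \<epsilon>\<^sup>2)"
proof -
  interpret unstable_sheet \<Omega> f a P xb
    by (rule unstable_sheet.intro) fact+
  obtain zs z1 z2 l1 l2 ls es \<mu> K c R where "local_saddle \<Omega> f a P xb zs z1 z2 l1 l2 ls es \<mu> K c R"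
    by (rule local_saddle_exists)
  then interpret local_saddle \<Omega> f a P xb zs z1 z2 l1 l2 ls es \<mu> K c R .
  obtain B0 where B0: "\<And>x. x \<in> \<Omega> \<Longrightarrow> onorm (frechet_derivative f (at x)) \<le> B0"
    using assms(4) by metis
  \<comment> \<open>The maximum with 1 provides the strict positivity required by the Gronwall
    estimate.\<close>
  define B where "B = max B0 1"
  have B: "\<And>x. x \<in> \<Omega> \<Longrightarrow> onorm (frechet_derivative f (at x)) \<le> B" "B > 0"
    using order_trans[OF B0] by (auto simp: B_def)
  obtain Bg where Bg: "\<And>x t. x \<in> \<Omega> \<Longrightarrow> norm (g x t) \<le> Bg" using assms(7) by metis
  have Bg0: "Bg \<ge> 0" using order_trans[OF norm_ge_zero Bg[OF a(1)]] .
  obtain Bd0 where Bd0: "\<And>x t. x \<in> \<Omega> \<Longrightarrow> onorm (frechet_derivative (\<lambda>z. g z t) (at x)) \<le> Bd0"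
    using assms(8) by metis
  define Bd where "Bd = max Bd0 0"
  have Bd: "\<And>x t. x \<in> \<Omega> \<Longrightarrow> onorm (frechet_derivative (\<lambda>z. g z t) (at x)) \<le> Bd" "Bd \<ge> 0"
    using order_trans[OF Bd0] by (auto simp: Bd_def)
  have gC1: "C1_on \<Omega> (\<lambda>x. g x t)" for t using assms(5) C2_on_imp_C1_on by blast
  have gcont: "continuous_on \<Omega> (\<lambda>x. g x t)" for t
  proof -
    obtain D where "\<forall>x\<in>\<Omega>. ((\<lambda>x. g x t) has_derivative blinfun_apply (D x)) (at x within \<Omega>)"
      using gC1[of t] unfolding C1_on_def by blast
    then show ?thesis by (intro has_derivative_continuous_on) auto
  qed
  have gmeas: "\<And>x. x \<in> \<Omega> \<Longrightarrow> g x \<in> borel_measurable lebesgue" using assms(6) by blast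
  have jacB: "norm (jac f x *v v) \<le> B * norm v" if "x \<in> \<Omega>" for x v
  proof -
    have "bounded_linear ((*v) (jac f x))" by (rule matrix_vector_mul_bounded_linear)
    moreover have "(*v) (jac f x) = frechet_derivative f (at x)"
      by (rule ext) (rule jac_mult[OF open_\<Omega> C1_f that])
    ultimately have "norm (jac f x *v v) \<le> onorm (frechet_derivative f (at x)) * norm v"
      using onorm[of "(*v) (jac f x)" v] by simp
    also have "\<dots> \<le> B * norm v" by (intro mult_right_mono B(1) that) simp
    finally show ?thesis .
  qed
  obtain \<kappa> D where D: "\<kappa> > 0" "D > 0" "\<And>p \<alpha> \<tau>. p \<le> P \<Longrightarrow> \<alpha> \<in> {0..1} \<Longrightarrow> \<tau> \<le> p \<Longrightarrow>
    norm (adjoint_normal p \<alpha> \<tau>) \<le> D * exp (- \<kappa> * (p - \<tau>)) * norm (normal_vec f xb p \<alpha>)"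
    by (rule adjoint_decay[OF jacB less_imp_le[OF B(2)]]) (assumption, rule that)
  \<comment> \<open>The length of the normal at \<open>p\<close> is moved into the constant; it
    reappears as a factor of the final error and cancels on division by that length, however small
    it is.\<close>
  have decay: "norm (adjoint_normal p \<alpha> \<tau>) \<le> (D * norm (normal_vec f xb p \<alpha>)) * exp (- \<kappa> * (p - \<tau>))"
    if "p \<le> P" "\<alpha> \<in> {0..<1}" "\<tau> \<le> p" for p \<alpha> \<tau>
    using D(3)[of p \<alpha> \<tau>] that by (simp add: ac_simps)
  have integrable: "melnikov_integrand f g xb p \<alpha> t integrable_on {..p}" if "p \<le> P" "\<alpha> \<in> {0..<1}" for p \<alpha> t
    by (rule melnikov_integrand_bound(1)[OF gmeas gcont Bg D(1) decay[OF that] that(1)])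
  obtain CG0 where CG0: "\<forall>\<^sub>F \<epsilon> in at_right 0. \<forall>t\<le>T. \<forall>x\<in>\<Gamma> \<epsilon> t. infdist x (param_set a xb {..P}) \<le> CG0 * \<epsilon>"
    using assms(16) by blast
  obtain Cx0 where Cx0: "\<forall>\<^sub>F \<epsilon> in at_right 0. \<forall>p\<le>P. \<forall>\<alpha>\<in>{0..<1}. \<forall>t\<le>T. norm (xu p \<alpha> \<epsilon> t - xb p \<alpha>) \<le> Cx0 * \<epsilon>"
    using assms(18) by blast
  define CG Cx where "CG = max CG0 0" and "Cx = max Cx0 0"
  obtain C \<epsilon>0 where C: "C > 0" "\<epsilon>0 > 0" and shadow:
    "\<forall>\<epsilon> p \<alpha> Y G. 0 < \<epsilon> \<and> \<epsilon> < \<epsilon>0 \<and> p \<le> P \<and> \<alpha> \<in> {0..1} \<and>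
      (\<forall>u v. u \<le> v \<and> v \<le> p \<longrightarrow> ((\<lambda>\<tau>. f (Y \<tau>) + \<epsilon> *\<^sub>R G \<tau>) has_integral Y v - Y u) {u..v}) \<and>
      (\<forall>\<tau>\<le>p. norm (G \<tau>) \<le> Bg \<and> infdist (Y \<tau>) (param_set a xb {..P}) \<le> CG * \<epsilon>) \<and>
      norm (Y p - xb p \<alpha>) \<le> Cx * \<epsilon> \<longrightarrow> (\<forall>\<tau>\<le>p. norm (Y \<tau> - xb \<tau> \<alpha>) \<le> C * \<epsilon>)"
    by (rule shadowing[OF B Bg0, of CG Cx]) (assumption, simp add: CG_def, simp add: Cx_def, rule that)
  obtain S where S: "compact S" "S \<subseteq> \<Omega>" "\<And>p \<alpha>. p \<le> P \<Longrightarrow> \<alpha> \<in> {0..1} \<Longrightarrow> xb p \<alpha> \<in> S"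
    by (rule sheet_in_compact) (rule that)
  obtain \<eta> M where \<eta>: "\<eta> > 0" and M: "M > 0" "\<And>x. x \<in> S \<Longrightarrow> cball x \<eta> \<subseteq> \<Omega>"
    "\<And>x y. x \<in> S \<Longrightarrow> y \<in> cball x \<eta> \<Longrightarrow>
      norm (f y - f x - frechet_derivative f (at x) (y - x)) \<le> M * (norm (y - x))\<^sup>2"
    by (rule C2_on_quadratic_remainder[OF open_\<Omega> C2_f S(1,2)]) (rule that)
  \<comment> \<open>\<open>M * C\<^sup>2\<close> is the Taylor remainder of \<open>f\<close> at
    distance \<open>C * \<epsilon>\<close>, \<open>Bd * C\<close> the change of \<open>g\<close>
    over that distance, and \<open>D / \<kappa>\<close> the integral of the decaying weight relative
    to the length of the normal.\<close>
  define E where "E = D * (M * C\<^sup>2 + Bd * C) / \<kappa>"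
  have "0 < min \<epsilon>0 (\<eta> / C)" using C \<eta> by simp
  then have "\<forall>\<^sub>F \<epsilon> in at_right 0. \<epsilon> \<in> {0<..<min \<epsilon>0 (\<eta> / C)}"
    by (rule eventually_at_right_real)
  then have "\<forall>\<^sub>F \<epsilon> in at_right 0. \<forall>p\<le>P. \<forall>\<alpha>\<in>{0..<1}. \<forall>t\<le>T.
       \<bar>normal_displacement f xb xu p \<alpha> \<epsilon> t -
          \<epsilon> * (melnikov f g xb p \<alpha> t / norm (normal_vec f xb p \<alpha>))\<bar> \<le> E * \<epsilon>\<^sup>2"
    using assms(15) CG0 assms(17) Cx0
  proof eventually_elim
    case (elim \<epsilon>)
    then have \<epsilon>: "0 < \<epsilon>" "\<epsilon> < \<epsilon>0" "C * \<epsilon> < \<eta>" using C by (auto simp: field_simps)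
    show ?case
    proof (intro allI ballI impI)
      fix p \<alpha> t assume p: "p \<le> P" and \<alpha>: "\<alpha> \<in> {0..<1::real}" and t: "t \<le> T"
      have \<alpha>': "\<alpha> \<in> {0..1}" using \<alpha> by simp
      define N where "N = normal_vec f xb p \<alpha>"
      have N: "norm N > 0" using normal_nonzero[OF p, of \<alpha>] by (simp add: N_def)
      have "xu p \<alpha> \<epsilon> t \<in> \<Gamma> \<epsilon> t" using elim p \<alpha> t by blast
      \<comment> \<open>The backward trajectory is taken inside the slices of
        \<open>\<Gamma> \<epsilon>\<close>, so the distance bound to the sheet holds at every
        earlier time and not only at \<open>t\<close>.\<close>
      then obtain y where y: "trajectory_on (F \<epsilon>) \<Omega> {..t} y" "y t = xu p \<alpha> \<epsilon> t" "\<And>s. s \<le> t \<Longrightarrow> y s \<in> \<Gamma> \<epsilon> s"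
        using elim(2) t unfolding unstable_manifold_part_def by metis
      \<comment> \<open>The shift matches physical time \<open>t\<close> with the parameter value
        \<open>p\<close>; it produces the time argument \<open>\<tau> + t - p\<close> of
        \<open>g\<close>.\<close>
      define Y where "Y \<tau> = y (\<tau> + (t - p))" for \<tau>
      have Yp: "Y p = xu p \<alpha> \<epsilon> t" using y(2) by (simp add: Y_def)
      have YO: "Y \<tau> \<in> \<Omega>" if "\<tau> \<le> p" for \<tau>
        using y(1) that unfolding trajectory_on_def Y_def by auto
      have Yint: "((\<lambda>\<tau>. f (Y \<tau>) + \<epsilon> *\<^sub>R g (Y \<tau>) (\<tau> + (t - p))) has_integral Y v - Y u) {u..v}"
        if "u \<le> v" "v \<le> p" for u v
      proof -
        have "((\<lambda>\<tau>. F \<epsilon> (y \<tau>) \<tau>) has_integral y (v + (t - p)) - y (u + (t - p))) {u + (t - p)..v + (t - p)}"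
          using y(1) that unfolding trajectory_on_def by auto
        from has_integral_translate[OF this] show ?thesis by (simp add: F_def Y_def)
      qed
      have "\<forall>\<tau>\<le>p. norm (g (Y \<tau>) (\<tau> + (t - p))) \<le> Bg \<and> infdist (Y \<tau>) (param_set a xb {..P}) \<le> CG * \<epsilon>"
      proof (intro allI impI conjI)
        fix \<tau> assume \<tau>: "\<tau> \<le> p"
        show "norm (g (Y \<tau>) (\<tau> + (t - p))) \<le> Bg" using Bg YO[OF \<tau>] .
        have "infdist (Y \<tau>) (param_set a xb {..P}) \<le> CG0 * \<epsilon>"
          unfolding Y_def using \<tau> t by (intro elim(3)[rule_format, of "\<tau> + (t - p)"] y(3)) auto
        also have "\<dots> \<le> CG * \<epsilon>" using \<epsilon> by (intro mult_right_mono) (auto simp: CG_def)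
        finally show "infdist (Y \<tau>) (param_set a xb {..P}) \<le> CG * \<epsilon>" .
      qed
      moreover have "norm (Y p - xb p \<alpha>) \<le> Cx * \<epsilon>"
      proof -
        have "norm (xu p \<alpha> \<epsilon> t - xb p \<alpha>) \<le> Cx0 * \<epsilon>" using elim p \<alpha> t by blast
        also have "\<dots> \<le> Cx * \<epsilon>" using \<epsilon> by (intro mult_right_mono) (auto simp: Cx_def)
        finally show ?thesis by (simp add: Yp)
      qed
      ultimately have close: "norm (Y \<tau> - xb \<tau> \<alpha>) \<le> C * \<epsilon>" if "\<tau> \<le> p" for \<tau>
        using shadow[rule_format, of \<epsilon> p \<alpha> Y "\<lambda>\<tau>. g (Y \<tau>) (\<tau> + (t - p))" \<tau>] \<epsilon> p \<alpha>' Yint that by blast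
      have inS: "xb \<tau> \<alpha> \<in> S" if "\<tau> \<le> p" for \<tau> using S(3) \<alpha>' that p by auto
      have incb: "Y \<tau> \<in> cball (xb \<tau> \<alpha>) \<eta>" if "\<tau> \<le> p" for \<tau>
        using close[OF that] \<epsilon>(3) by (simp add: dist_norm norm_minus_commute)
      have f_quad: "norm (f (Y \<tau>) - f (xb \<tau> \<alpha>) - jac f (xb \<tau> \<alpha>) *v (Y \<tau> - xb \<tau> \<alpha>)) \<le> (M * C\<^sup>2) * \<epsilon>\<^sup>2"
        if "\<tau> \<le> p" for \<tau>
      proof -
        have "norm (f (Y \<tau>) - f (xb \<tau> \<alpha>) - jac f (xb \<tau> \<alpha>) *v (Y \<tau> - xb \<tau> \<alpha>)) \<le> M * (norm (Y \<tau> - xb \<tau> \<alpha>))\<^sup>2"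
          using M(3)[OF inS incb, OF that that] jac_mult[OF open_\<Omega> C1_f, of "xb \<tau> \<alpha>"] S(2) inS[OF that] by auto
        also have "\<dots> \<le> M * (C * \<epsilon>)\<^sup>2"
          using M(1) close[OF that] by (intro mult_left_mono power_mono) auto
        finally show ?thesis by (simp add: power_mult_distrib)
      qed
      have g_lip: "norm (g (Y \<tau>) (\<tau> + (t - p)) - g (xb \<tau> \<alpha>) (\<tau> + (t - p))) \<le> (Bd * C) * \<epsilon>" if "\<tau> \<le> p" for \<tau>
      proof -
        have "norm (g (Y \<tau>) (\<tau> + (t - p)) - g (xb \<tau> \<alpha>) (\<tau> + (t - p))) \<le> Bd * norm (Y \<tau> - xb \<tau> \<alpha>)"
          by (rule C1_on_cball_lipschitz[OF open_\<Omega> gC1 Bd(1) M(2)[OF inS[OF that]] incb[OF that]])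
        also have "\<dots> \<le> Bd * (C * \<epsilon>)" using close[OF that] Bd(2) by (intro mult_left_mono) auto
        finally show ?thesis by (simp add: mult.assoc)
      qed
      have "\<bar>N \<bullet> (Y p - xb p \<alpha>) - \<epsilon> * melnikov f g xb p \<alpha> t\<bar> \<le> (D * norm N) * (M * C\<^sup>2 + Bd * C) * \<epsilon>\<^sup>2 / \<kappa>"
        unfolding N_def
        by (rule normal_deviation_estimate[OF f_quad g_lip gmeas gcont Bg D(1) decay[OF p \<alpha>] p \<epsilon>(1) Yint YO close])
      also have "\<dots> = norm N * (E * \<epsilon>\<^sup>2)" by (simp add: E_def)
      finally have est: "\<bar>N \<bullet> (Y p - xb p \<alpha>) - \<epsilon> * melnikov f g xb p \<alpha> t\<bar> \<le> norm N * (E * \<epsilon>\<^sup>2)" .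
      have "normal_displacement f xb xu p \<alpha> \<epsilon> t - \<epsilon> * (melnikov f g xb p \<alpha> t / norm N)
          = (N \<bullet> (Y p - xb p \<alpha>) - \<epsilon> * melnikov f g xb p \<alpha> t) / norm N"
        by (simp add: normal_displacement_def N_def[symmetric] Yp divide_inverse algebra_simps)
      then have "\<bar>normal_displacement f xb xu p \<alpha> \<epsilon> t - \<epsilon> * (melnikov f g xb p \<alpha> t / norm N)\<bar>
          = \<bar>N \<bullet> (Y p - xb p \<alpha>) - \<epsilon> * melnikov f g xb p \<alpha> t\<bar> / norm N"
        using N by simp
      also have "\<dots> \<le> E * \<epsilon>\<^sup>2" using est N by (simp add: divide_le_eq mult.commute)
      finally show "\<bar>normal_displacement f xb xu p \<alpha> \<epsilon> t -
          \<epsilon> * (melnikov f g xb p \<alpha> t / norm (normal_vec f xb p \<alpha>))\<bar> \<le> E * \<epsilon>\<^sup>2" by (simp add: N_def)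
    qed
  qed
  with integrable show ?thesis by blast
qed

end
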